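(* Let $\mathcal{A}\subset M_n(\mathbb{F}_q)$ be an $\mathbb{F}_q$-subalgebra of dimension $m$ with basis $v_1,\dots,v_m$, let $\mathbf{t}=(t_1,\dots,t_m)$ be indeterminates, $K=\mathbb{F}_q(\mathbf{t})$, and $A(\mathbf{t})=\sum_{i=1}^mt_iv_i\in\mathrm{GL}_n(K)$. Let $N\in\mathrm{GL}_n(K)$ be such that $N^{-1}A N^{(q)}=\Delta$, where $\Delta$ is the matrix with $1$'s on the subdiagonal, last column $(a_0,\dots,a_{n-1})^T$ ($a_i\in K$) and all other entries $0$, and let $f(Y;\mathbf{t})=Y^{q^n}-a_0Y-a_1Y^q-\cdots-a_{n-1}Y^{q^{n-1}}\in\mathbb{F}_q(\mathbf{t})[Y]$. Then $f(Y;\mathbf{t})$ is $\mathcal{A}^\times$-generic over every infinite field $k$ containing $\mathbb{F}_q$.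
   Context: $N^{(q)}$ denotes entrywise $q$-th power. Definition: for a field $k$ and a finite group $G$, a monic separable polynomial $f(Y;\mathbf{t})\in k(\mathbf{t})[Y]$, $\mathbf{t}=(t_1,\dots,t_m)$, is $G$-generic over $k$ if (1) the Galois group of $f$ over $k(\mathbf{t})$ is isomorphic to $G$, and (2) every Galois $G$-extension $M/L$, where $L$ is a field containing $k$, is the splitting field over $L$ of a specialization $f(Y;\boldsymbol\xi)$ for some $\boldsymbol\xi\in L^m$. *)

theory Defs
  imports "HOL-Computational_Algebra.Polynomial" "HOL-Algebra.Group"
begin

definition field_hom :: "('a::field \<Rightarrow> 'b::field) \<Rightarrow> bool" where
  "field_hom h \<longleftrightarrow> h 0 = 0 \<and> h 1 = 1 \<and> (\<forall>x y. h (x + y) = h x + h y) \<and> (\<forall>x y. h (x * y) = h x * h y)"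

definition is_subfield :: "'a::field set \<Rightarrow> bool" where
  "is_subfield S \<longleftrightarrow> 0 \<in> S \<and> 1 \<in> S \<and> (\<forall>x\<in>S. \<forall>y\<in>S. x + y \<in> S \<and> x * y \<in> S)
     \<and> (\<forall>x\<in>S. - x \<in> S \<and> inverse x \<in> S)"

definition gen_field :: "'a::field set \<Rightarrow> 'a set" where
  "gen_field X = \<Inter>{S. is_subfield S \<and> X \<subseteq> S}"

definition splits_in :: "('a::field \<Rightarrow> 'b::field) \<Rightarrow> 'a poly \<Rightarrow> bool" where
  "splits_in e g \<longleftrightarrow> (\<exists>rs. map_poly e g =
      smult (lead_coeff (map_poly e g)) (prod_list (map (\<lambda>r. [:- r, 1:]) rs)))"

definition is_splitting_field :: "('a::field \<Rightarrow> 'b::field) \<Rightarrow> 'a poly \<Rightarrow> bool" where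
  "is_splitting_field e g \<longleftrightarrow> field_hom e \<and> g \<noteq> 0 \<and> splits_in e g \<and>
      gen_field (range e \<union> {r. poly (map_poly e g) r = 0}) = UNIV"

definition Aut :: "('a::field \<Rightarrow> 'b::field) \<Rightarrow> ('b \<Rightarrow> 'b) set" where
  "Aut e = {\<sigma>. bij \<sigma> \<and> field_hom \<sigma> \<and> (\<forall>x. \<sigma> (e x) = e x)}"

definition aut_group :: "('a::field \<Rightarrow> 'b::field) \<Rightarrow> ('b \<Rightarrow> 'b) monoid" where
  "aut_group e = \<lparr>carrier = Aut e, mult = (\<circ>), one = id\<rparr>"

definition finite_ext :: "('a::field \<Rightarrow> 'b::field) \<Rightarrow> bool" where
  "finite_ext e \<longleftrightarrow> (\<exists>B. finite B \<and> (\<forall>x. \<exists>c. x = (\<Sum>b\<in>B. e (c b) * b)))"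

definition galois_ext :: "('a::field \<Rightarrow> 'b::field) \<Rightarrow> bool" where
  "galois_ext e \<longleftrightarrow> field_hom e \<and> finite_ext e \<and> {x. \<forall>\<sigma>\<in>Aut e. \<sigma> x = x} = range e"

text \<open>Exponent vectors of monomials in the variables t_0, ..., t_(m-1).\<close>
definition exps :: "nat \<Rightarrow> (nat \<Rightarrow> nat) set" where
  "exps m = {\<alpha>. \<forall>j\<ge>m. \<alpha> j = 0}"

definition mpeval :: "nat \<Rightarrow> ('a \<Rightarrow> 'b::comm_ring_1) \<Rightarrow> (nat \<Rightarrow> nat) set \<Rightarrow> ((nat \<Rightarrow> nat) \<Rightarrow> 'a) \<Rightarrow> (nat \<Rightarrow> 'b) \<Rightarrow> 'b" where
  "mpeval m h S c x = (\<Sum>\<alpha>\<in>S. h (c \<alpha>) * (\<Prod>j<m. x j ^ \<alpha> j))"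

definition is_rat_fun_field :: "nat \<Rightarrow> ('k::field \<Rightarrow> 'K::field) \<Rightarrow> (nat \<Rightarrow> 'K) \<Rightarrow> bool" where
  "is_rat_fun_field m e t \<longleftrightarrow> field_hom e \<and>
     (\<forall>S c. finite S \<and> S \<subseteq> exps m \<and> mpeval m e S c t = 0 \<longrightarrow> (\<forall>\<alpha>\<in>S. c \<alpha> = 0)) \<and>
     (\<forall>x. \<exists>S P Q. finite S \<and> S \<subseteq> exps m \<and> mpeval m e S Q t \<noteq> 0 \<and>
            x = mpeval m e S P t / mpeval m e S Q t)"

definition rat_funs :: "nat \<Rightarrow> ('f \<Rightarrow> 'K::field) \<Rightarrow> (nat \<Rightarrow> 'K) \<Rightarrow> 'K set" where
  "rat_funs m h t = {x. \<exists>S P Q. finite S \<and> S \<subseteq> exps m \<and> mpeval m h S Q t \<noteq> 0 \<and>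
            x = mpeval m h S P t / mpeval m h S Q t}"

definition specializes :: "nat \<Rightarrow> ('k::field \<Rightarrow> 'K::field) \<Rightarrow> (nat \<Rightarrow> 'K) \<Rightarrow> ('k \<Rightarrow> 'L::field)
     \<Rightarrow> (nat \<Rightarrow> 'L) \<Rightarrow> 'K \<Rightarrow> 'L \<Rightarrow> bool" where
  "specializes m e t eL \<xi> x y \<longleftrightarrow> (\<exists>S P Q. finite S \<and> S \<subseteq> exps m \<and>
      mpeval m e S Q t \<noteq> 0 \<and> x = mpeval m e S P t / mpeval m e S Q t \<and>
      mpeval m eL S Q \<xi> \<noteq> 0 \<and> y = mpeval m eL S P \<xi> / mpeval m eL S Q \<xi>)"

section \<open>n \<times> n matrices, represented as functions nat \<Rightarrow> nat \<Rightarrow> 'a that vanish outside {0..<n}^2\<close>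

definition Mn :: "nat \<Rightarrow> (nat \<Rightarrow> nat \<Rightarrow> 'a::zero) set" where
  "Mn n = {X. \<forall>i j. (n \<le> i \<or> n \<le> j) \<longrightarrow> X i j = 0}"

definition mat_mul :: "nat \<Rightarrow> (nat \<Rightarrow> nat \<Rightarrow> 'a::comm_semiring_1) \<Rightarrow> (nat \<Rightarrow> nat \<Rightarrow> 'a) \<Rightarrow> (nat \<Rightarrow> nat \<Rightarrow> 'a)" where
  "mat_mul n X Y = (\<lambda>i j. if i < n \<and> j < n then (\<Sum>k<n. X i k * Y k j) else 0)"

definition mat_one :: "nat \<Rightarrow> (nat \<Rightarrow> nat \<Rightarrow> 'a::comm_semiring_1)" where
  "mat_one n = (\<lambda>i j. if i < n \<and> j < n \<and> i = j then 1 else 0)"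

definition is_subalgebra :: "nat \<Rightarrow> (nat \<Rightarrow> nat \<Rightarrow> 'a::field) set \<Rightarrow> bool" where
  "is_subalgebra n \<A> \<longleftrightarrow> \<A> \<subseteq> Mn n \<and> mat_one n \<in> \<A> \<and> (\<lambda>i j. 0) \<in> \<A> \<and>
     (\<forall>X\<in>\<A>. \<forall>Y\<in>\<A>. (\<lambda>i j. X i j + Y i j) \<in> \<A> \<and> mat_mul n X Y \<in> \<A>) \<and>
     (\<forall>c. \<forall>X\<in>\<A>. (\<lambda>i j. c * X i j) \<in> \<A>)"

definition is_basis :: "nat \<Rightarrow> (nat \<Rightarrow> nat \<Rightarrow> 'a::field) set \<Rightarrow> nat \<Rightarrow> (nat \<Rightarrow> nat \<Rightarrow> nat \<Rightarrow> 'a) \<Rightarrow> bool" where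
  "is_basis n \<A> m v \<longleftrightarrow> (\<forall>i<m. v i \<in> \<A>) \<and>
     (\<forall>c. (\<lambda>r s. \<Sum>i<m. c i * v i r s) = (\<lambda>r s. 0) \<longrightarrow> (\<forall>i<m. c i = 0)) \<and>
     (\<forall>X\<in>\<A>. \<exists>c. X = (\<lambda>r s. \<Sum>i<m. c i * v i r s))"

definition units_group :: "nat \<Rightarrow> (nat \<Rightarrow> nat \<Rightarrow> 'a::field) set \<Rightarrow> (nat \<Rightarrow> nat \<Rightarrow> 'a) monoid" where
  "units_group n \<A> = \<lparr>carrier = {X\<in>\<A>. \<exists>Y\<in>\<A>. mat_mul n X Y = mat_one n \<and> mat_mul n Y X = mat_one n},
     mult = mat_mul n, one = mat_one n\<rparr>"

definition Delta :: "nat \<Rightarrow> (nat \<Rightarrow> 'a::comm_semiring_1) \<Rightarrow> (nat \<Rightarrow> nat \<Rightarrow> 'a)" where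
  "Delta n a = (\<lambda>i j. if i < n \<and> j < n then (if j = n - 1 then a i else if i = j + 1 then 1 else 0) else 0)"

definition f_poly :: "nat \<Rightarrow> nat \<Rightarrow> (nat \<Rightarrow> 'a::comm_ring_1) \<Rightarrow> 'a poly" where
  "f_poly q n a = monom 1 (q ^ n) - (\<Sum>i<n. monom (a i) (q ^ i))"

end

(*
  Solutions U of U^(q) = U A, with A a unit of the scalar extension of the algebra, correspond to
  Z = U N with Z^(q) = Z Delta, and the rows of such a Z are (y, y^q, ..., y^(q^(n-1))) for roots y
  of f.  By Frobenius descent and a count of annihilators, an invertible solution in GL_n can be
  replaced by one that is a unit U of the algebra.  For the generic A(t) the coordinates u of U are
  algebraically independent: D(t) is algebraic over k(xi), where xi = t^(-1) t^(q), and the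
  specialization t -> u maps xi to t.  So the splitting field is the rational function field k(u),
  and the units c of the algebra act on it by u -> c u.

  Conversely, Galois descent (Hilbert 90) writes a Galois extension M/L with the given group as
  generated by the coordinates of a unit U with sigma U = c_sigma U.  Then U^(-1) U^(q) is defined
  over L, and since L is infinite and xi is algebraically independent, U can be chosen so that it
  avoids the zeros of the denominators of N, N^(-1) and the a_i.
*)

theory Submission
  imports "Jordan_Normal_Form.Determinant" "HOL-Algebra.Algebraic_Closure_Type"
    "HOL-Library.Function_Algebras" Defs
begin

hide_const (open) up_ring.coeff up_ring.monom Polynomials.degree Polynomials.lead_coeff

section \<open>Field homomorphisms and the Frobenius map\<close>

text \<open>The main obstacle is that a specialization is only a partial map on the rational
  function field. It is treated as a relation, \<open>rrel\<close>, between the values of one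
  fraction of polynomials at two points. The relation respects the field operations, and algebraic
  independence of \<open>t\<close> makes it single-valued, so polynomial identities transfer without
  constructing a polynomial ring. That K is algebraic over k(xi) has an elementary cause: each
  \<open>t i ^ q\<close> is a k(xi)-linear combination of the \<open>t l\<close>, so the monomials
  with exponents below \<open>q\<close> span all polynomials in \<open>t\<close>. This takes the
  place of transcendence degree. The annihilator count is there because the solutions inside the
  scalar extension form a left module over the algebra which has the right size but is not visibly
  free of rank one. An element with zero annihilator generates it, and comparison with the algebra
  itself supplies one. Frobenius descent and Galois descent share a shape: the fixed vectors of a
  semilinear action span the space. In the Galois case the combinations of fixed vectors with
  coefficients in L are again fixed, and as L is infinite a nonzero polynomial cannot vanish at all
  of them.\<close>

lemma field_homD:
  assumes "field_hom h"
  shows "h 0 = 0" "h 1 = 1" "h (x + y) = h x + h y" "h (x * y) = h x * h y"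
  using assms unfolding field_hom_def by auto

lemma field_hom_comp: "field_hom g \<Longrightarrow> field_hom h \<Longrightarrow> field_hom (g \<circ> h)"
  unfolding field_hom_def by auto

lemma field_hom_uminus: "field_hom h \<Longrightarrow> h (- x) = - h x"
  by (metis add_eq_0_iff field_homD(1,3))

lemma field_hom_diff: "field_hom h \<Longrightarrow> h (x - y) = h x - h y"
  using field_homD(3)[of h x "- y"] by (simp add: field_hom_uminus)

lemma field_hom_eq_0_iff:
  assumes h: "field_hom h"
  shows "h x = 0 \<longleftrightarrow> x = 0"
proof
  assume "h x = 0"
  then have "h (x * inverse x) = 0" by (simp add: field_homD[OF h])
  then have "x * inverse x \<noteq> 1" using field_homD(2)[OF h] by auto
  then show "x = 0" by (auto dest: right_inverse)
qed (simp add: field_homD[OF h])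

lemma field_hom_inj: "field_hom h \<Longrightarrow> inj h"
  by (rule injI) (metis eq_iff_diff_eq_0 field_hom_diff field_hom_eq_0_iff)

lemma field_hom_eq_iff: "field_hom h \<Longrightarrow> h x = h y \<longleftrightarrow> x = y"
  using field_hom_inj by (metis injD)

lemma field_hom_inverse: "field_hom h \<Longrightarrow> h (inverse x) = inverse (h x)"
proof (cases "x = 0")
  case False
  then have "h x * h (inverse x) = 1"
    if "field_hom h" using field_homD(2,4)[OF that] by (metis right_inverse)
  then show "field_hom h \<Longrightarrow> ?thesis" by (metis inverse_unique)
qed (simp add: field_homD)

lemma field_hom_divide: "field_hom h \<Longrightarrow> h (x / y) = h x / h y"
  by (simp add: divide_inverse field_homD(4) field_hom_inverse)

lemma field_hom_power: "field_hom h \<Longrightarrow> h (x ^ k) = h x ^ k"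
  by (induction k) (simp_all add: field_homD)

lemma field_hom_sum: "field_hom h \<Longrightarrow> h (sum f A) = (\<Sum>i\<in>A. h (f i))"
  by (induction A rule: infinite_finite_induct) (simp_all add: field_homD)

lemma field_hom_prod: "field_hom h \<Longrightarrow> h (prod f A) = (\<Prod>i\<in>A. h (f i))"
  by (induction A rule: infinite_finite_induct) (simp_all add: field_homD)

lemmas field_hom_simps = field_homD field_hom_uminus field_hom_diff field_hom_divide
  field_hom_inverse field_hom_power field_hom_sum field_hom_prod

section \<open>The finite base field and the q-power map on its extensions\<close>

lemma card_finite_field_gt_1: "card (UNIV :: 'f::{finite,field} set) > 1"
proof -
  have "card {0, 1 :: 'f} \<le> card (UNIV :: 'f set)" by (intro card_mono) auto
  then show ?thesis by simp
qed

text \<open>The translation by 1 permutes the field, so the sum of all elements does not change when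
  1 is added to each of the q summands.\<close>

lemma of_nat_card_finite_field: "of_nat (card (UNIV :: 'f::{finite,field} set)) = (0 :: 'f)"
proof -
  have "(\<Sum>c\<in>UNIV. c + (1::'f)) = (\<Sum>c\<in>UNIV. c)"
    by (rule sum.reindex_bij_witness[of _ "\<lambda>c. c - 1" "\<lambda>c. c + 1"]) auto
  then show ?thesis by (simp add: sum.distrib)
qed

text \<open>Multiplication by a nonzero \<open>x\<close> permutes the nonzero elements, so their
  product absorbs the factor \<open>x ^ (q - 1)\<close>.\<close>

lemma finite_field_pow_card: "(x :: 'f::{finite,field}) ^ card (UNIV :: 'f set) = x"
proof (cases "x = 0")
  case False
  have "(\<Prod>y\<in>UNIV-{0}. x * y) = (\<Prod>y\<in>UNIV-{0}. y)"
    by (rule prod.reindex_bij_witness[of _ "\<lambda>y. y / x" "\<lambda>y. x * y"]) (use False in auto)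
  then have "x ^ (card (UNIV :: 'f set) - 1) = 1"
    by (simp add: prod.distrib)
  then have "x ^ Suc (card (UNIV :: 'f set) - 1) = x" by simp
  then show ?thesis using card_finite_field_gt_1[where 'f = 'f] by simp
next
  case True
  have "0 < card (UNIV :: 'f set)" using card_finite_field_gt_1[where 'f = 'f] by linarith
  then show ?thesis unfolding True by (rule zero_power)
qed

text \<open>Both sides are values of polynomials of degree q with equal leading coefficients, and
  these agree at the q points of \<open>range h\<close>. The factorization yields the fixed field of
  Frobenius and also its additivity.\<close>

lemma frob_eq_prod:
  fixes h :: "'f::{finite,field} \<Rightarrow> 'e::field"
  assumes h: "field_hom h"
  shows "(x :: 'e) ^ card (UNIV :: 'f set) - x = (\<Prod>c\<in>UNIV. x - h c)"
proof -
  let ?q = "card (UNIV :: 'f set)"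
  define p where "p = monom 1 ?q - [:0, 1 :: 'e:]"
  have q: "?q > 1" by (rule card_finite_field_gt_1)
  have deg: "degree p = ?q"
    unfolding p_def using q by (intro antisym degree_le le_degree) (auto simp: coeff_pCons split: nat.splits)
  have "p = (\<Prod>c\<in>UNIV. [:- h c, 1:])"
  proof (rule poly_eqI_degree_lead_coeff[where A = "range h" and n = ?q])
    show "coeff p ?q = coeff (\<Prod>c\<in>UNIV. [:- h c, 1:]) ?q"
    proof -
      have "degree (\<Prod>c\<in>UNIV. [:- h c, 1:]) = ?q"
        by (subst degree_prod_eq_sum_degree) auto
      moreover have "lead_coeff (\<Prod>c\<in>UNIV. [:- h c, 1:]) = 1"
        by (simp add: lead_coeff_prod)
      ultimately show ?thesis using q by (simp add: p_def coeff_pCons split: nat.splits)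
    qed
    show "?q \<le> card (range h)" using card_image[OF field_hom_inj[OF h]] by simp
    show "poly p x = poly (\<Prod>c\<in>UNIV. [:- h c, 1:]) x" if "x \<in> range h" for x
    proof -
      from that obtain c where c: "x = h c" by auto
      have "(\<Prod>d\<in>UNIV. h c - h d) = 0" by (rule prod_zero) auto
      then show ?thesis
        using field_hom_power[OF h, of c ?q] by (simp add: c p_def poly_monom poly_prod finite_field_pow_card)
    qed
  qed (use deg in \<open>auto simp: degree_prod_eq_sum_degree\<close>)
  from arg_cong[OF this, of "\<lambda>p. poly p x"] show ?thesis
    by (simp add: p_def poly_monom poly_prod)
qed

text \<open>A product in a field vanishes only through a factor \<open>x - h c\<close>. This is the
  criterion by which every later argument recognizes that an element comes from the finite
  field.\<close>

lemma frob_fixed_iff: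
  fixes h :: "'f::{finite,field} \<Rightarrow> 'e::field"
  assumes h: "field_hom h"
  shows "(x :: 'e) ^ card (UNIV :: 'f set) = x \<longleftrightarrow> x \<in> range h"
proof -
  have "x ^ card (UNIV :: 'f set) = x \<longleftrightarrow> (\<Prod>c\<in>UNIV. x - h c) = 0"
    unfolding frob_eq_prod[OF h, symmetric] by simp
  then show ?thesis by auto
qed

text \<open>No factorization of \<open>q\<close> is needed: \<open>x ^ q - x\<close> is invariant under translation by the base
  field, so additivity holds at \<open>q\<close> points, and both sides are monic in \<open>x\<close> of degree \<open>q\<close>.\<close>

lemma frob_add:
  fixes h :: "'f::{finite,field} \<Rightarrow> 'e::field"
  assumes h: "field_hom h"
  shows "(x + y :: 'e) ^ card (UNIV :: 'f set) = x ^ card (UNIV :: 'f set) + y ^ card (UNIV :: 'f set)"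
proof -
  let ?q = "card (UNIV :: 'f set)"
  have q: "?q > 1" by (rule card_finite_field_gt_1)
  have shift: "(h c + y) ^ ?q - (h c + y) = y ^ ?q - y" for c
    unfolding frob_eq_prod[OF h]
    by (rule prod.reindex_bij_witness[of _ "\<lambda>d. d + c" "\<lambda>d. d - c"]) (auto simp: field_hom_simps[OF h])
  have hc: "h c ^ ?q = h c" for c using frob_fixed_iff[OF h] by auto
  have "[:y, 1:] ^ ?q = monom 1 ?q + [:y ^ ?q:]"
  proof (rule poly_eqI_degree_lead_coeff[where A = "range h" and n = ?q])
    show "?q \<le> card (range h)" using card_image[OF field_hom_inj[OF h]] by simp
    show "coeff ([:y, 1:] ^ ?q) ?q = coeff (monom 1 ?q + [:y ^ ?q:]) ?q"
      using q by (simp add: coeff_linear_power coeff_pCons split: nat.splits)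
    show "poly ([:y, 1:] ^ ?q) x = poly (monom 1 ?q + [:y ^ ?q:]) x" if "x \<in> range h" for x
      using that shift hc by (auto simp: poly_monom algebra_simps)
    show "degree (monom 1 ?q + [:y ^ ?q:]) \<le> ?q" by (intro degree_add_le degree_monom_le) simp
  qed (simp add: degree_linear_power)
  from arg_cong[OF this, of "\<lambda>p. poly p x"] show ?thesis
    by (simp add: poly_monom add.commute)
qed

lemma frob_field_hom:
  fixes h :: "'f::{finite,field} \<Rightarrow> 'e::field"
  assumes "field_hom h"
  shows "field_hom (\<lambda>x::'e. x ^ card (UNIV :: 'f set))"
proof -
  have "0 < card (UNIV :: 'f set)" using card_finite_field_gt_1[where 'f = 'f] by linarith
  then have "(0 :: 'e) ^ card (UNIV :: 'f set) = 0" by (rule zero_power)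
  then show ?thesis
    unfolding field_hom_def by (metis power_one power_mult_distrib frob_add[OF assms])
qed

lemma frob_field_hom_iter:
  fixes h :: "'f::{finite,field} \<Rightarrow> 'e::field"
  assumes "field_hom h"
  shows "field_hom (\<lambda>x::'e. x ^ (card (UNIV :: 'f set) ^ i))"
proof (induction i)
  case 0
  then show ?case by (simp add: field_hom_def)
next
  case (Suc i)
  show ?case
    using field_hom_comp[OF frob_field_hom[OF assms] Suc] by (simp add: o_def power_mult[symmetric] mult.commute)
qed

lemma of_nat_card_eq_0:
  fixes h :: "'f::{finite,field} \<Rightarrow> 'e::field"
  assumes h: "field_hom h"
  shows "of_nat (card (UNIV :: 'f set)) = (0 :: 'e)"
proof -
  have "h (of_nat k) = of_nat k" for k by (induction k) (simp_all add: field_homD[OF h])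
  from this[of "card (UNIV :: 'f set)"] show ?thesis
    by (simp add: of_nat_card_finite_field field_homD[OF h])
qed

section \<open>Frobenius descent\<close>

lemma (in vector_space) card_span_independent:
  assumes "finite B" "independent B" "finite (UNIV :: 'a set)"
  shows "card (span B) = card (UNIV :: 'a set) ^ card B"
proof -
  define \<Theta> where "\<Theta> c = (\<Sum>b\<in>B. scale (c b) b)" for c
  have "bij_betw \<Theta> (B \<rightarrow>\<^sub>E UNIV) (span B)"
    unfolding bij_betw_def
  proof
    show "inj_on \<Theta> (B \<rightarrow>\<^sub>E UNIV)"
    proof (rule inj_onI)
      fix c d assume cd: "c \<in> B \<rightarrow>\<^sub>E UNIV" "d \<in> B \<rightarrow>\<^sub>E UNIV" and eq: "\<Theta> c = \<Theta> d"
      have "(\<Sum>b\<in>B. scale (c b - d b) b) = 0"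
        using eq unfolding \<Theta>_def by (simp add: scale_left_diff_distrib sum_subtractf)
      then have "c b - d b = 0" if "b \<in> B" for b
        using independentD[OF assms(2,1) order_refl _ that, of "\<lambda>b. c b - d b"] by simp
      then have "c b = d b" if "b \<in> B" for b using that by simp
      then show "c = d" using cd by (metis PiE_ext)
    qed
    show "\<Theta> ` (B \<rightarrow>\<^sub>E UNIV) = span B"
    proof (intro equalityI subsetI)
      fix x assume "x \<in> span B"
      then obtain u where "x = (\<Sum>b\<in>B. scale (u b) b)" using span_finite[OF assms(1)] by auto
      then have "x = \<Theta> (restrict u B)" unfolding \<Theta>_def by simp
      moreover have "restrict u B \<in> B \<rightarrow>\<^sub>E UNIV" by simp
      ultimately show "x \<in> \<Theta> ` (B \<rightarrow>\<^sub>E UNIV)" by (metis image_eqI)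
    qed (auto simp: \<Theta>_def intro: span_sum span_scale span_base)
  qed
  then show ?thesis using assms by (simp add: bij_betw_same_card[symmetric] card_PiE)
qed

interpretation fs: vector_space "\<lambda>(c::'e::field) (x::'y \<Rightarrow> 'e) i. c * x i"
  by unfold_locales (auto simp: fun_eq_iff algebra_simps)

lemma sum_fun_apply: "(\<Sum>b\<in>B. f b) i = (\<Sum>b\<in>B. f b i)" for f :: "'b \<Rightarrow> 'c \<Rightarrow> 'd::comm_monoid_add"
  by (induction B rule: infinite_finite_induct) auto

text \<open>The image of \<open>V\<close> under the linear injection \<open>\<psi>\<close> is a
  subspace of a finite coordinate space that is stable under entrywise q-th powers, hence should
  have a form over the finite field. The map \<open>\<psi>\<close> is kept apart from
  \<open>V\<close> because two different \<open>\<psi>\<close> on the same \<open>V\<close> are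
  compared later.\<close>

locale frobenius_structure =
  fixes h :: "'f::{finite,field} \<Rightarrow> 'e::field"
    and V :: "('y \<Rightarrow> 'e) set"
    and \<psi> :: "('y \<Rightarrow> 'e) \<Rightarrow> 'x \<Rightarrow> 'e"
    and I :: "'x set"
  assumes hom: "field_hom h"
    and subspace: "fs.subspace V"
    and \<psi>_add: "\<And>x y. x \<in> V \<Longrightarrow> y \<in> V \<Longrightarrow> \<psi> (x + y) = \<psi> x + \<psi> y"
    and \<psi>_scale: "\<And>c x. x \<in> V \<Longrightarrow> \<psi> (\<lambda>i. c * x i) = (\<lambda>i. c * \<psi> x i)"
    and \<psi>_eq_0: "\<And>x. x \<in> V \<Longrightarrow> \<psi> x = 0 \<Longrightarrow> x = 0"
    and finite_I: "finite I"
    and support: "\<And>x i. x \<in> V \<Longrightarrow> i \<notin> I \<Longrightarrow> \<psi> x i = 0"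
    and frob: "\<And>x. x \<in> V \<Longrightarrow> \<exists>x'\<in>V. \<psi> x' = (\<lambda>i. \<psi> x i ^ card (UNIV :: 'f set))"
begin

definition VF where "VF = {x\<in>V. \<forall>i. \<psi> x i \<in> range h}"

lemma VF_subset: "VF \<subseteq> V" unfolding VF_def by auto

lemma \<psi>_0: "\<psi> 0 = 0"
  using \<psi>_scale[of 0 0] fs.subspace_0[OF subspace] by (auto simp: zero_fun_def)

lemma \<psi>_diff: "x \<in> V \<Longrightarrow> y \<in> V \<Longrightarrow> \<psi> (x - y) = \<psi> x - \<psi> y"
proof -
  assume xy: "x \<in> V" "y \<in> V"
  have "\<psi> (x + (\<lambda>i. - 1 * y i)) = \<psi> x + (\<lambda>i. - 1 * \<psi> y i)"
    using xy fs.subspace_scale[OF subspace xy(2), of "- 1"] by (simp only: \<psi>_add \<psi>_scale)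
  moreover have "x + (\<lambda>i. - 1 * y i) = x - y" "\<psi> x + (\<lambda>i. - 1 * \<psi> y i) = \<psi> x - \<psi> y"
    by (auto simp: fun_eq_iff)
  ultimately show ?thesis by simp
qed

lemma \<psi>_sum:
  assumes "B \<subseteq> V"
  shows "\<psi> (\<Sum>b\<in>B. (\<lambda>i. u b * b i)) i = (\<Sum>b\<in>B. u b * \<psi> b i)"
proof -
  have "(\<Sum>b\<in>B. (\<lambda>i. u b * b i)) \<in> V \<and> \<psi> (\<Sum>b\<in>B. (\<lambda>i. u b * b i)) i = (\<Sum>b\<in>B. u b * \<psi> b i)"
    using assms
  proof (induction B rule: infinite_finite_induct)
    case (insert x F)
    then have xV: "x \<in> V" by simp
    have A: "(\<lambda>i. u x * x i) \<in> V" using fs.subspace_scale[OF subspace xV] .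
    have B: "(\<Sum>b\<in>F. (\<lambda>i. u b * b i)) \<in> V"
      "\<psi> (\<Sum>b\<in>F. (\<lambda>i. u b * b i)) i = (\<Sum>b\<in>F. u b * \<psi> b i)"
      using insert by auto
    show ?case
      unfolding sum.insert[OF insert.hyps(1,2)]
    proof
      show "(\<lambda>i. u x * x i) + (\<Sum>b\<in>F. (\<lambda>i. u b * b i)) \<in> V"
        using fs.subspace_add[OF subspace A B(1)] .
      show "\<psi> ((\<lambda>i. u x * x i) + (\<Sum>b\<in>F. (\<lambda>i. u b * b i))) i = u x * \<psi> x i + (\<Sum>b\<in>F. u b * \<psi> b i)"
        unfolding \<psi>_add[OF A B(1)] \<psi>_scale[OF xV] using B(2) by simp
    qed
  qed (auto simp: \<psi>_0 fs.subspace_0[OF subspace])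
  then show ?thesis by blast
qed

abbreviation supp where "supp x \<equiv> {i. \<psi> x i \<noteq> 0}"

lemma finite_supp: "x \<in> V \<Longrightarrow> finite (supp x)"
  using finite_subset[OF _ finite_I, of "supp x"] support by blast

text \<open>After scaling one coordinate to 1, the difference between the q-th power and the vector
  loses that coordinate. Either it is zero and the vector is rational, or it is nonzero with
  strictly smaller support and the induction applies.\<close>

lemma exists_fixed_in_support:
  assumes "x \<in> V" "x \<noteq> 0"
  shows "\<exists>w\<in>VF. w \<noteq> 0 \<and> supp w \<subseteq> supp x"
  using assms
proof (induction "card (supp x)" arbitrary: x rule: less_induct)
  case less
  have "\<psi> x \<noteq> 0" using \<psi>_eq_0 less.prems by blast
  then obtain i0 where i0: "\<psi> x i0 \<noteq> 0" by (auto simp: fun_eq_iff)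
  define y where "y = (\<lambda>i. inverse (\<psi> x i0) * x i)"
  have yV: "y \<in> V" unfolding y_def using fs.subspace_scale[OF subspace] less.prems by blast
  have \<psi>y: "\<psi> y i = inverse (\<psi> x i0) * \<psi> x i" for i
    unfolding y_def by (simp add: \<psi>_scale less.prems)
  obtain y' where y': "y' \<in> V" "\<psi> y' = (\<lambda>i. \<psi> y i ^ card (UNIV :: 'f set))" using frob[OF yV] by blast
  have dV: "y' - y \<in> V" using fs.subspace_diff[OF subspace] y' yV by blast
  have \<psi>d: "\<psi> (y' - y) i = \<psi> y i ^ card (UNIV :: 'f set) - \<psi> y i" for i
    using \<psi>_diff[OF y'(1) yV] y'(2) by simp
  have q0: "0 < card (UNIV :: 'f set)" using card_finite_field_gt_1[where 'f = 'f] by linarith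
  have sy: "supp y = supp x" using i0 by (auto simp: \<psi>y)
  show ?case
  proof (cases "y' - y = 0")
    case True
    then have "\<psi> y i ^ card (UNIV :: 'f set) = \<psi> y i" for i using \<psi>d[of i] by (simp add: \<psi>_0)
    then have "y \<in> VF" unfolding VF_def using yV frob_fixed_iff[OF hom] by auto
    moreover have "y \<noteq> 0"
    proof
      assume "y = 0"
      then have "\<psi> y i0 = 0" by (simp add: \<psi>_0)
      then show False using \<psi>y[of i0] i0 by simp
    qed
    ultimately show ?thesis using sy by blast
  next
    case False
    have "supp (y' - y) \<subseteq> supp x - {i0}"
      using i0 q0 by (auto simp: \<psi>d \<psi>y)
    then have "supp (y' - y) \<subset> supp x" using i0 by blast
    then have "card (supp (y' - y)) < card (supp x)"
      using finite_supp less.prems by (intro psubset_card_mono) auto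
    from less.hyps[OF this dV False] \<open>supp (y' - y) \<subset> supp x\<close> show ?thesis by blast
  qed
qed

text \<open>A rational vector supported inside the support of \<open>x\<close> can be scaled and
  subtracted so as to kill a coordinate of \<open>x\<close> without creating new ones.\<close>

lemma subset_span_VF: "V \<subseteq> fs.span VF"
proof
  fix x assume "x \<in> V"
  then show "x \<in> fs.span VF"
  proof (induction "card (supp x)" arbitrary: x rule: less_induct)
    case less
    show ?case
    proof (cases "x = 0")
      case True
      then show ?thesis using fs.span_zero by simp
    next
      case False
      then obtain w where w: "w \<in> VF" "w \<noteq> 0" "supp w \<subseteq> supp x"
        using exists_fixed_in_support less.prems by blast
      then have wV: "w \<in> V" using VF_subset by blast
      then have "\<psi> w \<noteq> 0" using \<psi>_eq_0 w by blast
      then obtain i0 where i0: "\<psi> w i0 \<noteq> 0" by (auto simp: fun_eq_iff)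
      define c where "c = \<psi> x i0 / \<psi> w i0"
      have cV: "(\<lambda>i. c * w i) \<in> V" using fs.subspace_scale[OF subspace wV] .
      define y where "y = x - (\<lambda>i. c * w i)"
      have yV: "y \<in> V" unfolding y_def using fs.subspace_diff[OF subspace less.prems cV] .
      have \<psi>y: "\<psi> y i = \<psi> x i - c * \<psi> w i" for i
        unfolding y_def using \<psi>_diff[OF less.prems cV] by (simp add: \<psi>_scale wV)
      have "supp y \<subseteq> supp x - {i0}"
        using w(3) i0 by (auto simp: \<psi>y c_def)
      then have "supp y \<subset> supp x" using i0 w(3) by blast
      then have "card (supp y) < card (supp x)"
        using finite_supp less.prems by (intro psubset_card_mono) auto
      from fs.span_add[OF less.hyps[OF this yV] fs.span_scale[OF fs.span_base[OF w(1)], of c]]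
      have "y + (\<lambda>i. c * w i) \<in> fs.span VF" .
      moreover have "y + (\<lambda>i. c * w i) = x" unfolding y_def by simp
      ultimately show ?thesis by simp
    qed
  qed
qed

lemma \<psi>_inj: "x \<in> V \<Longrightarrow> y \<in> V \<Longrightarrow> \<psi> x = \<psi> y \<Longrightarrow> x = y"
  using \<psi>_diff[of x y] \<psi>_eq_0[of "x - y"] fs.subspace_diff[OF subspace, of x y] by simp

lemma finite_VF: "finite VF"
proof -
  have "\<psi> ` VF \<subseteq> {f. \<forall>i. (i \<in> I \<longrightarrow> f i \<in> range h) \<and> (i \<notin> I \<longrightarrow> f i = 0)}"
    unfolding VF_def using support by auto
  moreover have "finite \<dots>" by (rule finite_set_of_finite_funs) (auto simp: finite_I)
  ultimately have "finite (\<psi> ` VF)" by (rule finite_subset)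
  moreover have "inj_on \<psi> VF" using \<psi>_inj VF_subset by (intro inj_onI) blast
  ultimately show ?thesis by (simp add: finite_image_iff)
qed

text \<open>A basis of \<open>V\<close> over the large field, chosen inside \<open>VF\<close>, is
  also a basis of \<open>VF\<close> over the finite field: taking q-th powers fixes the basis
  vectors and the vector expanded, so by uniqueness it fixes the coefficients.\<close>

lemma card_VF: "card VF = card (UNIV :: 'f set) ^ fs.dim V"
proof -
  obtain B where B: "B \<subseteq> VF" "fs.independent B" "VF \<subseteq> fs.span B"
    using fs.maximal_independent_subset[of VF] by blast
  have finB: "finite B" using finite_subset[OF B(1) finite_VF] .
  have BV: "B \<subseteq> V" using B VF_subset by blast
  have "V \<subseteq> fs.span B"
    using subset_span_VF fs.span_minimal[OF B(3) fs.subspace_span] by blast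
  then have dim: "fs.dim V = card B" using fs.basis_card_eq_dim[OF BV _ B(2)] by simp
  \<comment> \<open>The same functions, now as a space over the finite field, whose scalars act
    through \<open>h\<close>.\<close>
  interpret F: vector_space "\<lambda>(c :: 'f) (x :: 'y \<Rightarrow> 'e) i. h c * x i"
    by unfold_locales (simp_all add: fun_eq_iff field_hom_simps[OF hom] algebra_simps)
  have hB: "\<psi> b i ^ card (UNIV :: 'f set) = \<psi> b i" if "b \<in> B" for b i
    using that B(1) frob_fixed_iff[OF hom] unfolding VF_def by blast
  have "F.subspace VF"
  proof (rule F.subspaceI)
    show "0 \<in> VF"
      unfolding VF_def using fs.subspace_0[OF subspace] field_homD(1)[OF hom] by (auto simp: \<psi>_0 image_iff)
    show "x + y \<in> VF" if "x \<in> VF" "y \<in> VF" for x y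
    proof -
      have "\<psi> x i + \<psi> y i \<in> range h" for i
      proof -
        have "\<psi> x i \<in> range h" "\<psi> y i \<in> range h" using that unfolding VF_def by auto
        then obtain c d where "\<psi> x i = h c" "\<psi> y i = h d" by auto
        then show ?thesis by (simp add: field_homD(3)[OF hom, symmetric])
      qed
      then show ?thesis using that fs.subspace_add[OF subspace, of x y] by (simp add: VF_def \<psi>_add)
    qed
    show "(\<lambda>i. h c * x i) \<in> VF" if "x \<in> VF" for c x
    proof -
      have "h c * \<psi> x i \<in> range h" for i
      proof -
        have "\<psi> x i \<in> range h" using that unfolding VF_def by auto
        then obtain d where "\<psi> x i = h d" by auto
        then show ?thesis by (simp add: field_homD(4)[OF hom, symmetric])
      qed
      then show ?thesis using that fs.subspace_scale[OF subspace, of x] by (simp add: VF_def \<psi>_scale)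
    qed
  qed
  moreover have "VF \<subseteq> F.span B"
  proof
    fix w assume w: "w \<in> VF"
    then have "w \<in> fs.span B" using B(3) by blast
    then obtain u where u: "w = (\<Sum>b\<in>B. (\<lambda>i. u b * b i))"
      using fs.span_finite[OF finB] by auto
    \<comment> \<open>Under \<open>\<psi>\<close> this is the q-th power of \<open>w\<close> minus
      \<open>w\<close>, which is zero because \<open>w\<close> is rational.\<close>
    have "(\<Sum>b\<in>B. (\<lambda>i. (u b ^ card (UNIV :: 'f set) - u b) * b i)) = 0" (is "?s = 0")
    proof (rule \<psi>_eq_0)
      show "?s \<in> V"
        using BV by (intro fs.subspace_sum[OF subspace] fs.subspace_scale[OF subspace]) auto
      show "\<psi> ?s = 0"
      proof
        fix i
        have wi: "\<psi> w i = (\<Sum>b\<in>B. u b * \<psi> b i)" unfolding u by (rule \<psi>_sum[OF BV])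
        have "\<psi> w i = \<psi> w i ^ card (UNIV :: 'f set)" using w frob_fixed_iff[OF hom, of "\<psi> w i"] unfolding VF_def by simp
        also have "\<dots> = (\<Sum>b\<in>B. u b ^ card (UNIV :: 'f set) * \<psi> b i)"
          unfolding wi by (simp add: field_hom_sum[OF frob_field_hom[OF hom]] power_mult_distrib hB)
        finally show "\<psi> ?s i = 0 i"
          using wi \<psi>_sum[OF BV, of "\<lambda>b. u b ^ card (UNIV :: 'f set) - u b" i]
          by (simp only: left_diff_distrib sum_subtractf zero_fun_apply diff_self)
      qed
    qed
    then have "u b ^ card (UNIV :: 'f set) - u b = 0" if "b \<in> B" for b
      using fs.independentD[OF B(2) finB order_refl _ that, of "\<lambda>b. u b ^ card (UNIV :: 'f set) - u b"] by simp
    then have "u b \<in> range h" if "b \<in> B" for b using that frob_fixed_iff[OF hom] by simp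
    then have "\<exists>c. \<forall>b\<in>B. u b = h (c b)" by (intro bchoice) auto
    then obtain c where c: "\<And>b. b \<in> B \<Longrightarrow> u b = h (c b)" by blast
    have "w = (\<Sum>b\<in>B. (\<lambda>i. h (c b) * b i))" unfolding u by (intro sum.cong) (auto simp: c)
    then show "w \<in> F.span B" by (auto intro: F.span_sum F.span_scale F.span_base)
  qed
  ultimately have span: "F.span B = VF" using F.span_minimal[OF B(1)] by blast
  have "F.independent B"
  proof (rule F.independent_if_scalars_zero[OF finB])
    fix c b assume "(\<Sum>b\<in>B. (\<lambda>i. h (c b) * b i)) = 0" "b \<in> B"
    then have "h (c b) = 0" using fs.independentD[OF B(2) finB order_refl, of "\<lambda>b. h (c b)"] by blast
    then show "c b = 0" using field_hom_eq_0_iff[OF hom] by blast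
  qed
  from F.card_span_independent[OF finB this] show ?thesis by (simp add: span dim)
qed

end

section \<open>Matrices as functions\<close>

abbreviation (input) mmap :: "('a \<Rightarrow> 'b) \<Rightarrow> (nat \<Rightarrow> nat \<Rightarrow> 'a) \<Rightarrow> nat \<Rightarrow> nat \<Rightarrow> 'b" where
  "mmap g A \<equiv> (\<lambda>i j. g (A i j))"

abbreviation (input) mpow :: "nat \<Rightarrow> (nat \<Rightarrow> nat \<Rightarrow> 'a::monoid_mult) \<Rightarrow> nat \<Rightarrow> nat \<Rightarrow> 'a" where
  "mpow q \<equiv> mmap (\<lambda>y. y ^ q)"

lemma mat_mul_Mn [simp]: "mat_mul n A B \<in> Mn n"
  unfolding mat_mul_def Mn_def by auto

lemma mat_one_Mn [simp]: "mat_one n \<in> Mn n"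
  unfolding mat_one_def Mn_def by auto

lemma Mn_eqI: "A \<in> Mn n \<Longrightarrow> B \<in> Mn n \<Longrightarrow> (\<And>i j. i < n \<Longrightarrow> j < n \<Longrightarrow> A i j = B i j) \<Longrightarrow> A = B"
  unfolding Mn_def by (intro ext) (smt (verit, best) mem_Collect_eq not_le)

lemma mat_mul_assoc: "mat_mul n (mat_mul n A B) C = mat_mul n A (mat_mul n B C)"
proof (rule Mn_eqI[where n = n])
  fix i j assume ij: "i < n" "j < n"
  have "mat_mul n (mat_mul n A B) C i j = (\<Sum>k<n. \<Sum>l<n. A i l * B l k * C k j)"
    using ij by (simp add: mat_mul_def sum_distrib_right)
  also have "\<dots> = (\<Sum>l<n. \<Sum>k<n. A i l * B l k * C k j)" by (rule sum.swap)
  also have "\<dots> = mat_mul n A (mat_mul n B C) i j"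
    using ij by (simp add: mat_mul_def sum_distrib_left mult.assoc)
  finally show "mat_mul n (mat_mul n A B) C i j = mat_mul n A (mat_mul n B C) i j" .
qed auto

lemma mat_mul_one_left: "A \<in> Mn n \<Longrightarrow> mat_mul n (mat_one n) A = A"
  by (rule Mn_eqI[OF mat_mul_Mn])
    (auto simp: mat_mul_def mat_one_def if_distrib[where f = "\<lambda>x. x * _"] cong: if_cong)

lemma mat_mul_one_right: "A \<in> Mn n \<Longrightarrow> mat_mul n A (mat_one n) = A"
  by (rule Mn_eqI[OF mat_mul_Mn])
    (auto simp: mat_mul_def mat_one_def if_distrib[where f = "\<lambda>x. _ * x"] cong: if_cong)

lemma mmap_Mn: "field_hom g \<Longrightarrow> A \<in> Mn n \<Longrightarrow> mmap g A \<in> Mn n"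
  unfolding Mn_def by (auto simp: field_homD)

lemma mmap_mat_mul: "field_hom g \<Longrightarrow> mmap g (mat_mul n A B) = mat_mul n (mmap g A) (mmap g B)"
  by (auto simp: mat_mul_def fun_eq_iff field_hom_simps)

lemma mmap_mat_one: "field_hom g \<Longrightarrow> mmap g (mat_one n) = mat_one n"
  by (auto simp: mat_one_def fun_eq_iff field_homD)

lemma mat_mul_zero_left: "mat_mul n (\<lambda>i j. 0) A = (\<lambda>i j. 0)"
  by (auto simp: mat_mul_def fun_eq_iff)

lemma mat_mul_zero_right: "mat_mul n A (\<lambda>i j. 0) = (\<lambda>i j. 0)"
  by (auto simp: mat_mul_def fun_eq_iff)

lemma mat_left_inverse_imp_right:
  fixes A B :: "nat \<Rightarrow> nat \<Rightarrow> 'a::field"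
  assumes "mat_mul n A B = mat_one n"
  shows "mat_mul n B A = mat_one n"
proof -
  let ?M = "\<lambda>A :: nat \<Rightarrow> nat \<Rightarrow> 'a. mat n n (\<lambda>(i, j). A i j)"
  have mult: "?M A * ?M B = ?M (mat_mul n A B)" for A B
    by (rule eq_matI) (auto simp: mat_mul_def scalar_prod_def lessThan_atLeast0)
  have one: "1\<^sub>m n = ?M (mat_one n)"
    by (rule eq_matI) (auto simp: mat_one_def)
  have "?M A * ?M B = 1\<^sub>m n" unfolding mult one assms ..
  then have "?M B * ?M A = 1\<^sub>m n"
    using mat_mult_left_right_inverse[of "?M A" n "?M B"] by simp
  then have eq: "?M (mat_mul n B A) = ?M (mat_one n)" unfolding mult one .
  show ?thesis
  proof (rule Mn_eqI[where n = n])
    fix i j assume "i < n" "j < n"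
    then show "mat_mul n B A i j = mat_one n i j"
      using arg_cong[OF eq, of "\<lambda>M. M $$ (i, j)"] by simp
  qed auto
qed

lemma mat_injective_imp_det:
  fixes A :: "nat \<Rightarrow> nat \<Rightarrow> 'a::field"
  assumes "\<And>x j. (\<And>i. i < n \<Longrightarrow> (\<Sum>j<n. A i j * x j) = 0) \<Longrightarrow> j < n \<Longrightarrow> x j = 0"
  shows "det (mat n n (\<lambda>(i, j). A i j)) \<noteq> 0"
proof -
  let ?M = "mat n n (\<lambda>(i, j). A i j)"
  show ?thesis
  proof
    assume "det ?M = 0"
    then obtain y where y: "y \<in> carrier_vec n" "y \<noteq> 0\<^sub>v n" "?M *\<^sub>v y = 0\<^sub>v n"
      using det_0_iff_vec_prod_zero_field[of ?M n] by auto
    have "(\<Sum>j<n. A i j * vec_index y j) = 0" if "i < n" for i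
      using that y(1) arg_cong[OF y(3), of "\<lambda>w. vec_index w i"]
      by (simp add: scalar_prod_def lessThan_atLeast0)
    then have "vec_index y j = 0" if "j < n" for j using assms[of "\<lambda>j. vec_index y j" j] that by blast
    then have "y = 0\<^sub>v n" using y(1) by (intro eq_vecI) auto
    with y(2) show False by simp
  qed
qed

lemma mat_det_imp_inverse:
  fixes A :: "nat \<Rightarrow> nat \<Rightarrow> 'a::field"
  assumes det: "det (mat n n (\<lambda>(i, j). A i j)) \<noteq> 0"
  shows "\<exists>B\<in>Mn n. mat_mul n A B = mat_one n"
proof -
  let ?M = "mat n n (\<lambda>(i, j). A i j)"
  define B where "B = (\<lambda>i j. if i < n \<and> j < n then (adj_mat ?M $$ (i, j)) / det ?M else 0)"
  have "mat_mul n A B = mat_one n"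
  proof (rule Mn_eqI[where n = n])
    fix i j assume ij: "i < n" "j < n"
    have "(?M * adj_mat ?M) $$ (i, j) = (det ?M \<cdot>\<^sub>m 1\<^sub>m n) $$ (i, j)"
      using adj_mat(2)[of ?M n] by simp
    moreover have "(?M * adj_mat ?M) $$ (i, j) = (\<Sum>k<n. A i k * adj_mat ?M $$ (k, j))"
      using ij adj_mat(1)[of ?M n] by (simp add: scalar_prod_def lessThan_atLeast0)
    ultimately have "(\<Sum>k<n. A i k * adj_mat ?M $$ (k, j)) = (if i = j then det ?M else 0)"
      using ij by simp
    then show "mat_mul n A B i j = mat_one n i j"
      using ij det by (auto simp: mat_mul_def mat_one_def B_def sum_divide_distrib[symmetric])
  qed auto
  moreover have "B \<in> Mn n" by (auto simp: B_def Mn_def)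
  ultimately show ?thesis by blast
qed

section \<open>Scalar extensions of a matrix algebra\<close>

text \<open>Vanishing from index \<open>m\<close> on makes equality of functions the same as
  equality of the first \<open>m\<close> coordinates.\<close>

definition coords :: "nat \<Rightarrow> (nat \<Rightarrow> 'e::zero) set" where
  "coords m = {x. \<forall>i\<ge>m. x i = 0}"

lemma coords_eqI: "x \<in> coords m \<Longrightarrow> y \<in> coords m \<Longrightarrow> (\<And>i. i < m \<Longrightarrow> x i = y i) \<Longrightarrow> x = y"
  unfolding coords_def by (intro ext) (smt (verit, best) mem_Collect_eq not_le)

lemma subspace_coords: "fs.subspace (coords m)"
  by (intro fs.subspaceI) (auto simp: coords_def)

locale matrix_algebra =
  fixes \<A> :: "(nat \<Rightarrow> nat \<Rightarrow> 'f::{finite,field}) set" and n m :: nat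
    and v :: "nat \<Rightarrow> nat \<Rightarrow> nat \<Rightarrow> 'f"
  assumes n_pos: "0 < n" and subalgebra: "is_subalgebra n \<A>" and basis: "is_basis n \<A> m v"
begin

text \<open>The element with coordinates \<open>x\<close> of the algebra extended by scalars to the
  larger field, realized as a matrix.\<close>

definition emb :: "('f \<Rightarrow> 'e::field) \<Rightarrow> (nat \<Rightarrow> 'e) \<Rightarrow> nat \<Rightarrow> nat \<Rightarrow> 'e" where
  "emb h x = (\<lambda>r s. \<Sum>i<m. x i * h (v i r s))"

lemma v_in: "i < m \<Longrightarrow> v i \<in> \<A>"
  using basis unfolding is_basis_def by blast

lemma \<A>_Mn: "A \<in> \<A> \<Longrightarrow> A \<in> Mn n"
  using subalgebra unfolding is_subalgebra_def by blast

lemma mat_one_in: "mat_one n \<in> \<A>"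
  using subalgebra unfolding is_subalgebra_def by blast

lemma zero_in: "(\<lambda>i j. 0) \<in> \<A>"
  using subalgebra unfolding is_subalgebra_def by blast

lemma mat_mul_in: "A \<in> \<A> \<Longrightarrow> B \<in> \<A> \<Longrightarrow> mat_mul n A B \<in> \<A>"
  using subalgebra unfolding is_subalgebra_def by blast

lemma scale_in: "A \<in> \<A> \<Longrightarrow> (\<lambda>r s. c * A r s) \<in> \<A>"
  using subalgebra unfolding is_subalgebra_def by blast

lemma add_in: "A \<in> \<A> \<Longrightarrow> B \<in> \<A> \<Longrightarrow> (\<lambda>r s. A r s + B r s) \<in> \<A>"
  using subalgebra unfolding is_subalgebra_def by blast

lemma combination_in: "k \<le> m \<Longrightarrow> (\<lambda>r s. \<Sum>i<k. c i * v i r s) \<in> \<A>"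
proof (induction k)
  case 0
  then show ?case by (simp add: zero_in)
next
  case (Suc k)
  then show ?case using add_in[OF Suc.IH scale_in[OF v_in[of k], of "c k"]] by simp
qed

lemma \<A>_coordsE:
  assumes "A \<in> \<A>"
  obtains c where "A = (\<lambda>r s. \<Sum>i<m. c i * v i r s)"
  using basis assms unfolding is_basis_def by blast

lemma combination_eq_0: "(\<lambda>r s. \<Sum>i<m. c i * v i r s) = (\<lambda>r s. 0) \<Longrightarrow> i < m \<Longrightarrow> c i = 0"
  using basis unfolding is_basis_def by blast

lemma finite_\<A>: "finite \<A>"
proof -
  have "\<A> \<subseteq> (\<lambda>c r s. \<Sum>i<m. c i * v i r s) ` (PiE {..<m} (\<lambda>_. UNIV))"
  proof
    fix A assume "A \<in> \<A>"
    then obtain c where c: "A = (\<lambda>r s. \<Sum>i<m. c i * v i r s)" by (rule \<A>_coordsE)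
    then have "A = (\<lambda>r s. \<Sum>i<m. restrict c {..<m} i * v i r s)" by simp
    moreover have "restrict c {..<m} \<in> PiE {..<m} (\<lambda>_. UNIV)" by simp
    ultimately show "A \<in> (\<lambda>c r s. \<Sum>i<m. c i * v i r s) ` (PiE {..<m} (\<lambda>_. UNIV))"
      by (rule image_eqI)
  qed
  then show ?thesis by (rule finite_subset) (intro finite_imageI finite_PiE, auto)
qed

lemma emb_cong: "(\<And>i. i < m \<Longrightarrow> x i = y i) \<Longrightarrow> emb h x = emb h y"
  unfolding emb_def by (intro ext sum.cong) auto

lemma emb_Mn: "field_hom h \<Longrightarrow> emb h x \<in> Mn n"
proof -
  assume h: "field_hom h"
  have "v i r s = 0" if "i < m" "n \<le> r \<or> n \<le> s" for i r s
    using \<A>_Mn[OF v_in[OF that(1)]] that(2) unfolding Mn_def by blast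
  then show ?thesis unfolding emb_def Mn_def by (auto simp: field_homD[OF h])
qed

lemma emb_add: "emb h (x + y) = emb h x + emb h y"
  unfolding emb_def by (auto simp: fun_eq_iff algebra_simps sum.distrib)

lemma emb_scale: "emb h (\<lambda>i. c * x i) = (\<lambda>r s. c * emb h x r s)"
  unfolding emb_def by (auto simp: fun_eq_iff algebra_simps sum_distrib_left)

lemma emb_combination: "field_hom h \<Longrightarrow> emb h (\<lambda>i. h (c i)) = mmap h (\<lambda>r s. \<Sum>i<m. c i * v i r s)"
  unfolding emb_def by (auto simp: fun_eq_iff field_hom_simps)

lemma mmap_emb: "field_hom g \<Longrightarrow> mmap g (emb h x) = emb (g \<circ> h) (\<lambda>i. g (x i))"
  unfolding emb_def by (auto simp: fun_eq_iff field_hom_simps)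

lemma mmap_frob_emb:
  fixes h :: "'f \<Rightarrow> 'e::field"
  assumes "field_hom h"
  shows "mpow (card (UNIV :: 'f set)) (emb h x) = emb h (\<lambda>i. x i ^ card (UNIV :: 'f set))"
proof -
  have "(\<lambda>y. y ^ card (UNIV :: 'f set)) \<circ> h = h"
    using frob_fixed_iff[OF assms] by (auto simp: fun_eq_iff)
  then show ?thesis using mmap_emb[OF frob_field_hom[OF assms], of h x] by simp
qed

text \<open>The basis has entries in the finite field, so its linear relations over the larger field
  form a Frobenius-stable space. That space is spanned by relations with coefficients in the finite
  field, and those are trivial.\<close>

lemma emb_eq_0:
  fixes h :: "'f \<Rightarrow> 'e::field"
  assumes h: "field_hom h" and x: "x \<in> coords m" and 0: "emb h x = 0"
  shows "x = 0"
proof -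
  define V where "V = {x\<in>coords m. emb h x = (0 :: nat \<Rightarrow> nat \<Rightarrow> 'e)}"
  interpret V: frobenius_structure h V id "{..<m}"
  proof
    show "fs.subspace V"
      using subspace_coords[of m] unfolding V_def fs.subspace_def
      by (auto simp: emb_add emb_scale fun_eq_iff) (auto simp: emb_def)
    have q: "0 < card (UNIV :: 'f set)" using card_finite_field_gt_1[where 'f = 'f] by linarith
    show "\<exists>x'\<in>V. id x' = (\<lambda>i. id x i ^ card (UNIV :: 'f set))" if "x \<in> V" for x
    proof -
      have "(\<lambda>i. x i ^ card (UNIV :: 'f set)) \<in> coords m"
        using that q by (auto simp: V_def coords_def)
      moreover have "emb h (\<lambda>i. x i ^ card (UNIV :: 'f set)) = 0"
        using that q mmap_frob_emb[OF h, of x] by (auto simp: V_def fun_eq_iff)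
      ultimately show ?thesis unfolding V_def by auto
    qed
  qed (use h in \<open>auto simp: V_def coords_def\<close>)
  have "V.VF \<subseteq> {0}"
  proof
    fix y assume "y \<in> V.VF"
    then have yV: "y \<in> V" and "\<forall>i. \<exists>c. y i = h c" unfolding V.VF_def by auto
    then obtain c where c: "\<And>i. y i = h (c i)" by metis
    then have "y = (\<lambda>i. h (c i))" by auto
    with yV have "mmap h (\<lambda>r s. \<Sum>i<m. c i * v i r s) = 0"
      using emb_combination[OF h, of c] unfolding V_def by simp
    then have "h (\<Sum>i<m. c i * v i r s) = 0" for r s by (auto simp: fun_eq_iff)
    then have "(\<lambda>r s. \<Sum>i<m. c i * v i r s) = (\<lambda>r s. 0)"
      using field_hom_eq_0_iff[OF h] by blast
    then have "c i = 0" if "i < m" for i using combination_eq_0 that by blast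
    then have "y = 0" using yV unfolding V_def
      by (intro coords_eqI[of _ m]) (auto simp: c field_homD[OF h] coords_def)
    then show "y \<in> {0}" by simp
  qed
  then have "V \<subseteq> fs.span {0}" using V.subset_span_VF fs.span_mono by blast
  then have "V \<subseteq> {0}" by simp
  then show ?thesis using x 0 unfolding V_def by blast
qed

lemma emb_inj: "field_hom h \<Longrightarrow> x \<in> coords m \<Longrightarrow> y \<in> coords m \<Longrightarrow> emb h x = emb h y \<Longrightarrow> x = y"
  for h :: "'f \<Rightarrow> 'e::field"
proof -
  assume h: "field_hom h" and xy: "x \<in> coords m" "y \<in> coords m" and eq: "emb h x = emb h y"
  have "emb h (x - y) = 0" using fun_cong[OF fun_cong[OF eq]]
    by (auto simp: emb_def fun_eq_iff left_diff_distrib sum_subtractf)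
  moreover have "x - y \<in> coords m" using xy unfolding coords_def by auto
  ultimately have "x - y = 0" using emb_eq_0[OF h] by blast
  then show "x = y" by simp
qed

text \<open>The structure constants of the algebra in the basis \<open>v\<close>.\<close>

definition \<gamma> :: "nat \<Rightarrow> nat \<Rightarrow> nat \<Rightarrow> 'f" where
  "\<gamma> i j = (SOME c. mat_mul n (v i) (v j) = (\<lambda>r s. \<Sum>l<m. c l * v l r s))"

lemma \<gamma>: "i < m \<Longrightarrow> j < m \<Longrightarrow> mat_mul n (v i) (v j) = (\<lambda>r s. \<Sum>l<m. \<gamma> i j l * v l r s)"
  using basis mat_mul_in[OF v_in v_in, of i j] unfolding \<gamma>_def is_basis_def
  by (intro someI_ex[of "\<lambda>c. mat_mul n (v i) (v j) = (\<lambda>r s. \<Sum>l<m. c l * v l r s)"]) simp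

definition \<epsilon> :: "nat \<Rightarrow> 'f" where
  "\<epsilon> = (\<lambda>i. if i < m then (SOME c. mat_one n = (\<lambda>r s. \<Sum>l<m. c l * v l r s)) i else 0)"

lemma \<epsilon>: "mat_one n = (\<lambda>r s. \<Sum>l<m. \<epsilon> l * v l r s)"
proof -
  let ?c = "SOME c. mat_one n = (\<lambda>r s. \<Sum>l<m. c l * v l r s)"
  have "mat_one n = (\<lambda>r s. \<Sum>l<m. ?c l * v l r s)"
    using basis mat_one_in unfolding is_basis_def
    by (intro someI_ex[of "\<lambda>c. mat_one n = (\<lambda>r s. \<Sum>l<m. c l * v l r s)"]) simp
  also have "\<dots> = (\<lambda>r s. \<Sum>l<m. \<epsilon> l * v l r s)" by (simp add: \<epsilon>_def)
  finally show ?thesis .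
qed

text \<open>The left regular representation: the matrix, in coordinates, of left multiplication by
  \<open>x\<close>.\<close>

definition regular :: "('f \<Rightarrow> 'e::field) \<Rightarrow> (nat \<Rightarrow> 'e) \<Rightarrow> nat \<Rightarrow> nat \<Rightarrow> 'e" where
  "regular h x l j = (\<Sum>i<m. x i * h (\<gamma> i j l))"

definition mulc :: "('f \<Rightarrow> 'e::field) \<Rightarrow> (nat \<Rightarrow> 'e) \<Rightarrow> (nat \<Rightarrow> 'e) \<Rightarrow> nat \<Rightarrow> 'e" where
  "mulc h x y l = (if l < m then \<Sum>j<m. regular h x l j * y j else 0)"

lemma mulc_coords [simp]: "mulc h x y \<in> coords m"
  unfolding mulc_def coords_def by auto

lemma emb_mulc:
  assumes h: "field_hom h"
  shows "emb h (mulc h x y) = mat_mul n (emb h x) (emb h y)"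
proof (rule Mn_eqI[OF emb_Mn[OF h] mat_mul_Mn])
  fix r s assume rs: "r < n" "s < n"
  have \<gamma>': "(\<Sum>k<n. h (v i r k) * h (v j k s)) = (\<Sum>l<m. h (\<gamma> i j l) * h (v l r s))"
    if "i < m" "j < m" for i j
    using arg_cong[OF fun_cong[OF fun_cong[OF \<gamma>[OF that]], of r s], of h] rs
    by (simp add: mat_mul_def field_hom_simps[OF h])
  have "mat_mul n (emb h x) (emb h y) r s = (\<Sum>k<n. \<Sum>i<m. \<Sum>j<m. x i * y j * (h (v i r k) * h (v j k s)))"
    using rs by (simp add: mat_mul_def emb_def sum_product mult_ac)
  also have "\<dots> = (\<Sum>i<m. \<Sum>k<n. \<Sum>j<m. x i * y j * (h (v i r k) * h (v j k s)))"
    by (rule sum.swap)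
  also have "\<dots> = (\<Sum>i<m. \<Sum>j<m. \<Sum>k<n. x i * y j * (h (v i r k) * h (v j k s)))"
    by (rule sum.cong[OF refl]) (rule sum.swap)
  also have "\<dots> = (\<Sum>i<m. \<Sum>j<m. \<Sum>l<m. x i * y j * (h (\<gamma> i j l) * h (v l r s)))"
    by (rule sum.cong[OF refl], rule sum.cong[OF refl]) (simp add: sum_distrib_left[symmetric] \<gamma>')
  also have "\<dots> = (\<Sum>i<m. \<Sum>l<m. \<Sum>j<m. x i * y j * (h (\<gamma> i j l) * h (v l r s)))"
    by (rule sum.cong[OF refl]) (rule sum.swap)
  also have "\<dots> = (\<Sum>l<m. \<Sum>i<m. \<Sum>j<m. x i * y j * (h (\<gamma> i j l) * h (v l r s)))"
    by (rule sum.swap)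
  also have "\<dots> = (\<Sum>l<m. \<Sum>j<m. \<Sum>i<m. x i * y j * (h (\<gamma> i j l) * h (v l r s)))"
    by (rule sum.cong[OF refl]) (rule sum.swap)
  also have "\<dots> = emb h (mulc h x y) r s"
    by (simp add: emb_def mulc_def regular_def sum_distrib_left sum_distrib_right mult_ac)
  finally show "emb h (mulc h x y) r s = mat_mul n (emb h x) (emb h y) r s" by simp
qed

lemma emb_\<epsilon>: "field_hom h \<Longrightarrow> emb h (\<lambda>i. h (\<epsilon> i)) = mat_one n"
  using emb_combination[of h \<epsilon>] mmap_mat_one[of h n] arg_cong[OF \<epsilon>, of "mmap h"] by simp

lemma \<epsilon>_coords: "field_hom h \<Longrightarrow> (\<lambda>i. h (\<epsilon> i)) \<in> coords m"
  unfolding coords_def \<epsilon>_def by (auto simp: field_homD)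

lemma mulc_add_left: "mulc h (x + y) z = mulc h x z + mulc h y z"
  unfolding mulc_def regular_def by (auto simp: fun_eq_iff algebra_simps sum.distrib)

lemma mulc_scale_left: "mulc h (\<lambda>i. c * x i) z = (\<lambda>i. c * mulc h x z i)"
  unfolding mulc_def regular_def by (auto simp: fun_eq_iff algebra_simps sum_distrib_left sum_distrib_right)

text \<open>Solving \<open>x y = 1\<close> in coordinates, rather than inverting the n by n matrix,
  keeps the inverse inside the extended algebra.\<close>

lemma regular_det_imp_inverse:
  assumes h: "field_hom h" and det: "det (mat m m (\<lambda>(l, j). regular h x l j)) \<noteq> 0"
  shows "\<exists>y\<in>coords m. mat_mul n (emb h x) (emb h y) = mat_one n"
proof -
  obtain Y where Y: "mat_mul m (regular h x) Y = mat_one m"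
    using mat_det_imp_inverse[OF det] by blast
  define y where "y = (\<lambda>j. if j < m then \<Sum>k<m. Y j k * h (\<epsilon> k) else 0)"
  have "mulc h x y = (\<lambda>i. h (\<epsilon> i))"
  proof (rule coords_eqI[OF mulc_coords \<epsilon>_coords[OF h]])
    fix l assume l: "l < m"
    have "mulc h x y l = (\<Sum>j<m. \<Sum>k<m. regular h x l j * Y j k * h (\<epsilon> k))"
      using l by (simp add: mulc_def y_def sum_distrib_left mult.assoc)
    also have "\<dots> = (\<Sum>k<m. \<Sum>j<m. regular h x l j * Y j k * h (\<epsilon> k))" by (rule sum.swap)
    also have "\<dots> = (\<Sum>k<m. mat_one m l k * h (\<epsilon> k))"
      using l by (intro sum.cong refl) (simp add: Y[symmetric] mat_mul_def sum_distrib_right)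
    also have "\<dots> = h (\<epsilon> l)"
      using l by (simp add: mat_one_def if_distrib[where f = "\<lambda>x. x * _"] cong: if_cong)
    finally show "mulc h x y l = h (\<epsilon> l)" .
  qed
  then have "mat_mul n (emb h x) (emb h y) = mat_one n"
    unfolding emb_mulc[OF h, symmetric] by (simp add: emb_\<epsilon>[OF h])
  moreover have "y \<in> coords m" unfolding y_def coords_def by auto
  ultimately show ?thesis by blast
qed

text \<open>A left inverse \<open>B\<close> anywhere among the n by n matrices makes left
  multiplication by \<open>x\<close> injective on the extended algebra, hence bijective by finite
  dimension. So the inverse already has coordinates in the basis \<open>v\<close>.\<close>

lemma regular_det:
  assumes h: "field_hom h" and inv: "mat_mul n B (emb h x) = mat_one n"
  shows "det (mat m m (\<lambda>(l, j). regular h x l j)) \<noteq> 0" "\<exists>y\<in>coords m. mat_mul n (emb h x) (emb h y) = mat_one n"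
proof -
  have inj: "y j = 0" if "\<And>l. l < m \<Longrightarrow> (\<Sum>j<m. regular h x l j * y j) = 0" and "j < m" for y j
  proof -
    let ?y = "\<lambda>i. if i < m then y i else 0"
    have "mulc h x ?y = (\<lambda>_. 0)" using that(1) unfolding mulc_def by auto
    then have "mat_mul n (emb h x) (emb h ?y) = (\<lambda>_ _. 0)"
      unfolding emb_mulc[OF h, symmetric] by (simp add: emb_def)
    then have "mat_mul n (mat_mul n B (emb h x)) (emb h ?y) = (\<lambda>_ _. 0)"
      unfolding mat_mul_assoc by (simp add: mat_mul_zero_right)
    then have "emb h ?y = 0" unfolding inv mat_mul_one_left[OF emb_Mn[OF h]] by (auto simp: zero_fun_def)
    moreover have "?y \<in> coords m" unfolding coords_def by auto
    ultimately have "?y = 0" using emb_eq_0[OF h] by blast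
    from fun_cong[OF this, of j] show ?thesis using that(2) by simp
  qed
  show "det (mat m m (\<lambda>(l, j). regular h x l j)) \<noteq> 0"
    by (rule mat_injective_imp_det) (rule inj)
  then show "\<exists>y\<in>coords m. mat_mul n (emb h x) (emb h y) = mat_one n" by (rule regular_det_imp_inverse[OF h])
qed

end

section \<open>Existence of a fundamental matrix inside the algebra\<close>

text \<open>Inversion over the lattice of subsets: the numbers of \<open>x\<close> with
  \<open>S \<subseteq> \<alpha> x\<close> determine the numbers with \<open>\<alpha> x = S\<close>,
  by subtracting the contributions of all strictly larger sets.\<close>

lemma card_fibre_eq:
  assumes "finite Z" "finite A" "finite B"
    and "\<alpha> ` A \<subseteq> Pow Z" "\<beta> ` B \<subseteq> Pow Z"
    and eq: "\<And>S. S \<subseteq> Z \<Longrightarrow> card {x\<in>A. S \<subseteq> \<alpha> x} = card {x\<in>B. S \<subseteq> \<beta> x}"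
    and "S \<subseteq> Z"
  shows "card {x\<in>A. \<alpha> x = S} = card {x\<in>B. \<beta> x = S}"
  using \<open>S \<subseteq> Z\<close>
proof (induction "card (Z - S)" arbitrary: S rule: less_induct)
  case less
  define \<S> where "\<S> = {S'. S \<subset> S' \<and> S' \<subseteq> Z}"
  have fin: "finite \<S>" unfolding \<S>_def using \<open>finite Z\<close> by simp
  have split: "card {x\<in>A. S \<subseteq> \<alpha> x} = card {x\<in>A. \<alpha> x = S} + (\<Sum>S'\<in>\<S>. card {x\<in>A. \<alpha> x = S'})"
    if "finite A" "\<alpha> ` A \<subseteq> Pow Z" for A :: "'x set" and \<alpha>
  proof -
    have "{x\<in>A. S \<subseteq> \<alpha> x} = {x\<in>A. \<alpha> x = S} \<union> (\<Union>S'\<in>\<S>. {x\<in>A. \<alpha> x = S'})"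
      using that(2) unfolding \<S>_def by blast
    also have "card \<dots> = card {x\<in>A. \<alpha> x = S} + card (\<Union>S'\<in>\<S>. {x\<in>A. \<alpha> x = S'})"
      using that(1) fin by (intro card_Un_disjoint) (auto simp: \<S>_def)
    also have "card (\<Union>S'\<in>\<S>. {x\<in>A. \<alpha> x = S'}) = (\<Sum>S'\<in>\<S>. card {x\<in>A. \<alpha> x = S'})"
      using that(1) fin by (intro card_UN_disjoint) auto
    finally show ?thesis .
  qed
  have "(\<Sum>S'\<in>\<S>. card {x\<in>A. \<alpha> x = S'}) = (\<Sum>S'\<in>\<S>. card {x\<in>B. \<beta> x = S'})"
  proof (rule sum.cong[OF refl])
    fix S' assume S': "S' \<in> \<S>"
    then have "Z - S' \<subset> Z - S" unfolding \<S>_def by blast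
    then have "card (Z - S') < card (Z - S)" using \<open>finite Z\<close> by (intro psubset_card_mono) auto
    then show "card {x\<in>A. \<alpha> x = S'} = card {x\<in>B. \<beta> x = S'}"
      using less.hyps S' unfolding \<S>_def by blast
  qed
  then show ?case
    using split[OF assms(2,4)] split[OF assms(3,5)] eq[OF less.prems] by linarith
qed

lemma mat_mul_add_right: "mat_mul n A (B + C) = mat_mul n A B + mat_mul n A C"
  by (auto simp: mat_mul_def fun_eq_iff algebra_simps sum.distrib)

lemma mat_mul_add_left: "mat_mul n (A + B) C = mat_mul n A C + mat_mul n B C"
  by (auto simp: mat_mul_def fun_eq_iff algebra_simps sum.distrib)

lemma mat_mul_scale_right: "mat_mul n A (\<lambda>r s. c * B r s) = (\<lambda>r s. c * mat_mul n A B r s)"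
  by (auto simp: mat_mul_def fun_eq_iff algebra_simps sum_distrib_left)

lemma mat_mul_scale_left: "mat_mul n (\<lambda>r s. c * A r s) B = (\<lambda>r s. c * mat_mul n A B r s)"
  by (auto simp: mat_mul_def fun_eq_iff algebra_simps sum_distrib_left)

lemma mat_inverse_unique:
  assumes "A \<in> Mn n" "B \<in> Mn n" "mat_mul n A C = mat_one n" "mat_mul n C B = mat_one n"
  shows "A = B"
proof -
  have "A = mat_mul n A (mat_mul n C B)" unfolding assms(4) mat_mul_one_right[OF assms(1)] ..
  also have "\<dots> = B" unfolding mat_mul_assoc[symmetric] assms(3) mat_mul_one_left[OF assms(2)] ..
  finally show ?thesis .
qed

context matrix_algebra
begin

lemma mulc_diff_left: "mulc h (x - y) z = mulc h x z - mulc h y z"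
  unfolding mulc_def regular_def by (auto simp: fun_eq_iff left_diff_distrib sum_subtractf)

text \<open>The solutions and the algebra itself are the fixed points of two
  Frobenius-semilinear maps on the same space, also after restriction to the elements annihilated
  by a subset \<open>S\<close> of the algebra. Hence as many solutions as elements of the algebra have a given
  annihilator; a solution with the same annihilator as \<open>1\<close> is invertible.\<close>

lemma exists_invertible_solution:
  fixes h :: "'f \<Rightarrow> 'e::field"
  assumes h: "field_hom h"
    and U0: "U0 \<in> Mn n" "U0i \<in> Mn n" "mat_mul n U0 U0i = mat_one n"
    and eq: "mpow (card (UNIV :: 'f set)) U0 = mat_mul n U0 (emb h t)"
  shows "\<exists>u\<in>coords m. \<exists>w\<in>coords m. mat_mul n (emb h u) (emb h w) = mat_one n
    \<and> mat_mul n (emb h w) (emb h u) = mat_one n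
    \<and> mpow (card (UNIV :: 'f set)) (emb h u) = mat_mul n (emb h u) (emb h t)"
proof -
  let ?q = "card (UNIV :: 'f set)"
  let ?F = "\<lambda>y :: 'e. y ^ ?q"
  let ?z = "\<lambda>i j :: nat. 0 :: 'e"
  have q: "0 < ?q" using card_finite_field_gt_1[where 'f = 'f] by linarith
  note F = frob_field_hom[OF h]
  have Fh: "mmap ?F (mmap h a) = mmap h a" for a :: "nat \<Rightarrow> nat \<Rightarrow> 'f"
    using frob_fixed_iff[OF h] by (intro ext) simp
  have Fz: "mmap ?F ?z = ?z" using zero_power[OF q, where 'a = 'e] by (simp only:)
  have U0': "mat_mul n U0i U0 = mat_one n" by (rule mat_left_inverse_imp_right[OF U0(3)])
  have FU0: "mat_mul n (mmap ?F U0i) (mmap ?F U0) = mat_one n"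
    unfolding mmap_mat_mul[OF F, symmetric] U0' mmap_mat_one[OF F] ..
  \<comment> \<open>The equation for \<open>U0\<close> exhibits a left inverse of
    \<open>emb h t\<close>; the coordinates \<open>s\<close> of its inverse are then available in
    the algebra.\<close>
  have "mat_mul n (mat_mul n (mmap ?F U0i) U0) (emb h t) = mat_one n"
    unfolding mat_mul_assoc eq[symmetric] FU0 ..
  from regular_det(2)[OF h this] obtain s
    where s: "s \<in> coords m" "mat_mul n (emb h t) (emb h s) = mat_one n" by blast
  have s': "mat_mul n (emb h s) (emb h t) = mat_one n" by (rule mat_left_inverse_imp_right[OF s(2)])
  have FU0i: "mat_mul n (emb h s) U0i = mmap ?F U0i"
  proof (rule mat_inverse_unique[OF mat_mul_Mn mmap_Mn[OF F U0(2)]])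
    have "mat_mul n (mat_mul n (emb h s) U0i) (mmap ?F U0)
      = mat_mul n (emb h s) (mat_mul n (mat_mul n U0i U0) (emb h t))"
      unfolding eq mat_mul_assoc ..
    then show "mat_mul n (mat_mul n (emb h s) U0i) (mmap ?F U0) = mat_one n"
      unfolding U0' mat_mul_one_left[OF emb_Mn[OF h]] s' .
    show "mat_mul n (mmap ?F U0) (mmap ?F U0i) = mat_one n"
      by (rule mat_left_inverse_imp_right[OF FU0])
  qed
  \<comment> \<open>A matrix U solves the equation exactly when \<open>U U0i\<close> is fixed by
    Frobenius. Measured through this \<open>\<psi>\<close>, the rational vectors \<open>W\<close>
    are the solutions in the extended algebra; measured by plain coordinates, the rational vectors
    \<open>P\<close> are the algebra itself.\<close>
  define \<psi> where "\<psi> u = (\<lambda>(r, s). mat_mul n (emb h u) U0i r s)" for u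
  define Ann where "Ann u = {a\<in>\<A>. mat_mul n (mmap h a) (emb h u) = ?z}" for u
  define VS where "VS S = {u\<in>coords m. \<forall>a\<in>S. mat_mul n (mmap h a) (emb h u) = ?z}" for S
  define W where "W = {u\<in>coords m. \<forall>i. \<psi> u i \<in> range h}"
  define P where "P = {x\<in>coords m. \<forall>i. x i \<in> range h}"
  have VS_subspace: "fs.subspace (VS S)" for S
  proof (rule fs.subspaceI)
    have "emb h 0 = ?z" by (auto simp: emb_def)
    then show "0 \<in> VS S"
      unfolding VS_def using fs.subspace_0[OF subspace_coords] by (auto simp: mat_mul_zero_right)
    show "x + y \<in> VS S" if "x \<in> VS S" "y \<in> VS S" for x y
    proof -
      have "mat_mul n (mmap h a) (emb h (x + y)) = ?z" if "a \<in> S" for a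
      proof -
        have "mat_mul n (mmap h a) (emb h x) = ?z" "mat_mul n (mmap h a) (emb h y) = ?z"
          using that \<open>x \<in> VS S\<close> \<open>y \<in> VS S\<close> unfolding VS_def by auto
        then show ?thesis unfolding emb_add mat_mul_add_right by (auto simp: fun_eq_iff)
      qed
      then show ?thesis
        using that fs.subspace_add[OF subspace_coords[of m], of x y] unfolding VS_def by blast
    qed
    show "(\<lambda>i. c * x i) \<in> VS S" if "x \<in> VS S" for c x
    proof -
      have "mat_mul n (mmap h a) (emb h (\<lambda>i. c * x i)) = ?z" if "a \<in> S" for a
        using that \<open>x \<in> VS S\<close> unfolding emb_scale mat_mul_scale_right VS_def by auto
      then show ?thesis
        using that fs.subspace_scale[OF subspace_coords[of m], of x c] unfolding VS_def by blast
    qed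
  qed
  have frob_coords: "(\<lambda>i. ?F (u i)) \<in> coords m" if "u \<in> coords m" for u
    using that q unfolding coords_def by simp
  have frob_Ann: "mat_mul n (mmap h a) (emb h (\<lambda>i. ?F (u i))) = ?z"
    if "mat_mul n (mmap h a) (emb h u) = ?z" for a u
  proof -
    have "mat_mul n (mmap h a) (emb h (\<lambda>i. ?F (u i))) = mat_mul n (mmap ?F (mmap h a)) (mmap ?F (emb h u))"
      unfolding Fh mmap_frob_emb[OF h] ..
    also have "\<dots> = mmap ?F (mat_mul n (mmap h a) (emb h u))" unfolding mmap_mat_mul[OF F] ..
    finally show ?thesis unfolding that Fz .
  qed
  have fs1: "frobenius_structure h (VS S) \<psi> ({..<n} \<times> {..<n})" for S
  proof (unfold_locales, rule h, rule VS_subspace)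
    show "\<psi> (x + y) = \<psi> x + \<psi> y" for x y
      unfolding \<psi>_def emb_add mat_mul_add_left by auto
    show "\<psi> (\<lambda>i. c * x i) = (\<lambda>i. c * \<psi> x i)" for c x
      unfolding \<psi>_def emb_scale mat_mul_scale_left by auto
    show "x = 0" if x: "x \<in> VS S" and 0: "\<psi> x = 0" for x
    proof -
      have "mat_mul n (emb h x) U0i = ?z" using 0 by (auto simp: \<psi>_def fun_eq_iff)
      then have "mat_mul n (emb h x) (mat_mul n U0i U0) = ?z"
        unfolding mat_mul_assoc[symmetric] by (simp add: mat_mul_zero_left)
      then have "emb h x = 0" unfolding U0' mat_mul_one_right[OF emb_Mn[OF h]] by (auto simp: zero_fun_def)
      with x show ?thesis using emb_eq_0[OF h] unfolding VS_def by blast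
    qed
    show "\<psi> x i = 0" if "i \<notin> {..<n} \<times> {..<n}" for x i
      using that by (cases i) (auto simp: \<psi>_def mat_mul_def)
    show "\<exists>x'\<in>VS S. \<psi> x' = (\<lambda>i. ?F (\<psi> x i))" if x: "x \<in> VS S" for x
    proof
      \<comment> \<open>The semilinear map U to \<open>U^(q) A^(-1)\<close>, whose fixed points are
        the solutions. Multiplying on the right, it preserves annihilation from the left.\<close>
      let ?x = "mulc h (\<lambda>i. ?F (x i)) s"
      have "mat_mul n (mmap h a) (emb h ?x) = ?z" if "a \<in> S" for a
        using frob_Ann[of a x] x that unfolding emb_mulc[OF h] mat_mul_assoc[symmetric]
        by (simp add: VS_def mat_mul_zero_left)
      then show "?x \<in> VS S" unfolding VS_def by simp
      have "mat_mul n (emb h ?x) U0i = mmap ?F (mat_mul n (emb h x) U0i)"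
        unfolding emb_mulc[OF h] mat_mul_assoc FU0i mmap_frob_emb[OF h, symmetric] mmap_mat_mul[OF F] ..
      then show "\<psi> ?x = (\<lambda>i. ?F (\<psi> x i))" unfolding \<psi>_def by auto
    qed
  qed simp
  have fs2: "frobenius_structure h (VS S) id {..<m}" for S
  proof (unfold_locales, rule h, rule VS_subspace)
    show "\<exists>x'\<in>VS S. id x' = (\<lambda>i. ?F (id x i))" if x: "x \<in> VS S" for x
      using x frob_Ann frob_coords unfolding VS_def by auto
  qed (auto simp: VS_def coords_def)
  \<comment> \<open>The count depends only on the dimension of \<open>VS S\<close>, which is the
    same space for solutions and for algebra elements.\<close>
  have cardW: "card {u\<in>W. S \<subseteq> Ann u} = ?q ^ fs.dim (VS S)" if "S \<subseteq> \<A>" for S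
  proof -
    interpret A: frobenius_structure h "VS S" \<psi> "{..<n} \<times> {..<n}" by (rule fs1)
    have "A.VF = {u\<in>W. S \<subseteq> Ann u}" using that unfolding A.VF_def unfolding W_def VS_def Ann_def by auto
    then show ?thesis using A.card_VF by simp
  qed
  have cardP: "card {u\<in>P. S \<subseteq> Ann u} = ?q ^ fs.dim (VS S)" if "S \<subseteq> \<A>" for S
  proof -
    interpret A: frobenius_structure h "VS S" id "{..<m}" by (rule fs2)
    have "A.VF = {u\<in>P. S \<subseteq> Ann u}" using that unfolding A.VF_def unfolding P_def VS_def Ann_def by auto
    then show ?thesis using A.card_VF by simp
  qed
  have finW: "finite W"
  proof -
    interpret A: frobenius_structure h "VS {}" \<psi> "{..<n} \<times> {..<n}" by (rule fs1)
    have "A.VF = W" unfolding A.VF_def unfolding W_def VS_def by auto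
    then show ?thesis using A.finite_VF by simp
  qed
  have spanW: "coords m \<subseteq> fs.span W"
  proof -
    interpret A: frobenius_structure h "VS {}" \<psi> "{..<n} \<times> {..<n}" by (rule fs1)
    have "A.VF = W" unfolding A.VF_def unfolding W_def VS_def by auto
    then show ?thesis using A.subset_span_VF by (simp add: VS_def)
  qed
  have finP: "finite P"
  proof -
    interpret A: frobenius_structure h "VS {}" id "{..<m}" by (rule fs2)
    have "A.VF = P" unfolding A.VF_def unfolding P_def VS_def by auto
    then show ?thesis using A.finite_VF by simp
  qed
  let ?e = "\<lambda>i. h (\<epsilon> i)"
  have eP: "?e \<in> P" unfolding P_def using \<epsilon>_coords[OF h] by auto
  have e_Ann: "Ann ?e = {\<lambda>_ _. 0}"
  proof -
    have "a = (\<lambda>_ _. 0)" if a: "a \<in> Ann ?e" for a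
    proof -
      have "mat_mul n (mmap h a) (mat_one n) = ?z" using a unfolding Ann_def emb_\<epsilon>[OF h] by auto
      moreover have "mmap h a \<in> Mn n" using a \<A>_Mn by (intro mmap_Mn[OF h]) (auto simp: Ann_def)
      ultimately have "mmap h a = ?z" by (simp add: mat_mul_one_right)
      then have "h (a r s) = 0" for r s by (auto simp: fun_eq_iff)
      then show ?thesis using field_hom_eq_0_iff[OF h] by auto
    qed
    then show ?thesis using zero_in by (auto simp: Ann_def field_homD[OF h] mat_mul_zero_left)
  qed
  have "card {u\<in>W. Ann u = {\<lambda>_ _. 0}} = card {u\<in>P. Ann u = {\<lambda>_ _. 0}}"
    by (rule card_fibre_eq[OF finite_\<A> finW finP]) (use cardW cardP zero_in in \<open>auto simp: Ann_def\<close>)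
  moreover have "card {u\<in>P. Ann u = {\<lambda>_ _. 0}} \<noteq> 0"
    using eP e_Ann finP by auto
  ultimately have "{u\<in>W. Ann u = {\<lambda>_ _. 0}} \<noteq> {}" by (metis card.empty)
  then obtain u where u: "u \<in> W" "Ann u = {\<lambda>_ _. 0}" by blast
  have uE: "u \<in> coords m" using u(1) unfolding W_def by blast
  \<comment> \<open>A difference of two elements of \<open>P\<close> with the same product with
    \<open>u\<close> comes from an algebra element annihilating \<open>u\<close>, hence is
    zero.\<close>
  have inj: "inj_on (\<lambda>x. mulc h x u) P"
  proof (rule inj_onI)
    fix x y assume x: "x \<in> P" and y: "y \<in> P" and xy: "mulc h x u = mulc h y u"
    have "\<forall>i. \<exists>c. x i - y i = h c"
    proof
      fix i
      obtain c d where "x i = h c" "y i = h d" using x y unfolding P_def by blast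
      then have "x i - y i = h (c - d)" by (simp add: field_hom_simps[OF h])
      then show "\<exists>c. x i - y i = h c" ..
    qed
    then obtain c where c: "\<And>i. x i - y i = h (c i)" by metis
    let ?a = "\<lambda>r s. \<Sum>i<m. c i * v i r s"
    have "mmap h ?a = emb h (x - y)"
      using emb_combination[OF h, of c] c by (simp add: emb_def)
    moreover have "mulc h (x - y) u = (\<lambda>_. 0)"
      unfolding mulc_diff_left xy by (simp add: fun_eq_iff)
    ultimately have "mat_mul n (mmap h ?a) (emb h u) = ?z"
      using emb_mulc[OF h, of "x - y" u] by (simp add: emb_def)
    moreover have "?a \<in> \<A>" by (rule combination_in) simp
    ultimately have "?a \<in> Ann u" unfolding Ann_def by blast
    then have "?a = (\<lambda>_ _. 0)" using u(2) by simp
    then have "c i = 0" if "i < m" for i using combination_eq_0 that by blast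
    then have "x i = y i" if "i < m" for i using c[of i] that by (simp add: field_homD[OF h])
    then show "x = y" using x y unfolding P_def by (intro coords_eqI[of x m y]) auto
  qed
  have sub: "(\<lambda>x. mulc h x u) ` P \<subseteq> W"
  proof (rule image_subsetI)
    fix x assume x: "x \<in> P"
    then have Fx: "?F (x i) = x i" for i using frob_fixed_iff[OF h] unfolding P_def by blast
    have "mmap ?F (mat_mul n (emb h u) U0i) = mat_mul n (emb h u) U0i"
      using u(1) frob_fixed_iff[OF h] unfolding W_def \<psi>_def by (auto simp: fun_eq_iff)
    then have "mmap ?F (mat_mul n (emb h (mulc h x u)) U0i) = mat_mul n (emb h (mulc h x u)) U0i"
      unfolding emb_mulc[OF h] mat_mul_assoc mmap_mat_mul[OF F, of n "emb h x"] mmap_frob_emb[OF h] by (simp add: Fx)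
    from fun_cong[OF fun_cong[OF this]] have "\<psi> (mulc h x u) i \<in> range h" for i
      unfolding \<psi>_def using frob_fixed_iff[OF h] by (cases i) auto
    then show "mulc h x u \<in> W" unfolding W_def by simp
  qed
  have "card W = card P" using cardW[of "{}"] cardP[of "{}"] by simp
  then have surj: "(\<lambda>x. mulc h x u) ` P = W"
    using card_subset_eq[OF finW sub] card_image[OF inj] by simp
  \<comment> \<open>The multiples of \<open>u\<close> by the extended algebra form a subspace
    containing \<open>W\<close>, which spans everything. So 1 is such a multiple, and
    \<open>u\<close> is a unit.\<close>
  have "fs.subspace (range (\<lambda>x. mulc h x u))"
  proof (intro fs.subspaceI)
    show "0 \<in> range (\<lambda>x. mulc h x u)"
      by (rule image_eqI[of _ _ 0]) (auto simp: mulc_def regular_def fun_eq_iff)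
  qed (auto simp: mulc_add_left[symmetric] mulc_scale_left[symmetric])
  then have "fs.span W \<subseteq> range (\<lambda>x. mulc h x u)"
    using surj by (intro fs.span_minimal) auto
  then have "?e \<in> range (\<lambda>x. mulc h x u)" using spanW \<epsilon>_coords[OF h] by blast
  then obtain x where "mulc h x u = ?e" by auto
  then have "mat_mul n (emb h x) (emb h u) = mat_one n"
    unfolding emb_mulc[OF h, symmetric] by (simp add: emb_\<epsilon>[OF h])
  from regular_det(2)[OF h this] obtain w
    where w: "w \<in> coords m" "mat_mul n (emb h u) (emb h w) = mat_one n" by blast
  moreover have "mmap ?F (emb h u) = mat_mul n (emb h u) (emb h t)"
  proof -
    have fxd: "mmap ?F (mat_mul n (emb h u) U0i) = mat_mul n (emb h u) U0i"
      using u(1) frob_fixed_iff[OF h] unfolding W_def \<psi>_def by (auto simp: fun_eq_iff)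
    have "emb h u = mat_mul n (mat_mul n (emb h u) U0i) U0"
      unfolding mat_mul_assoc U0' mat_mul_one_right[OF emb_Mn[OF h]] ..
    then have "mmap ?F (emb h u) = mmap ?F (mat_mul n (mat_mul n (emb h u) U0i) U0)" by metis
    also have "\<dots> = mat_mul n (mat_mul n (mat_mul n (emb h u) U0i) U0) (emb h t)"
      unfolding mmap_mat_mul[OF F, of n "mat_mul n (emb h u) U0i"] fxd eq by (rule mat_mul_assoc[symmetric])
    also have "\<dots> = mat_mul n (emb h u) (emb h t)"
      unfolding mat_mul_assoc[of n "emb h u"] U0' mat_mul_one_right[OF emb_Mn[OF h]] ..
    finally show ?thesis .
  qed
  ultimately show ?thesis using uE mat_left_inverse_imp_right by blast
qed

end

section \<open>Specialization of rational functions\<close>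

definition alg_indep :: "nat \<Rightarrow> ('k::field \<Rightarrow> 'a::field) \<Rightarrow> (nat \<Rightarrow> 'a) \<Rightarrow> bool" where
  "alg_indep m e t \<longleftrightarrow> (\<forall>S c. finite S \<and> S \<subseteq> exps m \<and> mpeval m e S c t = 0 \<longrightarrow> (\<forall>\<alpha>\<in>S. c \<alpha> = 0))"

lemma mpeval_hom:
  assumes "field_hom g"
  shows "mpeval m (g \<circ> h) S c (\<lambda>j. g (x j)) = g (mpeval m h S c x)"
  unfolding mpeval_def by (simp add: field_hom_simps[OF assms])

lemma mpeval_cong: "(\<And>j. j < m \<Longrightarrow> x j = y j) \<Longrightarrow> mpeval m h S c x = mpeval m h S c y"
  unfolding mpeval_def by simp

lemma mpeval_extend:
  assumes "field_hom h" "finite S'" "S \<subseteq> S'"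
  shows "mpeval m h S c x = mpeval m h S' (\<lambda>\<alpha>. if \<alpha> \<in> S then c \<alpha> else 0) x"
  unfolding mpeval_def using assms by (intro sum.mono_neutral_cong_left) (auto simp: field_homD)

lemma mpeval_zero: "field_hom h \<Longrightarrow> (\<And>\<alpha>. \<alpha> \<in> S \<Longrightarrow> c \<alpha> = 0) \<Longrightarrow> mpeval m h S c x = 0"
  unfolding mpeval_def by (simp add: field_homD)

lemma mpeval_sum: "finite S \<Longrightarrow> mpeval m h S c x = (\<Sum>\<alpha>\<in>S. mpeval m h {\<alpha>} c x)"
  unfolding mpeval_def by simp

section \<open>Evaluating the same polynomials and fractions at two points\<close>

locale specialization =
  fixes m :: nat and e :: "'k::field \<Rightarrow> 'a::field" and h :: "'k \<Rightarrow> 'b::field"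
    and t :: "nat \<Rightarrow> 'a" and x :: "nat \<Rightarrow> 'b"
  assumes e: "field_hom e" and h: "field_hom h"
begin

text \<open>The two arguments are values of one polynomial over the coefficient field, at
  \<open>t\<close> and at \<open>x\<close>. Working with pairs of values avoids naming the
  polynomial.\<close>

definition prel :: "'a \<Rightarrow> 'b \<Rightarrow> bool" where
  "prel a b \<longleftrightarrow> (\<exists>S c. finite S \<and> S \<subseteq> exps m \<and> a = mpeval m e S c t \<and> b = mpeval m h S c x)"

lemma prelI: "finite S \<Longrightarrow> S \<subseteq> exps m \<Longrightarrow> prel (mpeval m e S c t) (mpeval m h S c x)"
  unfolding prel_def by blast

lemma prel_const: "prel (e c) (h c)"
  using prelI[of "{\<lambda>_. 0}" "\<lambda>_. c"] by (simp add: mpeval_def exps_def)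

lemma prel_0: "prel 0 0" and prel_1: "prel 1 1"
  using prel_const[of 0] prel_const[of 1] by (auto simp: field_homD[OF e] field_homD[OF h])

lemma prel_var: "i < m \<Longrightarrow> prel (t i) (x i)"
proof -
  assume i: "i < m"
  have *: "(\<Prod>j<m. y j ^ (if j = i then 1 else 0)) = y i" for y :: "nat \<Rightarrow> 'z::field"
  proof -
    have "(\<Prod>j<m. y j ^ (if j = i then 1 else 0)) = (\<Prod>j<m. if j = i then y j else 1)"
      by (intro prod.cong) auto
    then show ?thesis using i by simp
  qed
  show ?thesis
    using prelI[of "{\<lambda>j. if j = i then 1 else 0}" "\<lambda>_. 1"] i
    by (simp add: mpeval_def exps_def * field_homD[OF e] field_homD[OF h])
qed

lemma prel_add: "prel a b \<Longrightarrow> prel a' b' \<Longrightarrow> prel (a + a') (b + b')"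
proof -
  assume "prel a b" "prel a' b'"
  then obtain S c S' c' where S: "finite S" "S \<subseteq> exps m" "a = mpeval m e S c t" "b = mpeval m h S c x"
    and S': "finite S'" "S' \<subseteq> exps m" "a' = mpeval m e S' c' t" "b' = mpeval m h S' c' x"
    unfolding prel_def by blast
  let ?d = "\<lambda>\<alpha>. (if \<alpha> \<in> S then c \<alpha> else 0) + (if \<alpha> \<in> S' then c' \<alpha> else 0)"
  have *: "mpeval m g S c y + mpeval m g S' c' y = mpeval m g (S \<union> S') ?d y" if "field_hom g"
    for g :: "'k \<Rightarrow> 'z::field" and y
    using S(1) S'(1)
    by (subst mpeval_extend[OF that, of "S \<union> S'" S], simp, simp,
        subst mpeval_extend[OF that, of "S \<union> S'" S'], simp, simp)
      (simp add: mpeval_def field_homD[OF that] distrib_right sum.distrib)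
  show ?thesis
    unfolding S(3,4) S'(3,4) *[OF e] *[OF h] using S S' by (intro prelI) auto
qed

lemma prel_sum: "(\<And>i. i \<in> I \<Longrightarrow> prel (f i) (g i)) \<Longrightarrow> prel (sum f I) (sum g I)"
  by (induction I rule: infinite_finite_induct) (auto intro: prel_0 prel_add)

text \<open>Multiplication by a monomial translates exponents injectively, so the coefficient of a
  translated exponent is found by subtracting \<open>\<beta>\<close>.\<close>

lemma prel_monomial_mult:
  assumes "prel a b" "\<beta> \<in> exps m"
  shows "prel (mpeval m e {\<beta>} d t * a) (mpeval m h {\<beta>} d x * b)"
proof -
  obtain S c where S: "finite S" "S \<subseteq> exps m" "a = mpeval m e S c t" "b = mpeval m h S c x"
    using assms(1) unfolding prel_def by blast
  let ?s = "\<lambda>\<alpha> j. \<alpha> j + \<beta> j :: nat"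
  have inj: "inj_on ?s S" by (rule inj_onI) (auto simp: fun_eq_iff)
  have *: "mpeval m g {\<beta>} d y * mpeval m g S c y = mpeval m g (?s ` S) (\<lambda>\<alpha>. d \<beta> * c (\<lambda>j. \<alpha> j - \<beta> j)) y"
    if "field_hom g" for g :: "'k \<Rightarrow> 'z::field" and y
    unfolding mpeval_def sum.reindex[OF inj]
    by (simp add: sum_distrib_left field_homD[OF that] power_add prod.distrib mult_ac)
  show ?thesis
    unfolding S(3,4) *[OF e] *[OF h]
    using S assms(2) by (intro prelI) (auto simp: exps_def)
qed

lemma prel_mult: "prel a b \<Longrightarrow> prel a' b' \<Longrightarrow> prel (a * a') (b * b')"
proof -
  assume "prel a b" and ab': "prel a' b'"
  then obtain S c where S: "finite S" "S \<subseteq> exps m" "a = mpeval m e S c t" "b = mpeval m h S c x"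
    unfolding prel_def by blast
  have "prel (\<Sum>\<alpha>\<in>S. mpeval m e {\<alpha>} c t * a') (\<Sum>\<alpha>\<in>S. mpeval m h {\<alpha>} c x * b')"
    using S(2) ab' by (intro prel_sum prel_monomial_mult) auto
  then show ?thesis
    unfolding S(3,4) mpeval_sum[OF S(1), of m e] mpeval_sum[OF S(1), of m h] sum_distrib_right .
qed

lemma prel_uminus: "prel a b \<Longrightarrow> prel (- a) (- b)"
  using prel_mult[OF prel_const[of "- 1"], of a b] by (simp add: field_hom_simps[OF e] field_hom_simps[OF h])

lemma prel_prod: "(\<And>i. i \<in> I \<Longrightarrow> prel (f i) (g i)) \<Longrightarrow> prel (prod f I) (prod g I)"
  by (induction I rule: infinite_finite_induct) (auto intro: prel_1 prel_mult)

lemma prel_power: "prel a b \<Longrightarrow> prel (a ^ k) (b ^ k)"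
  by (induction k) (auto intro: prel_1 prel_mult)

lemma prel_det:
  assumes "\<And>i j. i < N \<Longrightarrow> j < N \<Longrightarrow> prel (f i j) (g i j)"
  shows "prel (det (mat N N (\<lambda>(i, j). f i j))) (det (mat N N (\<lambda>(i, j). g i j)))"
proof -
  have sign: "prel (signof p) (signof p)" for p :: "nat \<Rightarrow> nat"
    using prel_1 prel_uminus[OF prel_1] by (auto simp: sign_def)
  have "prel (\<Prod>i = 0..<N. mat N N (\<lambda>(i, j). f i j) $$ (i, p i)) (\<Prod>i = 0..<N. mat N N (\<lambda>(i, j). g i j) $$ (i, p i))"
    if "p permutes {0..<N}" for p
    using permutes_in_image[OF that] by (intro prel_prod) (auto intro!: assms)
  then show ?thesis
    unfolding det_def by (auto intro!: prel_sum prel_mult sign)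
qed

lemma prel_adj_mat:
  assumes f: "\<And>i j. i < N \<Longrightarrow> j < N \<Longrightarrow> prel (f i j) (g i j)" and "i < N" "j < N"
  shows "prel (adj_mat (mat N N (\<lambda>(i, j). f i j)) $$ (i, j)) (adj_mat (mat N N (\<lambda>(i, j). g i j)) $$ (i, j))"
proof -
  let ?s = "\<lambda>i k :: nat. if k < i then k else Suc k"
  have del: "mat_delete (mat N N (\<lambda>(i, j). f i j)) j i = mat (N - 1) (N - 1) (\<lambda>(k, l). f (?s j k) (?s i l))"
    for f :: "nat \<Rightarrow> nat \<Rightarrow> 'z"
    unfolding mat_delete_def using assms(2,3) by (intro eq_matI) auto
  have "prel (det (mat (N - 1) (N - 1) (\<lambda>(k, l). f (?s j k) (?s i l))))
    (det (mat (N - 1) (N - 1) (\<lambda>(k, l). g (?s j k) (?s i l))))"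
    using assms(2,3) by (intro prel_det f) auto
  moreover have "prel ((- 1) ^ (j + i)) ((- 1) ^ (j + i))"
    by (intro prel_power prel_uminus prel_1)
  ultimately show ?thesis
    using assms(2,3) by (simp add: adj_mat_def cofactor_def del prel_mult)
qed

text \<open>The graph of the partial specialization map: some representation of \<open>a\<close> as
  a fraction must keep a nonzero denominator at \<open>x\<close>.\<close>

definition rrel :: "'a \<Rightarrow> 'b \<Rightarrow> bool" where
  "rrel a b \<longleftrightarrow> (\<exists>p p' r r'. prel p p' \<and> prel r r' \<and> r \<noteq> 0 \<and> r' \<noteq> 0 \<and> a = p / r \<and> b = p' / r')"

lemma rrelI: "prel p p' \<Longrightarrow> prel r r' \<Longrightarrow> r \<noteq> 0 \<Longrightarrow> r' \<noteq> 0 \<Longrightarrow> rrel (p / r) (p' / r')"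
  unfolding rrel_def by blast

lemma rrelE:
  assumes "rrel a b"
  obtains p p' r r' where "prel p p'" "prel r r'" "r \<noteq> 0" "r' \<noteq> 0" "a = p / r" "b = p' / r'"
  using assms unfolding rrel_def by blast

lemma prel_imp_rrel: "prel a b \<Longrightarrow> rrel a b"
  using rrelI[OF _ prel_1, of a b] by simp

lemma rrel_0: "rrel 0 0" and rrel_1: "rrel 1 1"
  by (auto intro: prel_imp_rrel prel_0 prel_1)

lemma rrel_add: "rrel a b \<Longrightarrow> rrel a' b' \<Longrightarrow> rrel (a + a') (b + b')"
  by (elim rrelE, hypsubst, subst add_frac_eq, assumption, assumption, subst add_frac_eq, assumption, assumption)
    (intro rrelI prel_add prel_mult, auto)

lemma rrel_mult: "rrel a b \<Longrightarrow> rrel a' b' \<Longrightarrow> rrel (a * a') (b * b')"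
  by (elim rrelE, hypsubst, unfold times_divide_times_eq) (intro rrelI prel_mult, auto)

lemma rrel_uminus: "rrel a b \<Longrightarrow> rrel (- a) (- b)"
  using rrel_mult[OF prel_imp_rrel[OF prel_uminus[OF prel_1]], of a b] by simp

lemma rrel_diff: "rrel a b \<Longrightarrow> rrel a' b' \<Longrightarrow> rrel (a - a') (b - b')"
  using rrel_add[OF _ rrel_uminus, of a b a' b'] by simp

lemma rrel_inverse: "rrel a b \<Longrightarrow> a \<noteq> 0 \<Longrightarrow> b \<noteq> 0 \<Longrightarrow> rrel (inverse a) (inverse b)"
  by (elim rrelE, hypsubst) (simp add: rrelI)

lemma rrel_sum: "(\<And>i. i \<in> I \<Longrightarrow> rrel (f i) (g i)) \<Longrightarrow> rrel (sum f I) (sum g I)"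
  by (induction I rule: infinite_finite_induct) (auto intro: rrel_0 rrel_add)

lemma rrel_prod: "(\<And>i. i \<in> I \<Longrightarrow> rrel (f i) (g i)) \<Longrightarrow> rrel (prod f I) (prod g I)"
  by (induction I rule: infinite_finite_induct) (auto intro: rrel_1 rrel_mult)

lemma rrel_power: "rrel a b \<Longrightarrow> rrel (a ^ k) (b ^ k)"
  by (induction k) (auto intro: rrel_1 rrel_mult)

lemma rrel_mpeval:
  "(\<And>j. j < m' \<Longrightarrow> rrel (y j) (z j)) \<Longrightarrow> rrel (mpeval m' e S c y) (mpeval m' h S c z)"
  unfolding mpeval_def by (intro rrel_sum rrel_mult rrel_prod rrel_power prel_imp_rrel[OF prel_const]) auto

lemma rrel_mat_mul:
  "(\<And>i j. rrel (A i j) (A' i j)) \<Longrightarrow> (\<And>i j. rrel (B i j) (B' i j)) \<Longrightarrow> rrel (mat_mul n A B i j) (mat_mul n A' B' i j)"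
  unfolding mat_mul_def by (auto intro!: rrel_sum rrel_mult rrel_0)

lemma rrel_specializes: "rrel a b \<Longrightarrow> specializes m e t h x a b"
proof -
  assume "rrel a b"
  then obtain p p' r r' where *: "prel p p'" "prel r r'" "r \<noteq> 0" "r' \<noteq> 0" "a = p / r" "b = p' / r'"
    by (rule rrelE)
  obtain S c where S: "finite S" "S \<subseteq> exps m" "p = mpeval m e S c t" "p' = mpeval m h S c x"
    using *(1) unfolding prel_def by blast
  obtain S' c' where S': "finite S'" "S' \<subseteq> exps m" "r = mpeval m e S' c' t" "r' = mpeval m h S' c' x"
    using *(2) unfolding prel_def by blast
  \<comment> \<open>\<open>specializes\<close> uses one exponent set for numerator and denominator,
    so both are padded with zero coefficients to the union.\<close>
  let ?c = "\<lambda>\<alpha>. if \<alpha> \<in> S then c \<alpha> else 0" and ?c' = "\<lambda>\<alpha>. if \<alpha> \<in> S' then c' \<alpha> else 0"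
  let ?U = "S \<union> S'"
  have fin: "finite ?U" "S \<subseteq> ?U" "S' \<subseteq> ?U" using S S' by auto
  note ext = mpeval_extend[OF e fin(1,2), of m c t] mpeval_extend[OF h fin(1,2), of m c x]
    mpeval_extend[OF e fin(1,3), of m c' t] mpeval_extend[OF h fin(1,3), of m c' x]
  show ?thesis
    unfolding specializes_def
    by (rule exI[of _ ?U], rule exI[of _ ?c], rule exI[of _ ?c'])
      (use * S S' fin in \<open>simp add: ext[symmetric]\<close>)
qed

text \<open>A polynomial vanishing at the independent point \<open>t\<close> is the zero polynomial,
  so it vanishes at every \<open>x\<close>.\<close>

lemma prel_eq_0: "alg_indep m e t \<Longrightarrow> prel a b \<Longrightarrow> a = 0 \<Longrightarrow> b = 0"
  using mpeval_zero[OF h] unfolding prel_def alg_indep_def by metis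

lemma rrel_eq_0: "alg_indep m e t \<Longrightarrow> rrel a b \<Longrightarrow> a = 0 \<Longrightarrow> b = 0"
  by (elim rrelE) (auto dest: prel_eq_0)

lemma rrel_functional: "alg_indep m e t \<Longrightarrow> rrel a b \<Longrightarrow> rrel a b' \<Longrightarrow> b = b'"
  using rrel_eq_0[OF _ rrel_diff, of a b a b'] by simp

end

section \<open>Rational function fields, homomorphisms out of them and common denominators\<close>

lemma rat_fun_field_iff:
  "is_rat_fun_field m e t \<longleftrightarrow> field_hom e \<and> alg_indep m e t \<and> rat_funs m e t = UNIV"
  unfolding is_rat_fun_field_def alg_indep_def rat_funs_def
  by (simp only: set_eq_iff mem_Collect_eq UNIV_I simp_thms)

lemma rat_funs_subfield:
  fixes t :: "nat \<Rightarrow> 'a::field"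
  assumes "field_hom e"
  shows "is_subfield (rat_funs m e t)" and "e c \<in> rat_funs m e t" and "i < m \<Longrightarrow> t i \<in> rat_funs m e t"
proof -
  \<comment> \<open>With both points equal, being a rational function is being
    \<open>rrel\<close>-related to itself, so closure under the field operations is inherited from
    \<open>rrel\<close>.\<close>
  interpret specialization m e e t t using assms by unfold_locales
  have diag: "prel a b \<Longrightarrow> a = b" for a b unfolding prel_def by auto
  have diag': "rrel a b \<Longrightarrow> a = b" for a b by (elim rrelE) (auto dest: diag)
  have iff: "a \<in> rat_funs m e t \<longleftrightarrow> rrel a a" for a
  proof
    assume "rrel a a"
    from rrel_specializes[OF this] show "a \<in> rat_funs m e t"
      unfolding specializes_def rat_funs_def by blast
  next
    assume "a \<in> rat_funs m e t"
    then show "rrel a a" unfolding rat_funs_def by (auto intro!: rrelI prelI)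
  qed
  show "is_subfield (rat_funs m e t)"
  proof -
    have "rrel (inverse a) (inverse a)" if "rrel a a" for a
      using that rrel_inverse[OF that] rrel_0 by (cases "a = 0") auto
    then show ?thesis
      unfolding is_subfield_def Ball_def iff
      by (intro conjI allI impI rrel_0 rrel_1 rrel_add rrel_mult rrel_uminus)
  qed
  show "e c \<in> rat_funs m e t" unfolding iff by (rule prel_imp_rrel[OF prel_const])
  show "t i \<in> rat_funs m e t" if "i < m" unfolding iff by (rule prel_imp_rrel[OF prel_var[OF that]])
qed

text \<open>The homomorphism has \<open>rrel\<close> as its graph. Independence of \<open>x\<close>
  keeps every denominator nonzero, so the relation is total; independence of \<open>t\<close> makes
  it single-valued.\<close>

lemma rat_fun_hom_exists:
  fixes e :: "'k::field \<Rightarrow> 'a::field" and h :: "'k \<Rightarrow> 'b::field"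
  assumes t: "is_rat_fun_field m e t" and h: "field_hom h" and x: "alg_indep m h x"
  shows "\<exists>\<sigma>. field_hom \<sigma> \<and> (\<forall>c. \<sigma> (e c) = h c) \<and> (\<forall>i<m. \<sigma> (t i) = x i)"
proof -
  interpret specialization m e h t x
    using t h unfolding rat_fun_field_iff by unfold_locales auto
  have ind: "alg_indep m e t" using t unfolding rat_fun_field_iff by blast
  have ex: "\<exists>b. rrel a b" for a
  proof -
    have "a \<in> rat_funs m e t" using t unfolding rat_fun_field_iff by blast
    then obtain S P Q where S: "finite S" "S \<subseteq> exps m" "mpeval m e S Q t \<noteq> 0"
      "a = mpeval m e S P t / mpeval m e S Q t" unfolding rat_funs_def by blast
    have "mpeval m h S Q x \<noteq> 0"
    proof
      assume "mpeval m h S Q x = 0"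
      then have "\<forall>\<alpha>\<in>S. Q \<alpha> = 0" using x S unfolding alg_indep_def by blast
      then have "mpeval m e S Q t = 0" unfolding mpeval_def by (simp add: field_homD[OF e])
      with S show False by simp
    qed
    then show ?thesis using S by (auto intro!: rrelI prelI)
  qed
  define \<sigma> where "\<sigma> a = (THE b. rrel a b)" for a
  have \<sigma>: "\<sigma> a = b" if "rrel a b" for a b
    unfolding \<sigma>_def using that rrel_functional[OF ind] by blast
  have rel: "rrel a (\<sigma> a)" for a using ex[of a] \<sigma> by metis
  have "field_hom \<sigma>"
    unfolding field_hom_def
    by (intro conjI allI \<sigma> rrel_0 rrel_1 rrel_add rrel_mult rel)
  then show ?thesis using \<sigma> prel_imp_rrel[OF prel_const] prel_imp_rrel[OF prel_var] by blast
qed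

lemma rat_fun_hom_unique:
  assumes t: "is_rat_fun_field m e t" and "field_hom \<sigma>" "field_hom \<tau>"
    and "\<And>c. \<sigma> (e c) = \<tau> (e c)" "\<And>i. i < m \<Longrightarrow> \<sigma> (t i) = \<tau> (t i)"
  shows "\<sigma> = \<tau>"
proof
  fix a
  have "a \<in> rat_funs m e t" using t unfolding rat_fun_field_iff by blast
  then obtain S P Q where a: "a = mpeval m e S P t / mpeval m e S Q t"
    unfolding rat_funs_def by blast
  have "\<sigma> \<circ> e = \<tau> \<circ> e" using assms(4) by auto
  moreover have "mpeval m g S c (\<lambda>j. \<sigma> (t j)) = mpeval m g S c (\<lambda>j. \<tau> (t j))" for g c
    by (rule mpeval_cong) (rule assms(5))
  ultimately have "\<sigma> (mpeval m e S c t) = \<tau> (mpeval m e S c t)" for c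
    unfolding mpeval_hom[OF assms(2), symmetric] mpeval_hom[OF assms(3), symmetric] by simp
  then show "\<sigma> a = \<tau> a" unfolding a field_hom_divide[OF assms(2)] field_hom_divide[OF assms(3)] by simp
qed

text \<open>The product of denominators works for all points at once. The witness is chosen before
  \<open>h\<close> and \<open>x\<close> because the point at which it must not vanish is found only
  later, by an argument about this very polynomial.\<close>

lemma common_denominator:
  fixes e :: "'k::field \<Rightarrow> 'a::field"
  assumes t: "is_rat_fun_field m e t" and "finite A"
  shows "\<exists>S c. finite S \<and> S \<subseteq> exps m \<and> mpeval m e S c t \<noteq> 0 \<and>
    (\<forall>(h :: 'k \<Rightarrow> 'b::field) x. field_hom h \<longrightarrow> mpeval m h S c x \<noteq> 0
      \<longrightarrow> (\<forall>a\<in>A. \<exists>b. specialization.rrel m e h t x a b))"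
  using \<open>finite A\<close>
proof (induction A rule: finite_induct)
  case empty
  have e: "field_hom e" using t unfolding rat_fun_field_iff by blast
  show ?case
    by (rule exI[of _ "{\<lambda>_. 0}"], rule exI[of _ "\<lambda>_. 1"]) (simp add: exps_def mpeval_def field_homD[OF e])
next
  case (insert a A)
  have e: "field_hom e" and ind: "alg_indep m e t" using t unfolding rat_fun_field_iff by blast+
  interpret K: specialization m e e t t using e by unfold_locales
  obtain S c where S: "finite S" "S \<subseteq> exps m" "mpeval m e S c t \<noteq> 0"
    "\<And>(h :: 'k \<Rightarrow> 'b) x a. field_hom h \<Longrightarrow> mpeval m h S c x \<noteq> 0 \<Longrightarrow> a \<in> A \<Longrightarrow> \<exists>b. specialization.rrel m e h t x a b"
    using insert.IH by blast
  have "a \<in> rat_funs m e t" using t unfolding rat_fun_field_iff by blast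
  then obtain S' P Q where S': "finite S'" "S' \<subseteq> exps m" "mpeval m e S' Q t \<noteq> 0"
    "a = mpeval m e S' P t / mpeval m e S' Q t" unfolding rat_funs_def by blast
  have "K.prel (mpeval m e S c t * mpeval m e S' Q t) (mpeval m e S c t * mpeval m e S' Q t)"
    using S S' by (intro K.prel_mult K.prelI)
  then obtain T R where T: "finite T" "T \<subseteq> exps m" "mpeval m e S c t * mpeval m e S' Q t = mpeval m e T R t"
    unfolding K.prel_def by blast
  \<comment> \<open>The factorization is known at \<open>t\<close> only; it holds at every point
    because specialization from the independent \<open>t\<close> is single-valued.\<close>
  have prod: "mpeval m h S c x * mpeval m h S' Q x = mpeval m h T R x" if h: "field_hom h"
    for h :: "'k \<Rightarrow> 'b" and x
  proof -
    interpret L: specialization m e h t x using e h by unfold_locales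
    have "L.prel (mpeval m e T R t) (mpeval m h S c x * mpeval m h S' Q x)"
      unfolding T(3)[symmetric] using S S' by (intro L.prel_mult L.prelI)
    then show ?thesis
      using L.rrel_functional[OF ind L.prel_imp_rrel L.prel_imp_rrel] L.prelI[OF T(1,2), of R] by blast
  qed
  show ?case
  proof (intro exI[of _ T] exI[of _ R] conjI allI impI T)
    show "mpeval m e T R t \<noteq> 0" unfolding T(3)[symmetric] using S S' by simp
    fix h :: "'k \<Rightarrow> 'b" and x assume h: "field_hom h" and nz: "mpeval m h T R x \<noteq> 0"
    then have nz': "mpeval m h S c x \<noteq> 0" "mpeval m h S' Q x \<noteq> 0" unfolding prod[OF h, symmetric] by auto
    interpret L: specialization m e h t x using e h by unfold_locales
    have "L.rrel a (mpeval m h S' P x / mpeval m h S' Q x)"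
      unfolding S'(4) using S' nz' by (intro L.rrelI L.prelI) auto
    then show "\<forall>a\<in>insert a A. \<exists>b. L.rrel a b" using S(4)[OF h nz'(1)] by blast
  qed
qed

text \<open>Coordinates are moved into \<open>T\<close> one at a time: in each of them
  \<open>g\<close> is a one-variable polynomial, nonzero at the current value, so only finitely many
  elements of \<open>T\<close> are forbidden.\<close>

lemma nonvanishing_point:
  fixes g :: "(nat \<Rightarrow> 'e::field) \<Rightarrow> 'e"
  assumes poly: "\<And>i y. i < r \<Longrightarrow> \<exists>p. \<forall>z. g (y(i := z)) = poly p z"
    and "infinite T" and "g y \<noteq> 0"
  shows "\<exists>y'. (\<forall>i<r. y' i \<in> T) \<and> (\<forall>i\<ge>r. y' i = y i) \<and> g y' \<noteq> 0"
  using poly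
proof (induction r)
  case 0
  then show ?case using \<open>g y \<noteq> 0\<close> by auto
next
  case (Suc r)
  then obtain y' where y': "\<forall>i<r. y' i \<in> T" "\<forall>i\<ge>r. y' i = y i" "g y' \<noteq> 0" by fastforce
  obtain p where p: "\<And>z. g (y'(r := z)) = poly p z" using Suc.prems[of r y'] by blast
  have "poly p (y' r) \<noteq> 0" using p[of "y' r"] y'(3) by simp
  then have "p \<noteq> 0" by auto
  then have "finite {z. poly p z = 0}" by (rule poly_roots_finite)
  then obtain z where "z \<in> T" "poly p z \<noteq> 0"
    using \<open>infinite T\<close> by (metis (mono_tags, lifting) finite_subset mem_Collect_eq subsetI)
  then have "g (y'(r := z)) \<noteq> 0" using p[of z] by simp
  moreover have "\<forall>i<Suc r. (y'(r := z)) i \<in> T" "\<forall>i\<ge>Suc r. (y'(r := z)) i = y i"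
    using y' \<open>z \<in> T\<close> by (auto simp: less_Suc_eq)
  ultimately show ?case by blast
qed

lemma mpeval_poly:
  assumes "\<And>j z. j < m \<Longrightarrow> f z j = poly (p j) z"
  shows "\<exists>P. \<forall>z. mpeval m h S c (f z) = poly P z"
  by (rule exI[of _ "\<Sum>\<alpha>\<in>S. [:h (c \<alpha>):] * (\<Prod>j<m. p j ^ \<alpha> j)"])
    (simp add: mpeval_def poly_sum poly_prod poly_mult poly_power assms)

section \<open>Roots of the additive polynomial\<close>

lemma map_f_poly:
  assumes "field_hom e"
  shows "map_poly e (f_poly q n a) = f_poly q n (\<lambda>i. e (a i))"
  by (rule poly_eqI)
    (simp add: f_poly_def coeff_map_poly coeff_sum field_hom_simps[OF assms] if_distrib[where f = e] cong: if_cong)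

locale frobenius_field =
  fixes h :: "'f::{finite,field} \<Rightarrow> 'e::field" and q :: nat
  assumes hom: "field_hom h" and q: "q = card (UNIV :: 'f set)"
begin

lemma q_gt_1: "1 < q" unfolding q by (rule card_finite_field_gt_1)

abbreviation F :: "nat \<Rightarrow> 'e \<Rightarrow> 'e" where "F i \<equiv> (\<lambda>y. y ^ q ^ i)"

lemma F_hom: "field_hom (F i)" unfolding q by (rule frob_field_hom_iter[OF hom])

lemma frob_hom: "field_hom (\<lambda>y :: 'e. y ^ q)" unfolding q by (rule frob_field_hom[OF hom])

lemma frob_fixed: "y ^ q = y \<longleftrightarrow> y \<in> range h" unfolding q by (rule frob_fixed_iff[OF hom])

lemma frob_const: "h c ^ q = h c" using frob_fixed by blast

lemma F_const: "h c ^ q ^ i = h c"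
  by (induction i) (simp_all add: power_mult frob_const)

lemma poly_f: "poly (f_poly q n a) y = y ^ q ^ n - (\<Sum>i<n. a i * y ^ q ^ i)" for a :: "nat \<Rightarrow> 'e"
  by (simp add: f_poly_def poly_monom poly_sum)

lemma poly_f_add: "poly (f_poly q n a) (y + z) = poly (f_poly q n a) y + poly (f_poly q n a) z"
  for a :: "nat \<Rightarrow> 'e"
  unfolding poly_f by (simp add: field_homD(3)[OF F_hom] distrib_left sum.distrib)

lemma poly_f_scale: "poly (f_poly q n a) (h c * y) = h c * poly (f_poly q n a) y"
  for a :: "nat \<Rightarrow> 'e"
  unfolding poly_f by (simp add: power_mult_distrib F_const right_diff_distrib sum_distrib_left mult_ac)

lemma poly_f_0: "poly (f_poly q n a) 0 = 0" for a :: "nat \<Rightarrow> 'e"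
  using poly_f_scale[of n a 0 0] by (simp add: field_homD[OF hom])

lemma degree_sum_monom: "0 < n \<Longrightarrow> degree (\<Sum>i<n. monom (a i) (q ^ i)) < q ^ n" for a :: "nat \<Rightarrow> 'e"
proof (intro degree_sum_less)
  fix i assume "i \<in> {..<n}"
  then have "q ^ i < q ^ n" using q_gt_1 by (intro power_strict_increasing) auto
  then show "degree (monom (a i) (q ^ i)) < q ^ n" using degree_monom_le le_less_trans by blast
qed (use q_gt_1 in auto)

lemma degree_f: "0 < n \<Longrightarrow> degree (f_poly q n a) = q ^ n" for a :: "nat \<Rightarrow> 'e"
  unfolding f_poly_def diff_conv_add_uminus
  by (subst degree_add_eq_left) (auto simp: degree_monom_eq degree_sum_monom)

lemma lead_coeff_f: "0 < n \<Longrightarrow> lead_coeff (f_poly q n a) = 1" for a :: "nat \<Rightarrow> 'e"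
  unfolding degree_f
  using coeff_eq_0[OF degree_sum_monom[of n a]] by (simp add: f_poly_def)

text \<open>Every exponent \<open>q ^ i\<close> with \<open>i > 0\<close> is zero in the field, so
  only the linear term survives. Hence \<open>a 0 \<noteq> 0\<close> is the separability
  condition.\<close>

lemma pderiv_f:
  fixes a :: "nat \<Rightarrow> 'e"
  assumes "0 < n"
  shows "pderiv (f_poly q n a) = [:- a 0:]"
proof -
  have q0: "of_nat q = (0 :: 'e)" unfolding q by (rule of_nat_card_eq_0[OF hom])
  have *: "pderiv (monom c (q ^ i)) = (if i = 0 then [:c:] else 0)" for c :: 'e and i
    using q0 by (cases i) (auto simp: pderiv_monom monom_0)
  have sum: "pderiv (sum p I) = (\<Sum>i\<in>I. pderiv (p i))" for p :: "nat \<Rightarrow> 'e poly" and I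
    by (induction I rule: infinite_finite_induct) (auto simp: pderiv_add)
  have "pderiv (f_poly q n a) = - (\<Sum>i<n. if i = 0 then [:a i:] else 0)"
    unfolding f_poly_def pderiv_diff sum * using assms by simp
  also have "(\<Sum>i<n. if i = 0 then [:a i:] else 0) = [:a 0:]" using assms by simp
  finally show ?thesis by simp
qed

lemma card_roots_le: "0 < n \<Longrightarrow> card {y. poly (f_poly q n a) y = 0} \<le> q ^ n" for a :: "nat \<Rightarrow> 'e"
  using card_poly_roots_bound[of "f_poly q n a"] lead_coeff_f[of n a] degree_f[of n a] by fastforce

lemma finite_roots: "0 < n \<Longrightarrow> finite {y. poly (f_poly q n a) y = 0}" for a :: "nat \<Rightarrow> 'e"
  using lead_coeff_f[of n a] by (intro poly_roots_finite) auto

lemma card_roots_of_product: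
  fixes a :: "nat \<Rightarrow> 'e"
  assumes n: "0 < n" and a0: "a 0 \<noteq> 0"
    and rs: "f_poly q n a = (\<Prod>r\<leftarrow>rs. [:- r, 1:])"
  shows "card {y. poly (f_poly q n a) y = 0} = q ^ n"
proof -
  have "distinct rs"
  proof (rule ccontr)
    assume "\<not> distinct rs"
    \<comment> \<open>A repeated entry of the list makes the square of \<open>[:- y, 1:]\<close> a
      factor, and the derivative then vanishes at \<open>y\<close>.\<close>
    then obtain xs ys zs y where rs_eq: "rs = xs @ [y] @ ys @ [y] @ zs" using not_distinct_decomp by blast
    define g where "g = (\<Prod>r\<leftarrow>xs. [:- r, 1:]) * (\<Prod>r\<leftarrow>ys. [:- r, 1:]) * (\<Prod>r\<leftarrow>zs. [:- r, 1:])"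
    have "f_poly q n a = [:- y, 1:] * ([:- y, 1:] * g)"
      unfolding rs rs_eq g_def
      by (simp add: mult_ac del: mult_pCons_left mult_pCons_right)
    moreover have "poly [:- y, 1:] y = 0" by simp
    ultimately have "poly (pderiv (f_poly q n a)) y = 0"
      by (simp only: pderiv_mult poly_add poly_mult mult_zero_left mult_zero_right add_0_left)
    then show False using a0 pderiv_f[OF n, of a] by simp
  qed
  moreover have "{y. poly (f_poly q n a) y = 0} = set rs"
  proof -
    have "poly (\<Prod>r\<leftarrow>rs. [:- r, 1:]) x = 0 \<longleftrightarrow> x \<in> set rs" for x by (induction rs) auto
    then show ?thesis unfolding rs by blast
  qed
  moreover have "length rs = degree (\<Prod>r\<leftarrow>rs. [:- r, 1:])"
  proof (induction rs)
    case (Cons r rs)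
    have "(\<Prod>r\<leftarrow>rs. [:- r, 1:]) \<noteq> 0" by (auto simp: prod_list_zero_iff)
    then have "degree ([:- r, 1:] * (\<Prod>r\<leftarrow>rs. [:- r, 1:])) = Suc (degree (\<Prod>r\<leftarrow>rs. [:- r, 1:]))"
      by (subst degree_mult_eq) auto
    with Cons show ?case by (simp del: mult_pCons_left)
  qed simp
  ultimately show ?thesis
    unfolding rs[symmetric] using degree_f[OF n, of a] by (simp add: distinct_card)
qed

lemma product_of_card_roots:
  fixes a :: "nat \<Rightarrow> 'e"
  assumes n: "0 < n" and card: "card {y. poly (f_poly q n a) y = 0} = q ^ n"
  shows "\<exists>rs. f_poly q n a = (\<Prod>r\<leftarrow>rs. [:- r, 1:])"
proof -
  let ?R = "{y. poly (f_poly q n a) y = 0}"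
  obtain rs where rs: "set rs = ?R" "distinct rs"
    using finite_distinct_list[OF finite_roots[OF n]] by blast
  have "f_poly q n a = (\<Prod>r\<in>?R. [:- r, 1:])"
  proof (rule poly_eqI_degree_lead_coeff[where A = ?R and n = "q ^ n"])
    have deg: "degree (\<Prod>r\<in>?R. [:- r, 1:]) = q ^ n"
      using card by (subst degree_prod_eq_sum_degree) auto
    then show "degree (\<Prod>r\<in>?R. [:- r, 1:]) \<le> q ^ n" by simp
    have "lead_coeff (\<Prod>r\<in>?R. [:- r, 1:]) = 1" by (simp add: lead_coeff_prod)
    then show "coeff (f_poly q n a) (q ^ n) = coeff (\<Prod>r\<in>?R. [:- r, 1:]) (q ^ n)"
      using lead_coeff_f[OF n, of a] unfolding deg degree_f[OF n] by simp
    show "poly (f_poly q n a) z = poly (\<Prod>r\<in>?R. [:- r, 1:]) z" if "z \<in> ?R" for z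
      using that finite_roots[OF n, of a] by (auto simp: poly_prod intro!: prod_zero[symmetric])
  qed (use card degree_f[OF n] in auto)
  also have "\<dots> = (\<Prod>r\<leftarrow>rs. [:- r, 1:])"
    using rs by (simp add: prod.distinct_set_conv_list[symmetric])
  finally show ?thesis by blast
qed

section \<open>Moore matrices and matrix solutions of the companion equation\<close>

definition moore :: "nat \<Rightarrow> (nat \<Rightarrow> 'e) \<Rightarrow> nat \<Rightarrow> nat \<Rightarrow> 'e" where
  "moore n y = (\<lambda>i j. if i < n \<and> j < n then y i ^ q ^ j else 0)"

lemma moore_Mn [simp]: "moore n y \<in> Mn n" unfolding moore_def Mn_def by auto

text \<open>The subdiagonal ones of \<open>Delta\<close> shift the powers of each root by one, and
  the last column expresses \<open>y ^ q ^ n\<close> through the lower ones because \<open>y\<close>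
  is a root.\<close>

lemma frob_moore:
  assumes n: "0 < n" and roots: "\<And>i. i < n \<Longrightarrow> poly (f_poly q n a) (y i) = 0"
  shows "mpow q (moore n y) = mat_mul n (moore n y) (Delta n a)"
proof (rule Mn_eqI[OF mmap_Mn[OF frob_hom moore_Mn] mat_mul_Mn])
  fix i j assume ij: "i < n" "j < n"
  have eq: "moore n y i j ^ q = y i ^ q ^ Suc j"
    using ij by (simp add: moore_def power_mult[symmetric] mult.commute)
  have mult: "mat_mul n (moore n y) (Delta n a) i j
    = (\<Sum>k<n. y i ^ q ^ k * (if j = n - 1 then a k else if k = j + 1 then 1 else 0))"
    using ij by (auto simp: mat_mul_def moore_def Delta_def intro!: sum.cong)
  show "moore n y i j ^ q = mat_mul n (moore n y) (Delta n a) i j"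
  proof (cases "j = n - 1")
    case True
    have "y i ^ q ^ n = (\<Sum>k<n. a k * y i ^ q ^ k)" using roots[OF ij(1)] unfolding poly_f by simp
    then show ?thesis unfolding eq mult using True n by (simp add: mult.commute)
  next
    case False
    then have "j + 1 < n" using ij by simp
    then show ?thesis unfolding eq mult using False
      by (simp add: if_distrib[where f = "\<lambda>x. _ * x"] cong: if_cong)
  qed
qed

text \<open>The roots form a space over the finite field with \<open>q ^ n\<close> elements, so of
  dimension \<open>n\<close>. A dependence between the columns of the Moore matrix of a basis is an
  additive polynomial of degree below \<open>q ^ n\<close> vanishing at all roots, hence
  zero.\<close>

lemma exists_moore_inverse:
  assumes n: "0 < n" and card: "card {y. poly (f_poly q n a) y = 0} = q ^ n"
  shows "\<exists>y Zi. (\<forall>i<n. poly (f_poly q n a) (y i) = 0) \<and> Zi \<in> Mn n \<and> mat_mul n (moore n y) Zi = mat_one n"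
proof -
  let ?R = "{y. poly (f_poly q n a) y = 0}"
  interpret fv: vector_space "\<lambda>c y. h c * y"
    by unfold_locales (simp_all add: field_hom_simps[OF hom] algebra_simps)
  have sub: "fv.subspace ?R"
    by (rule fv.subspaceI) (auto simp: poly_f_0 poly_f_add poly_f_scale)
  obtain B where B: "B \<subseteq> ?R" "fv.independent B" "?R \<subseteq> fv.span B"
    using fv.maximal_independent_subset[of ?R] by blast
  have finB: "finite B" using B(1) finite_roots[OF n] finite_subset by blast
  have span: "fv.span B = ?R" using B fv.span_minimal[OF B(1) sub] by blast
  have "card (fv.span B) = q ^ card B"
    unfolding q by (rule fv.card_span_independent[OF finB B(2)]) simp
  then have "q ^ card B = q ^ n" unfolding span card by simp
  then have cardB: "card B = n" using q_gt_1 by simp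
  obtain y where y: "bij_betw y {..<n} B"
    using ex_bij_betw_nat_finite[OF finB] unfolding cardB lessThan_atLeast0 by blast
  have "\<exists>Zi\<in>Mn n. mat_mul n (moore n y) Zi = mat_one n"
  proof (rule mat_det_imp_inverse, rule mat_injective_imp_det)
    fix x j assume 0: "\<And>i. i < n \<Longrightarrow> (\<Sum>j<n. moore n y i j * x j) = 0" and j: "j < n"
    define p where "p = (\<Sum>k<n. monom (x k) (q ^ k))"
    have p: "poly p z = (\<Sum>k<n. x k * z ^ q ^ k)" for z unfolding p_def by (simp add: poly_monom poly_sum)
    have "fv.subspace {z. poly p z = 0}"
    proof (rule fv.subspaceI)
      show "0 \<in> {z. poly p z = 0}" using q_gt_1 by (auto simp: p intro!: sum.neutral)
    qed (auto simp: p field_homD(3)[OF F_hom] power_mult_distrib F_const distrib_left sum.distrib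
        mult.left_commute sum_distrib_left[symmetric])
    moreover have "B \<subseteq> {z. poly p z = 0}"
    proof
      fix z assume "z \<in> B"
      then obtain i where i: "i < n" "z = y i" using y unfolding bij_betw_def by auto
      then show "z \<in> {z. poly p z = 0}" using 0[OF i(1)] by (simp add: p moore_def mult.commute)
    qed
    ultimately have "?R \<subseteq> {z. poly p z = 0}" using fv.span_minimal span by blast
    then have "p = 0"
      using degree_sum_monom[OF n, of x] card finite_roots[OF n, of a]
      by (intro poly_eqI_degree[where A = ?R]) (use q_gt_1 in \<open>auto simp: p_def[symmetric] card\<close>)
    then have "coeff p (q ^ j) = 0" by simp
    moreover have "q ^ k = q ^ j \<longleftrightarrow> k = j" for k using q_gt_1 by simp
    ultimately show "x j = 0" using j by (simp add: p_def coeff_sum)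
  qed
  then show ?thesis using y B(1) unfolding bij_betw_def by blast
qed

text \<open>Two solutions of the same Frobenius equation differ by a constant left factor:
  \<open>Y Z^(-1)\<close> equals its own entrywise q-th power because \<open>D\<close>
  cancels.\<close>

lemma solution_quotient_fixed:
  assumes Z: "Z \<in> Mn n" "Zi \<in> Mn n" "mat_mul n Z Zi = mat_one n"
    and ZD: "mpow q Z = mat_mul n Z D" and YD: "mpow q Y = mat_mul n Y D" and Y: "Y \<in> Mn n"
  shows "mat_mul n Y Zi i j \<in> range h" and "mat_mul n (mat_mul n Y Zi) Z = Y"
proof -
  let ?C = "mat_mul n Y Zi"
  have ZiZ: "mat_mul n Zi Z = mat_one n" by (rule mat_left_inverse_imp_right[OF Z(3)])
  show CZ: "mat_mul n ?C Z = Y" unfolding mat_mul_assoc ZiZ mat_mul_one_right[OF Y] ..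
  have one: "mat_mul n (mpow q Z) (mpow q Zi) = mat_one n"
    unfolding mmap_mat_mul[OF frob_hom, symmetric] Z(3) mmap_mat_one[OF frob_hom] ..
  have "mat_mul n (mpow q ?C) (mpow q Z) = mat_mul n Y D"
    unfolding mmap_mat_mul[OF frob_hom, symmetric] CZ YD ..
  also have "\<dots> = mat_mul n ?C (mpow q Z)"
    unfolding ZD mat_mul_assoc[symmetric] CZ ..
  finally have "mat_mul n (mat_mul n (mpow q ?C) (mpow q Z)) (mpow q Zi)
    = mat_mul n (mat_mul n ?C (mpow q Z)) (mpow q Zi)" by simp
  then have "mpow q ?C = ?C"
    unfolding mat_mul_assoc[of n _ "mpow q Z"] one
    by (simp only: mat_mul_one_right[OF mat_mul_Mn] mat_mul_one_right[OF mmap_Mn[OF frob_hom mat_mul_Mn]])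
  from fun_cong[OF fun_cong[OF this]] show "?C i j \<in> range h" using frob_fixed by blast
qed

text \<open>The change of variables by \<open>N\<close> turns a solution for \<open>T\<close> into
  one for the companion matrix; here \<open>T\<close> is the generic matrix or one of its
  specializations.\<close>

lemma solution_times:
  fixes U :: "nat \<Rightarrow> nat \<Rightarrow> 'e"
  assumes UW: "mat_mul n U W = mat_one n" "W \<in> Mn n" and NNi: "mat_mul n N Ni = mat_one n"
    and UT: "mat_mul n U T = mpow q U"
    and D: "mat_mul n (mat_mul n Ni T) (mpow q N) = D"
  shows "mat_mul n (mat_mul n U N) (mat_mul n Ni W) = mat_one n"
    and "mpow q (mat_mul n U N) = mat_mul n (mat_mul n U N) D"
proof -
  have "mat_mul n (mat_mul n U N) (mat_mul n Ni W) = mat_mul n U (mat_mul n (mat_mul n N Ni) W)"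
    unfolding mat_mul_assoc ..
  then show "mat_mul n (mat_mul n U N) (mat_mul n Ni W) = mat_one n"
    unfolding NNi mat_mul_one_left[OF UW(2)] UW(1) .
  have "mat_mul n (mat_mul n U N) D
    = mat_mul n U (mat_mul n (mat_mul n N Ni) (mat_mul n T (mpow q N)))"
    unfolding D[symmetric] mat_mul_assoc ..
  also have "\<dots> = mat_mul n (mat_mul n U T) (mpow q N)"
    unfolding NNi mat_mul_one_left[OF mat_mul_Mn] mat_mul_assoc ..
  also have "\<dots> = mpow q (mat_mul n U N)" unfolding UT by (rule mmap_mat_mul[OF frob_hom, symmetric])
  finally show "mpow q (mat_mul n U N) = mat_mul n (mat_mul n U N) D" by (rule sym)
qed

text \<open>A root \<open>y\<close> is the upper left entry of a matrix solution whose other rows vanish.\<close>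
lemma root_as_combination:
  assumes n: "0 < n" and Z: "Z \<in> Mn n" "Zi \<in> Mn n" "mat_mul n Z Zi = mat_one n"
    and ZD: "mpow q Z = mat_mul n Z (Delta n a)"
    and root: "poly (f_poly q n a) y = 0"
  shows "\<exists>c. y = (\<Sum>k<n. h (c k) * Z k 0)"
proof -
  let ?Y = "moore n (\<lambda>i. if i = 0 then y else 0)"
  have YD: "mpow q ?Y = mat_mul n ?Y (Delta n a)"
    by (rule frob_moore[OF n]) (use root poly_f_0 in auto)
  note C = solution_quotient_fixed[OF Z ZD YD moore_Mn]
  have "\<forall>k. \<exists>c. mat_mul n ?Y Zi 0 k = h c" using C(1) by blast
  then obtain c where c: "\<And>k. mat_mul n ?Y Zi 0 k = h (c k)" by metis
  have "y = ?Y 0 0" using n by (simp add: moore_def)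
  also have "\<dots> = (\<Sum>k<n. h (c k) * Z k 0)"
    using n c by (subst C(2)[symmetric]) (simp add: mat_mul_def[of n "mat_mul n ?Y Zi"])
  finally show ?thesis by blast
qed

text \<open>The converse of \<open>frob_moore\<close>: the first \<open>n - 1\<close> columns of the
  equation force the powers along each row, and the last one then says that the first entry is a
  root.\<close>

lemma solution_entries:
  fixes Z :: "nat \<Rightarrow> nat \<Rightarrow> 'e"
  assumes Z: "Z \<in> Mn n" and ZD: "mpow q Z = mat_mul n Z (Delta n a)" and "i < n" "j < n"
  shows "Z i j = Z i 0 ^ q ^ j" and "poly (f_poly q n a) (Z i 0) = 0"
proof -
  have eq: "Z i k ^ q = (\<Sum>l<n. Z i l * (if k = n - 1 then a l else if l = k + 1 then 1 else 0))" if "k < n" for k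
    using fun_cong[OF fun_cong[OF ZD, of i], of k] that \<open>i < n\<close> by (simp add: mat_mul_def Delta_def)
  have "Z i k ^ q = Z i (k + 1)" if "k + 1 < n" for k
  proof -
    have "k \<noteq> n - 1" using that by simp
    then show ?thesis using eq[of k] that by (auto simp: if_distrib[where f = "\<lambda>x. _ * x"] cong: if_cong)
  qed
  then have pow: "Z i k = Z i 0 ^ q ^ k" if "k < n" for k
    using that
  proof (induction k)
    case (Suc k)
    then have "Z i (Suc k) = (Z i 0 ^ q ^ k) ^ q"
      using \<open>\<And>k. k + 1 < n \<Longrightarrow> Z i k ^ q = Z i (k + 1)\<close>[of k] by simp
    then show ?case by (simp add: power_mult[symmetric] mult.commute)
  qed simp
  then show "Z i j = Z i 0 ^ q ^ j" using \<open>j < n\<close> by blast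
  have "(\<Sum>l<n. Z i l * a l) = Z i (n - 1) ^ q" using eq[of "n - 1"] \<open>i < n\<close> by simp
  also have "Z i (n - 1) ^ q = Z i 0 ^ q ^ n"
  proof -
    have "Z i (n - 1) ^ q = (Z i 0 ^ q ^ (n - 1)) ^ q" by (subst pow) (use \<open>i < n\<close> in auto)
    also have "\<dots> = Z i 0 ^ q ^ Suc (n - 1)" by (simp add: power_mult[symmetric] mult.commute)
    finally show ?thesis using \<open>i < n\<close> by simp
  qed
  finally have top: "(\<Sum>l<n. Z i l * a l) = Z i 0 ^ q ^ n" .
  have "(\<Sum>l<n. Z i l * a l) = (\<Sum>l<n. a l * Z i 0 ^ q ^ l)"
  proof (rule sum.cong[OF refl])
    fix l assume "l \<in> {..<n}"
    then have "Z i l = Z i 0 ^ q ^ l" by (intro pow) simp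
    then show "Z i l * a l = a l * Z i 0 ^ q ^ l" by (metis mult.commute)
  qed
  then show "poly (f_poly q n a) (Z i 0) = 0" using top unfolding poly_f by simp
qed

text \<open>The combinations of the first column over the finite field are roots. A relation among
  its entries becomes, on taking powers, the same relation in every column, and invertibility of
  \<open>Z\<close> kills it; so these \<open>q ^ n\<close> roots are distinct.\<close>

lemma card_roots_of_solution:
  fixes Z :: "nat \<Rightarrow> nat \<Rightarrow> 'e"
  assumes n: "0 < n" and Z: "Z \<in> Mn n" "mat_mul n Z Zi = mat_one n"
    and ZD: "mpow q Z = mat_mul n Z (Delta n a)"
  shows "card {y. poly (f_poly q n a) y = 0} = q ^ n"
proof -
  let ?R = "{y. poly (f_poly q n a) y = 0}"
  define \<Theta> where "\<Theta> c = (\<Sum>i<n. h (c i) * Z i 0)" for c :: "nat \<Rightarrow> 'f"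
  have "inj_on \<Theta> ({..<n} \<rightarrow>\<^sub>E UNIV)"
  proof (rule inj_onI)
    fix c d assume cd: "c \<in> {..<n} \<rightarrow>\<^sub>E UNIV" "d \<in> {..<n} \<rightarrow>\<^sub>E UNIV" and eq: "\<Theta> c = \<Theta> d"
    have 0: "(\<Sum>i<n. h (c i - d i) * Z i j) = 0" if "j < n" for j
    proof -
      have "(\<Sum>i<n. h (c i - d i) * Z i j) = (\<Sum>i<n. h (c i - d i) * Z i 0) ^ q ^ j"
        unfolding field_hom_sum[OF F_hom]
        using solution_entries(1)[OF Z(1) ZD _ that] by (simp add: power_mult_distrib F_const)
      also have "(\<Sum>i<n. h (c i - d i) * Z i 0) = 0"
        using eq by (simp add: \<Theta>_def field_hom_simps[OF hom] left_diff_distrib sum_subtractf)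
      finally show ?thesis using q_gt_1 by simp
    qed
    have "h (c k - d k) = 0" if k: "k < n" for k
    proof -
      have "h (c k - d k) = (\<Sum>i<n. h (c i - d i) * mat_one n i k)"
        using k by (simp add: mat_one_def if_distrib[where f = "\<lambda>x. _ * x"] cong: if_cong)
      also have "\<dots> = (\<Sum>i<n. \<Sum>j<n. h (c i - d i) * Z i j * Zi j k)"
        unfolding Z(2)[symmetric] using k by (simp add: mat_mul_def sum_distrib_left mult.assoc)
      also have "\<dots> = (\<Sum>j<n. (\<Sum>i<n. h (c i - d i) * Z i j) * Zi j k)"
        unfolding sum_distrib_right by (rule sum.swap)
      finally show ?thesis using 0 by simp
    qed
    then have "c k = d k" if "k < n" for k using that field_hom_eq_0_iff[OF hom] by simp
    then show "c = d" using cd by (metis PiE_ext lessThan_iff)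
  qed
  then have "card (\<Theta> ` ({..<n} \<rightarrow>\<^sub>E UNIV)) = q ^ n"
    by (simp add: card_image card_PiE q)
  moreover have "\<Theta> ` ({..<n} \<rightarrow>\<^sub>E UNIV) \<subseteq> ?R"
  proof -
    have "poly (f_poly q n a) (\<Sum>i\<in>I. h (c i) * Z i 0) = 0" if "I \<subseteq> {..<n}" for I c
      using that solution_entries(2)[OF Z(1) ZD _ n]
      by (induction I rule: infinite_finite_induct) (auto simp: poly_f_0 poly_f_add poly_f_scale)
    then show ?thesis unfolding \<Theta>_def by auto
  qed
  ultimately show ?thesis
    using card_mono[OF finite_roots[OF n, of a], of "\<Theta> ` ({..<n} \<rightarrow>\<^sub>E UNIV)"] card_roots_le[OF n, of a] by simp
qed

end

section \<open>Linear dependence over a subfield\<close>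

lemma is_subfieldD:
  assumes "is_subfield S"
  shows "0 \<in> S" "1 \<in> S" "x \<in> S \<Longrightarrow> y \<in> S \<Longrightarrow> x + y \<in> S" "x \<in> S \<Longrightarrow> y \<in> S \<Longrightarrow> x * y \<in> S"
    "x \<in> S \<Longrightarrow> - x \<in> S" "x \<in> S \<Longrightarrow> inverse x \<in> S"
  using assms unfolding is_subfield_def by auto

lemma is_subfield_diff: "is_subfield S \<Longrightarrow> x \<in> S \<Longrightarrow> y \<in> S \<Longrightarrow> x - y \<in> S"
  using is_subfieldD(3)[of S x "- y"] is_subfieldD(5)[of S y] by simp

lemma is_subfield_divide: "is_subfield S \<Longrightarrow> x \<in> S \<Longrightarrow> y \<in> S \<Longrightarrow> x / y \<in> S"
  unfolding divide_inverse using is_subfieldD(4)[of S x "inverse y"] is_subfieldD(6)[of S y] by simp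

lemma is_subfield_sum: "is_subfield S \<Longrightarrow> (\<And>i. i \<in> I \<Longrightarrow> f i \<in> S) \<Longrightarrow> sum f I \<in> S"
  by (induction I rule: infinite_finite_induct) (auto simp: is_subfieldD)

lemma is_subfield_power: "is_subfield S \<Longrightarrow> x \<in> S \<Longrightarrow> x ^ k \<in> S"
  by (induction k) (auto simp: is_subfieldD)

text \<open>Gaussian elimination, carried out so that all scalars stay in the set \<open>S\<close>:
  more unknowns, indexed by \<open>J\<close>, than equations, indexed by \<open>I\<close>.\<close>

lemma homogeneous_system:
  fixes w :: "'j \<Rightarrow> 'i \<Rightarrow> 'a::field"
  assumes "is_subfield S" "finite I" "finite J" "card I < card J" "\<And>j i. j \<in> J \<Longrightarrow> i \<in> I \<Longrightarrow> w j i \<in> S"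
  shows "\<exists>s. (\<forall>j\<in>J. s j \<in> S) \<and> (\<exists>j\<in>J. s j \<noteq> 0) \<and> (\<forall>i\<in>I. (\<Sum>j\<in>J. s j * w j i) = 0)"
  using assms(2-)
proof (induction I arbitrary: J w rule: finite_induct)
  case empty
  then obtain j where "j \<in> J" by fastforce
  then show ?case using is_subfieldD(2)[OF assms(1)] by (intro exI[of _ "\<lambda>_. 1"]) auto
next
  case (insert b I)
  show ?case
  proof (cases "\<forall>j\<in>J. w j b = 0")
    case True
    have "card I < card J" using insert.hyps insert.prems(2) by simp
    then show ?thesis using insert.IH[of J w] insert.prems True by auto
  next
    case False
    then obtain p where p: "p \<in> J" "w p b \<noteq> 0" by blast
    define J' where "J' = J - {p}"
    \<comment> \<open>Unknown \<open>p\<close> is eliminated by means of equation \<open>b\<close>;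
      its value \<open>sp\<close> is recovered from the others afterwards.\<close>
    define w' where "w' j i = w j i - w j b / w p b * w p i" for j i
    have fin: "finite J'" and card: "card I < card J'"
      using insert.hyps insert.prems(1,2) p unfolding J'_def by auto
    have w'S: "w' j i \<in> S" if "j \<in> J'" "i \<in> I" for j i
      unfolding w'_def using that insert.prems(3) p
      by (intro is_subfield_diff[OF assms(1)] is_subfieldD(4)[OF assms(1)] is_subfield_divide[OF assms(1)])
        (auto simp: J'_def)
    obtain s where
      s: "\<forall>j\<in>J'. s j \<in> S" "\<exists>j\<in>J'. s j \<noteq> 0" "\<forall>i\<in>I. (\<Sum>j\<in>J'. s j * w' j i) = 0"
      using insert.IH[OF fin card, of w'] w'S by blast
    define sp where "sp = - (\<Sum>j\<in>J'. s j * (w j b / w p b))"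
    have sp: "sp \<in> S" unfolding sp_def using s(1) insert.prems(3) p
      by (intro is_subfieldD(5)[OF assms(1)] is_subfield_sum[OF assms(1)] is_subfieldD(4)[OF assms(1)]
          is_subfield_divide[OF assms(1)]) (auto simp: J'_def)
    have split: "(\<Sum>j\<in>J. (s(p := sp)) j * w j i) = sp * w p i + (\<Sum>j\<in>J'. s j * w j i)" for i
    proof -
      have "(\<Sum>j\<in>J. (s(p := sp)) j * w j i) = sp * w p i + (\<Sum>j\<in>J'. (s(p := sp)) j * w j i)"
        unfolding J'_def by (subst sum.remove[OF insert.prems(1) p(1)]) simp
      also have "(\<Sum>j\<in>J'. (s(p := sp)) j * w j i) = (\<Sum>j\<in>J'. s j * w j i)"
        by (intro sum.cong) (auto simp: J'_def)
      finally show ?thesis .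
    qed
    have "(\<Sum>j\<in>J. (s(p := sp)) j * w j i) = 0" if "i \<in> insert b I" for i
    proof (cases "i = b")
      case True
      show ?thesis unfolding True split unfolding sp_def using p by (simp add: sum_distrib_right mult.assoc)
    next
      case False
      then have "(\<Sum>j\<in>J'. s j * w' j i) = 0" using s(3) that by blast
      then show ?thesis
        unfolding split unfolding sp_def w'_def
        by (simp add: right_diff_distrib sum_subtractf sum_distrib_right mult.assoc)
    qed
    moreover have "\<forall>j\<in>J. (s(p := sp)) j \<in> S" using s(1) sp by (auto simp: J'_def)
    moreover have "\<exists>j\<in>J. (s(p := sp)) j \<noteq> 0" using s(2) by (auto simp: J'_def)
    ultimately show ?thesis by blast
  qed
qed

text \<open>There is one more power of \<open>z\<close> in the range up to \<open>card I\<close>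
  than there are spanning elements. Dividing by the lowest occurring power makes the constant term
  nonzero, which is what survives when \<open>z\<close> is later specialized to 0.\<close>

lemma algebraic_relation:
  fixes z :: "'a::field"
  assumes S: "is_subfield S" and "finite I" and z: "z \<noteq> 0"
    and span: "\<And>k. \<exists>w. (\<forall>i\<in>I. w i \<in> S) \<and> z ^ k = (\<Sum>i\<in>I. w i * b i)"
  shows "\<exists>M s. (\<forall>k\<le>M. s k \<in> S) \<and> s 0 \<noteq> 0 \<and> (\<Sum>k\<le>M. s k * z ^ k) = 0"
proof -
  obtain w where w: "\<And>k i. i \<in> I \<Longrightarrow> w k i \<in> S" "\<And>k. z ^ k = (\<Sum>i\<in>I. w k i * b i)" using span by metis
  obtain s where s: "\<forall>k\<in>{..card I}. s k \<in> S" "\<exists>k\<in>{..card I}. s k \<noteq> 0"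
    "\<forall>i\<in>I. (\<Sum>k\<in>{..card I}. s k * w k i) = 0"
    using homogeneous_system[OF S \<open>finite I\<close>, of "{..card I}" w] w(1) by auto
  have "(\<Sum>k\<le>card I. s k * z ^ k) = (\<Sum>k\<le>card I. \<Sum>i\<in>I. s k * w k i * b i)"
    unfolding w(2) by (simp add: sum_distrib_left mult.assoc)
  also have "\<dots> = (\<Sum>i\<in>I. \<Sum>k\<le>card I. s k * w k i * b i)" by (rule sum.swap)
  also have "\<dots> = (\<Sum>i\<in>I. (\<Sum>k\<le>card I. s k * w k i) * b i)" by (simp add: sum_distrib_right)
  finally have rel: "(\<Sum>k\<le>card I. s k * z ^ k) = 0" using s(3) by simp
  define k0 where "k0 = (LEAST k. k \<le> card I \<and> s k \<noteq> 0)"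
  have "\<exists>k. k \<le> card I \<and> s k \<noteq> 0" using s(2) by blast
  from LeastI_ex[OF this] have k0: "k0 \<le> card I" "s k0 \<noteq> 0" unfolding k0_def by blast+
  have k0': "s k = 0" if "k < k0" for k
    using not_less_Least[of k "\<lambda>k. k \<le> card I \<and> s k \<noteq> 0"] that k0(1) unfolding k0_def[symmetric] by simp
  have "0 = (\<Sum>k\<in>{k0..card I}. s k * z ^ k)"
    unfolding rel[symmetric] using k0 k0' by (intro sum.mono_neutral_right) (auto simp: not_le)
  also have "\<dots> = (\<Sum>k\<le>card I - k0. s (k + k0) * z ^ (k + k0))"
    using k0(1) by (intro sum.reindex_bij_witness[of _ "\<lambda>k. k + k0" "\<lambda>k. k - k0"]) auto
  also have "\<dots> = z ^ k0 * (\<Sum>k\<le>card I - k0. s (k + k0) * z ^ k)"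
    by (simp add: sum_distrib_left power_add mult_ac)
  finally have "(\<Sum>k\<le>card I - k0. s (k + k0) * z ^ k) = 0" using z by simp
  then show ?thesis
    using k0 s(1) by (intro exI[of _ "card I - k0"] exI[of _ "\<lambda>k. s (k + k0)"]) auto
qed

section \<open>The generic equation\<close>

lemma (in matrix_algebra) mulc_eqI:
  assumes h: "field_hom h" and eq: "mat_mul n (emb h x) (emb h y) = emb h z" and "l < m"
  shows "mulc h x y l = z l"
proof -
  have "emb h (mulc h x y) = emb h (\<lambda>i. if i < m then z i else 0)"
    unfolding emb_mulc[OF h] eq by (rule emb_cong) simp
  then have "mulc h x y = (\<lambda>i. if i < m then z i else 0)"
    by (intro emb_inj[OF h] mulc_coords) (auto simp: coords_def)
  then show ?thesis using \<open>l < m\<close> by simp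
qed

text \<open>Cramer's rule without division. It writes the quotient of two algebra elements as a
  fraction whose numerator and denominator are polynomials in the coordinates, which is the form
  that \<open>rrel\<close> needs.\<close>

lemma (in matrix_algebra) cramer:
  assumes h: "field_hom h" and eq: "mat_mul n (emb h x) (emb h y) = emb h z" and j: "j < m"
  shows "det (mat m m (\<lambda>(l, j). regular h x l j)) * y j
    = (\<Sum>l<m. adj_mat (mat m m (\<lambda>(l, j). regular h x l j)) $$ (j, l) * z l)"
proof -
  let ?M = "mat m m (\<lambda>(l, j). regular h x l j)"
  have adj: "(\<Sum>l<m. adj_mat ?M $$ (j, l) * regular h x l k) = (if j = k then det ?M else 0)" if "k < m" for k
  proof -
    have "(adj_mat ?M * ?M) $$ (j, k) = (det ?M \<cdot>\<^sub>m 1\<^sub>m m) $$ (j, k)"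
      using adj_mat(3)[of ?M m] by simp
    moreover have "(adj_mat ?M * ?M) $$ (j, k) = (\<Sum>l<m. adj_mat ?M $$ (j, l) * regular h x l k)"
      using j that adj_mat(1)[of ?M m] by (simp add: scalar_prod_def lessThan_atLeast0)
    ultimately show ?thesis using j that by simp
  qed
  have z: "z l = (\<Sum>k<m. regular h x l k * y k)" if "l < m" for l
    using mulc_eqI[OF h eq that] that by (simp add: mulc_def)
  have "(\<Sum>l<m. adj_mat ?M $$ (j, l) * z l) = (\<Sum>l<m. \<Sum>k<m. adj_mat ?M $$ (j, l) * regular h x l k * y k)"
    by (intro sum.cong refl) (simp add: z sum_distrib_left mult.assoc)
  also have "\<dots> = (\<Sum>k<m. \<Sum>l<m. adj_mat ?M $$ (j, l) * regular h x l k * y k)" by (rule sum.swap)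
  also have "\<dots> = (\<Sum>k<m. (if j = k then det ?M else 0) * y k)"
    by (intro sum.cong refl) (simp add: adj[symmetric] sum_distrib_right)
  also have "\<dots> = det ?M * y j"
    using j by (simp add: if_distrib[where f = "\<lambda>x. x * _"] cong: if_cong)
  finally show ?thesis by simp
qed

locale generic_matrix = matrix_algebra \<A> n m v
  for \<A> :: "(nat \<Rightarrow> nat \<Rightarrow> 'f::{finite,field}) set" and n m :: nat and v +
  fixes eF :: "'f \<Rightarrow> 'k::field" and eK :: "'k \<Rightarrow> 'K::field" and t :: "nat \<Rightarrow> 'K" and q :: nat
  assumes eF: "field_hom eF" and t: "is_rat_fun_field m eK t" and q: "q = card (UNIV :: 'f set)"
begin

lemma eK: "field_hom eK" and t_indep: "alg_indep m eK t"
  using t unfolding rat_fun_field_iff by auto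

lemma hom_comp: "field_hom g \<Longrightarrow> field_hom (g \<circ> eF)"
  using field_hom_comp eF by blast

lemma q_gt_1: "1 < q" unfolding q by (rule card_finite_field_gt_1)

lemma frob_hom: "field_hom g \<Longrightarrow> field_hom (\<lambda>y :: 'e. y ^ q)" for g :: "'k \<Rightarrow> 'e::field"
  unfolding q by (rule frob_field_hom[OF hom_comp])

lemma frob_emb: "field_hom g \<Longrightarrow> mpow q (emb (g \<circ> eF) x) = emb (g \<circ> eF) (\<lambda>i. x i ^ q)"
  unfolding q by (rule mmap_frob_emb[OF hom_comp])

text \<open>The norm form of the regular representation: a polynomial in the coordinates that is
  nonzero exactly at units. The embedding \<open>g\<close> is a parameter so that one form can be
  evaluated in several fields.\<close>

definition \<delta> :: "('k \<Rightarrow> 'e::field) \<Rightarrow> (nat \<Rightarrow> 'e) \<Rightarrow> 'e" where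
  "\<delta> g x = det (mat m m (\<lambda>(l, j). regular (g \<circ> eF) x l j))"

lemma \<delta>_nonzero: "field_hom g \<Longrightarrow> mat_mul n B (emb (g \<circ> eF) x) = mat_one n \<Longrightarrow> \<delta> g x \<noteq> 0"
  unfolding \<delta>_def by (rule regular_det(1)[OF hom_comp])

lemma \<delta>_inverse:
  "field_hom g \<Longrightarrow> \<delta> g x \<noteq> 0 \<Longrightarrow> \<exists>y\<in>coords m. mat_mul n (emb (g \<circ> eF) x) (emb (g \<circ> eF) y) = mat_one n"
  unfolding \<delta>_def by (rule regular_det_imp_inverse[OF hom_comp])

lemma prel_regular:
  assumes "field_hom g"
  shows "specialization.prel m eK g t x (regular (eK \<circ> eF) t l j) (regular (g \<circ> eF) x l j)"
proof -
  interpret specialization m eK g t x using eK assms by unfold_locales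
  show ?thesis unfolding regular_def by (auto intro!: prel_sum prel_mult prel_var prel_const)
qed

lemma prel_\<delta>:
  assumes "field_hom g"
  shows "specialization.prel m eK g t x (\<delta> eK t) (\<delta> g x)"
proof -
  interpret specialization m eK g t x using eK assms by unfold_locales
  show ?thesis unfolding \<delta>_def by (rule prel_det) (rule prel_regular[OF assms])
qed

text \<open>The norm form is not the zero polynomial because it is nonzero at the coordinates of the
  identity matrix.\<close>

lemma \<delta>_t: "\<delta> eK t \<noteq> 0"
proof
  assume 0: "\<delta> eK t = 0"
  have id: "field_hom (id :: 'k \<Rightarrow> 'k)" by (simp add: field_hom_def)
  interpret specialization m eK id t "\<lambda>i. eF (\<epsilon> i)" using eK id by unfold_locales
  have "mat_mul n (mat_one n) (emb (id \<circ> eF) (\<lambda>i. eF (\<epsilon> i))) = mat_one n"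
    using emb_\<epsilon>[OF eF] by (simp add: mat_mul_one_left)
  then have "\<delta> id (\<lambda>i. eF (\<epsilon> i)) \<noteq> 0" by (rule \<delta>_nonzero[OF id])
  then show False using prel_eq_0[OF t_indep prel_\<delta>[OF id] 0] by simp
qed

definition \<xi> :: "nat \<Rightarrow> 'K" where
  "\<xi> = (SOME z. z \<in> coords m \<and> mat_mul n (emb (eK \<circ> eF) t) (emb (eK \<circ> eF) z) = emb (eK \<circ> eF) (\<lambda>i. t i ^ q))"

lemma \<xi>: "mat_mul n (emb (eK \<circ> eF) t) (emb (eK \<circ> eF) \<xi>) = emb (eK \<circ> eF) (\<lambda>i. t i ^ q)"
proof -
  note h = hom_comp[OF eK]
  obtain y where y: "mat_mul n (emb (eK \<circ> eF) t) (emb (eK \<circ> eF) y) = mat_one n"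
    using \<delta>_inverse[OF eK \<delta>_t] by blast
  have "mat_mul n (emb (eK \<circ> eF) t) (emb (eK \<circ> eF) (mulc (eK \<circ> eF) y (\<lambda>i. t i ^ q))) = emb (eK \<circ> eF) (\<lambda>i. t i ^ q)"
    unfolding emb_mulc[OF h] mat_mul_assoc[symmetric] y by (rule mat_mul_one_left[OF emb_Mn[OF h]])
  then have "\<exists>z. z \<in> coords m \<and> mat_mul n (emb (eK \<circ> eF) t) (emb (eK \<circ> eF) z) = emb (eK \<circ> eF) (\<lambda>i. t i ^ q)"
    using mulc_coords by blast
  from someI_ex[OF this] show ?thesis unfolding \<xi>_def by blast
qed

text \<open>The vector \<open>\<xi>\<close> is the value at \<open>t\<close> of the rational map
  taking x to \<open>x^(-1) x^(q)\<close>. Cramer's rule shows that the only denominator is the norm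
  form, so at every unit the value is the expected one.\<close>

lemma rrel_\<xi>:
  assumes g: "field_hom g" and \<delta>: "\<delta> g x \<noteq> 0"
    and eq: "mat_mul n (emb (g \<circ> eF) x) (emb (g \<circ> eF) z) = emb (g \<circ> eF) (\<lambda>i. x i ^ q)" and j: "j < m"
  shows "specialization.rrel m eK g t x (\<xi> j) (z j)"
proof -
  interpret specialization m eK g t x using eK g by unfold_locales
  let ?M = "\<lambda>g :: 'k \<Rightarrow> 'K. \<lambda>x. mat m m (\<lambda>(l, j). regular (g \<circ> eF) x l j)"
  have *: "prel (\<Sum>l<m. adj_mat (mat m m (\<lambda>(l, j). regular (eK \<circ> eF) t l j)) $$ (j, l) * t l ^ q)
    (\<Sum>l<m. adj_mat (mat m m (\<lambda>(l, j). regular (g \<circ> eF) x l j)) $$ (j, l) * x l ^ q)"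
    using j by (intro prel_sum prel_mult prel_adj_mat prel_regular[OF g] prel_power prel_var) auto
  have "rrel (\<delta> eK t * \<xi> j / \<delta> eK t) (\<delta> g x * z j / \<delta> g x)"
    using * cramer[OF hom_comp[OF eK] \<xi> j] cramer[OF hom_comp[OF g] eq j] \<delta>_t \<delta> prel_\<delta>[OF g]
    unfolding \<delta>_def[symmetric] by (intro rrelI) auto
  then show ?thesis using \<delta>_t \<delta> by simp
qed

lemma finite_reduced_exps: "finite {\<beta>\<in>exps m. \<forall>j<m. \<beta> j < q}"
proof -
  have "{\<beta>\<in>exps m. \<forall>j<m. \<beta> j < q} \<subseteq> {f. \<forall>i. (i \<in> {..<m} \<longrightarrow> f i \<in> {..<q}) \<and> (i \<notin> {..<m} \<longrightarrow> f i = 0)}"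
    by (auto simp: exps_def)
  moreover have "finite \<dots>" by (rule finite_set_of_finite_funs) auto
  ultimately show ?thesis by (rule finite_subset)
qed

text \<open>In coordinates, \<open>t \<xi> = t^(q)\<close> replaces each \<open>t i ^ q\<close> by a
  combination of the \<open>t l\<close> with coefficients in \<open>S\<close>. Each replacement
  lowers the total degree by \<open>q - 1 > 0\<close>, so the rewriting ends with all exponents
  below \<open>q\<close>.\<close>

lemma monomial_span:
  assumes S: "is_subfield S" "range eK \<subseteq> S" "\<And>j. j < m \<Longrightarrow> \<xi> j \<in> S" and "\<alpha> \<in> exps m"
  shows "\<exists>w. (\<forall>\<beta>\<in>{\<beta>\<in>exps m. \<forall>j<m. \<beta> j < q}. w \<beta> \<in> S)
    \<and> (\<Prod>j<m. t j ^ \<alpha> j) = (\<Sum>\<beta>\<in>{\<beta>\<in>exps m. \<forall>j<m. \<beta> j < q}. w \<beta> * (\<Prod>j<m. t j ^ \<beta> j))"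
proof -
  let ?B = "{\<beta>\<in>exps m. \<forall>j<m. \<beta> j < q}"
  note finB = finite_reduced_exps
  define V where "V = {x. \<exists>w. (\<forall>\<beta>\<in>?B. w \<beta> \<in> S) \<and> x = (\<Sum>\<beta>\<in>?B. w \<beta> * (\<Prod>j<m. t j ^ \<beta> j))}"
  have VE: "\<exists>w. (\<forall>\<beta>\<in>?B. w \<beta> \<in> S) \<and> x = (\<Sum>\<beta>\<in>?B. w \<beta> * (\<Prod>j<m. t j ^ \<beta> j))" if "x \<in> V" for x
    using that unfolding V_def by (rule CollectD)
  have VI: "x \<in> V" if "x = (\<Sum>\<beta>\<in>?B. w \<beta> * (\<Prod>j<m. t j ^ \<beta> j))" "\<forall>\<beta>\<in>?B. w \<beta> \<in> S" for x w
    unfolding V_def by (intro CollectI exI[of _ w] conjI that)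
  have V0: "0 \<in> V" unfolding V_def using is_subfieldD(1)[OF S(1)] by (auto intro!: exI[of _ "\<lambda>_. 0"])
  have V_add: "x + y \<in> V" if "x \<in> V" "y \<in> V" for x y
  proof -
    from VE[OF that(1)] obtain w
      where "(\<forall>\<beta>\<in>?B. w \<beta> \<in> S) \<and> x = (\<Sum>\<beta>\<in>?B. w \<beta> * (\<Prod>j<m. t j ^ \<beta> j))" ..
    note w = conjunct1[OF this] conjunct2[OF this]
    from VE[OF that(2)] obtain w'
      where "(\<forall>\<beta>\<in>?B. w' \<beta> \<in> S) \<and> y = (\<Sum>\<beta>\<in>?B. w' \<beta> * (\<Prod>j<m. t j ^ \<beta> j))" ..
    note w' = conjunct1[OF this] conjunct2[OF this]
    have "x + y = (\<Sum>\<beta>\<in>?B. (w \<beta> + w' \<beta>) * (\<Prod>j<m. t j ^ \<beta> j))"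
      unfolding w(2) w'(2) by (simp add: sum.distrib distrib_right)
    moreover have "\<forall>\<beta>\<in>?B. w \<beta> + w' \<beta> \<in> S" using w(1) w'(1) is_subfieldD(3)[OF S(1)] by blast
    ultimately show ?thesis by (rule VI)
  qed
  have V_scale: "c * x \<in> V" if "c \<in> S" "x \<in> V" for c x
  proof -
    from VE[OF that(2)] obtain w
      where "(\<forall>\<beta>\<in>?B. w \<beta> \<in> S) \<and> x = (\<Sum>\<beta>\<in>?B. w \<beta> * (\<Prod>j<m. t j ^ \<beta> j))" ..
    note w = conjunct1[OF this] conjunct2[OF this]
    have "c * x = (\<Sum>\<beta>\<in>?B. (c * w \<beta>) * (\<Prod>j<m. t j ^ \<beta> j))"
      unfolding w(2) by (simp add: sum_distrib_left mult.assoc)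
    moreover have "\<forall>\<beta>\<in>?B. c * w \<beta> \<in> S" using w that is_subfieldD(4)[OF S(1)] by blast
    ultimately show ?thesis by (rule VI)
  qed
  have V_sum: "sum f I \<in> V" if "\<And>i. i \<in> I \<Longrightarrow> f i \<in> V" for f and I :: "nat set"
    using that by (induction I rule: infinite_finite_induct) (auto simp: V0 V_add)
  define d where "d i l = (\<Sum>j<m. eK (eF (\<gamma> l j i)) * \<xi> j)" for i l
  have dS: "d i l \<in> S" for i l
    unfolding d_def using S by (intro is_subfield_sum[OF S(1)] is_subfieldD(4)[OF S(1)]) auto
  have tq: "t i ^ q = (\<Sum>l<m. d i l * t l)" if "i < m" for i
  proof -
    have "t i ^ q = mulc (eK \<circ> eF) t \<xi> i" by (rule mulc_eqI[OF hom_comp[OF eK] \<xi> that, symmetric])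
    also have "\<dots> = (\<Sum>j<m. \<Sum>l<m. eK (eF (\<gamma> l j i)) * \<xi> j * t l)"
      using that by (simp add: mulc_def regular_def sum_distrib_right sum_distrib_left mult_ac)
    also have "\<dots> = (\<Sum>l<m. \<Sum>j<m. eK (eF (\<gamma> l j i)) * \<xi> j * t l)" by (rule sum.swap)
    also have "\<dots> = (\<Sum>l<m. d i l * t l)" by (simp add: d_def sum_distrib_right)
    finally show ?thesis .
  qed
  have "(\<Prod>j<m. t j ^ \<alpha> j) \<in> V"
    using \<open>\<alpha> \<in> exps m\<close>
  proof (induction "\<Sum>j<m. \<alpha> j" arbitrary: \<alpha> rule: less_induct)
    case less
    show ?case
    proof (cases "\<forall>j<m. \<alpha> j < q")
      case True
      then have \<alpha>: "\<alpha> \<in> ?B" using less.prems by blast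
      have "(\<Prod>j<m. t j ^ \<alpha> j) = (\<Sum>\<beta>\<in>?B. (if \<beta> = \<alpha> then 1 else 0) * (\<Prod>j<m. t j ^ \<beta> j))"
        using \<alpha> finB by (simp add: if_distrib[where f = "\<lambda>x. x * _"] cong: if_cong)
      moreover have "\<forall>\<beta>\<in>?B. (if \<beta> = \<alpha> then 1 else 0) \<in> S" using is_subfieldD[OF S(1)] by simp
      ultimately show ?thesis by (rule VI)
    next
      case False
      then obtain i where i: "i < m" "q \<le> \<alpha> i" by (auto simp: not_less)
      define \<alpha>' where "\<alpha>' = \<alpha>(i := \<alpha> i - q)"
      have sum': "(\<Sum>j<m. \<alpha> j) = (\<Sum>j<m. \<alpha>' j) + q"
        using i by (simp add: \<alpha>'_def sum.remove[of "{..<m}" i])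
      have "(\<Prod>j<m. t j ^ \<alpha> j) = t i ^ q * (\<Prod>j<m. t j ^ \<alpha>' j)"
        using i by (simp add: \<alpha>'_def prod.remove[of "{..<m}" i] power_add[symmetric])
      also have "\<dots> = (\<Sum>l<m. d i l * (t l * (\<Prod>j<m. t j ^ \<alpha>' j)))"
        unfolding tq[OF i(1)] by (simp add: sum_distrib_right mult.assoc)
      also have "\<dots> \<in> V"
      proof (rule V_sum, rule V_scale[OF dS])
        fix l assume "l \<in> {..<m}"
        then have l: "l < m" by simp
        define \<beta> where "\<beta> = \<alpha>'(l := Suc (\<alpha>' l))"
        have "t l * (\<Prod>j<m. t j ^ \<alpha>' j) = (\<Prod>j<m. t j ^ \<beta> j)"
          using l by (simp add: \<beta>_def prod.remove[of "{..<m}" l])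
        moreover have "(\<Sum>j<m. \<beta> j) = Suc (\<Sum>j<m. \<alpha>' j)"
          using l by (simp add: \<beta>_def sum.remove[of "{..<m}" l])
        then have "(\<Sum>j<m. \<beta> j) < (\<Sum>j<m. \<alpha> j)" unfolding sum' using q_gt_1 by simp
        moreover have "\<beta> \<in> exps m" using less.prems i(1) l by (auto simp: exps_def \<beta>_def \<alpha>'_def)
        ultimately show "t l * (\<Prod>j<m. t j ^ \<alpha>' j) \<in> V" using less.hyps by simp
      qed
      finally show ?thesis .
    qed
  qed
  then show ?thesis by (rule VE)
qed

text \<open>The coordinates \<open>u\<close> of a fundamental solution are algebraically independent: a nonzero
  polynomial \<open>D t\<close> satisfies an algebraic equation over the field generated by \<open>\<xi>\<close>
  with nonzero constant term, and this equation specializes under \<open>t \<mapsto> u\<close>, \<open>\<xi> \<mapsto> t\<close>.\<close>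

lemma solution_alg_indep:
  fixes g :: "'K \<Rightarrow> 'e::field"
  assumes g: "field_hom g" and inv: "mat_mul n B (emb (g \<circ> eK \<circ> eF) u) = mat_one n"
    and eq: "mat_mul n (emb (g \<circ> eK \<circ> eF) u) (emb (g \<circ> eK \<circ> eF) (\<lambda>i. g (t i))) = emb (g \<circ> eK \<circ> eF) (\<lambda>i. u i ^ q)"
  shows "alg_indep m (g \<circ> eK) u"
proof -
  have geK: "field_hom (g \<circ> eK)" by (rule field_hom_comp[OF g eK])
  interpret A: specialization m eK "g \<circ> eK" t u using eK geK by unfold_locales
  interpret B: specialization m eK eK t \<xi> using eK by unfold_locales
  interpret C: specialization m eK eK t t using eK by unfold_locales
  have \<xi>_rel: "A.rrel (\<xi> j) (g (t j))" if "j < m" for j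
    by (rule rrel_\<xi>[OF geK \<delta>_nonzero[OF geK inv] eq that])
  \<comment> \<open>An element s is in \<open>S\<close> when it is a fraction s' evaluated at
    \<open>\<xi>\<close> and, moreover, specializing t to u carries s to the image of s' under
    \<open>g\<close>. The second clause records that \<xi> goes to t.\<close>
  define S where "S = {s. \<exists>s'. B.rrel s' s \<and> A.rrel s (g s')}"
  have SI: "s \<in> S" if "B.rrel s' s" "A.rrel s (g s')" for s s' using that unfolding S_def by blast
  have g0: "A.rrel 0 (g 0)" and g1: "A.rrel 1 (g 1)"
    using A.rrel_0 A.rrel_1 by (auto simp: field_homD[OF g])
  have "is_subfield S"
    unfolding is_subfield_def
  proof (intro conjI ballI)
    fix x y assume "x \<in> S" "y \<in> S"
    then obtain x' y' where x': "B.rrel x' x" "A.rrel x (g x')" and y': "B.rrel y' y" "A.rrel y (g y')"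
      unfolding S_def by blast
    show "x + y \<in> S" using B.rrel_add[OF x'(1) y'(1)] A.rrel_add[OF x'(2) y'(2)]
      by (intro SI) (auto simp: field_homD[OF g])
    show "x * y \<in> S" using B.rrel_mult[OF x'(1) y'(1)] A.rrel_mult[OF x'(2) y'(2)]
      by (intro SI) (auto simp: field_homD[OF g])
  next
    fix x assume "x \<in> S"
    then obtain x' where x': "B.rrel x' x" "A.rrel x (g x')" unfolding S_def by blast
    show "- x \<in> S" using B.rrel_uminus[OF x'(1)] A.rrel_uminus[OF x'(2)]
      by (intro SI) (auto simp: field_hom_simps[OF g])
    show "inverse x \<in> S"
    proof (cases "x = 0")
      case True
      then show ?thesis using \<open>x \<in> S\<close> by simp
    next
      case False
      \<comment> \<open>Had x' been zero, so would be its value x at \<open>\<xi>\<close>. Hence the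
        value of x at \<open>u\<close> is nonzero and the inverse specializes too.\<close>
      then have nz: "x' \<noteq> 0" using B.rrel_eq_0[OF t_indep x'(1)] by blast
      then have "g x' \<noteq> 0" using field_hom_eq_0_iff[OF g] by blast
      then show ?thesis using B.rrel_inverse[OF x'(1) nz False] A.rrel_inverse[OF x'(2) False]
        by (intro SI) (auto simp: field_hom_simps[OF g])
    qed
  qed (use SI[OF B.rrel_0 g0] SI[OF B.rrel_1 g1] in auto)
  note sub = this
  have eKS: "range eK \<subseteq> S"
    using SI[OF B.prel_imp_rrel[OF B.prel_const]] A.prel_imp_rrel[OF A.prel_const] by auto
  have \<xi>S: "\<xi> j \<in> S" if "j < m" for j
    using SI[OF B.prel_imp_rrel[OF B.prel_var[OF that]] \<xi>_rel[OF that]] .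
  let ?B = "{\<beta>\<in>exps m. \<forall>j<m. \<beta> j < q}"
  note finB = finite_reduced_exps
  show ?thesis
    unfolding alg_indep_def
  proof (intro allI impI ballI)
    fix T c \<alpha> assume T: "finite T \<and> T \<subseteq> exps m \<and> mpeval m (g \<circ> eK) T c u = 0" and \<alpha>: "\<alpha> \<in> T"
    define z where "z = mpeval m eK T c t"
    have z_rel: "A.rrel z 0"
      using A.prel_imp_rrel[OF A.prelI[of T c]] T unfolding z_def by simp
    show "c \<alpha> = 0"
    proof (rule ccontr)
      assume "c \<alpha> \<noteq> 0"
      then have z: "z \<noteq> 0" using t_indep T \<alpha> unfolding alg_indep_def z_def by blast
      have span: "\<exists>w. (\<forall>\<beta>\<in>?B. w \<beta> \<in> S) \<and> z ^ k = (\<Sum>\<beta>\<in>?B. w \<beta> * (\<Prod>j<m. t j ^ \<beta> j))" for k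
      proof -
        have "C.prel (z ^ k) (z ^ k)"
          unfolding z_def using T by (intro C.prel_power C.prelI) auto
        then obtain T' c' where T': "finite T'" "T' \<subseteq> exps m" "z ^ k = mpeval m eK T' c' t"
          unfolding C.prel_def by blast
        have "\<forall>\<alpha>\<in>T'. \<exists>w. (\<forall>\<beta>\<in>?B. w \<beta> \<in> S)
          \<and> (\<Prod>j<m. t j ^ \<alpha> j) = (\<Sum>\<beta>\<in>?B. w \<beta> * (\<Prod>j<m. t j ^ \<beta> j))"
          using monomial_span[OF sub eKS \<xi>S] T'(2) by blast
        from bchoice[OF this] obtain w where W: "\<forall>\<alpha>\<in>T'. (\<forall>\<beta>\<in>?B. w \<alpha> \<beta> \<in> S)
          \<and> (\<Prod>j<m. t j ^ \<alpha> j) = (\<Sum>\<beta>\<in>?B. w \<alpha> \<beta> * (\<Prod>j<m. t j ^ \<beta> j))" ..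
        have w: "w \<alpha> \<beta> \<in> S" if "\<alpha> \<in> T'" "\<beta> \<in> ?B" for \<alpha> \<beta> using W that by blast
        have w_sum: "(\<Prod>j<m. t j ^ \<alpha> j) = (\<Sum>\<beta>\<in>?B. w \<alpha> \<beta> * (\<Prod>j<m. t j ^ \<beta> j))" if "\<alpha> \<in> T'" for \<alpha>
          using W that by blast
        have "z ^ k = (\<Sum>\<alpha>\<in>T'. \<Sum>\<beta>\<in>?B. eK (c' \<alpha>) * w \<alpha> \<beta> * (\<Prod>j<m. t j ^ \<beta> j))"
          unfolding T'(3) mpeval_def by (intro sum.cong refl) (simp add: w_sum sum_distrib_left mult.assoc)
        also have "\<dots> = (\<Sum>\<beta>\<in>?B. \<Sum>\<alpha>\<in>T'. eK (c' \<alpha>) * w \<alpha> \<beta> * (\<Prod>j<m. t j ^ \<beta> j))" by (rule sum.swap)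
        also have "\<dots> = (\<Sum>\<beta>\<in>?B. (\<Sum>\<alpha>\<in>T'. eK (c' \<alpha>) * w \<alpha> \<beta>) * (\<Prod>j<m. t j ^ \<beta> j))"
          by (simp add: sum_distrib_right)
        finally have "z ^ k = (\<Sum>\<beta>\<in>?B. (\<Sum>\<alpha>\<in>T'. eK (c' \<alpha>) * w \<alpha> \<beta>) * (\<Prod>j<m. t j ^ \<beta> j))" .
        moreover have "\<forall>\<beta>\<in>?B. (\<Sum>\<alpha>\<in>T'. eK (c' \<alpha>) * w \<alpha> \<beta>) \<in> S"
          using w eKS by (intro ballI is_subfield_sum[OF sub] is_subfieldD(4)[OF sub]) auto
        ultimately show ?thesis
          by (intro exI[of _ "\<lambda>\<beta>. \<Sum>\<alpha>\<in>T'. eK (c' \<alpha>) * w \<alpha> \<beta>"] conjI)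
      qed
      obtain M s where s: "\<forall>k\<le>M. s k \<in> S" "s 0 \<noteq> 0" "(\<Sum>k\<le>M. s k * z ^ k) = 0"
        using algebraic_relation[OF sub finB z span] by blast
      have "\<forall>k\<in>{..M}. \<exists>s'. B.rrel s' (s k) \<and> A.rrel (s k) (g s')" using s(1) unfolding S_def by blast
      then obtain s' where s': "\<And>k. k \<le> M \<Longrightarrow> B.rrel (s' k) (s k)" "\<And>k. k \<le> M \<Longrightarrow> A.rrel (s k) (g (s' k))"
        by (metis atMost_iff)
      \<comment> \<open>Specializing the relation sends \<open>z\<close> to 0 and leaves only the
        constant term, which must then vanish; this contradicts its choice.\<close>
      have "A.rrel (\<Sum>k\<le>M. s k * z ^ k) (\<Sum>k\<le>M. g (s' k) * 0 ^ k)"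
        using s' z_rel by (intro A.rrel_sum A.rrel_mult A.rrel_power) auto
      then have "(\<Sum>k\<le>M. g (s' k) * 0 ^ k) = 0" using A.rrel_eq_0[OF t_indep] s(3) by blast
      moreover have "(\<Sum>k\<le>M. g (s' k) * 0 ^ k) = g (s' 0)"
        by (simp add: power_0_left if_distrib[where f = "\<lambda>x. _ * x"] cong: if_cong)
      ultimately have "s' 0 = 0" using field_hom_eq_0_iff[OF g] by simp
      then have "s 0 = 0" using B.rrel_eq_0[OF t_indep s'(1)[of 0]] by simp
      then show False using s(2) by blast
    qed
  qed
qed

end

section \<open>The Galois group over the rational function field\<close>

lemma is_subfield_prod: "is_subfield S \<Longrightarrow> (\<And>i. i \<in> I \<Longrightarrow> f i \<in> S) \<Longrightarrow> prod f I \<in> S"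
  by (induction I rule: infinite_finite_induct) (auto simp: is_subfieldD)

lemma is_subfield_mpeval:
  assumes "is_subfield S" "range h \<subseteq> S" "\<And>j. j < m \<Longrightarrow> x j \<in> S"
  shows "mpeval m h A c x \<in> S"
  unfolding mpeval_def using assms
  by (intro is_subfield_sum[OF assms(1)] is_subfieldD(4)[OF assms(1)] is_subfield_prod[OF assms(1)]
      is_subfield_power[OF assms(1)]) auto

lemma is_subfield_mat_mul:
  assumes "is_subfield S" "\<And>i j. A i j \<in> S" "\<And>i j. B i j \<in> S"
  shows "mat_mul n A B i j \<in> S"
  unfolding mat_mul_def using assms is_subfieldD(1)[OF assms(1)]
  by (auto intro!: is_subfield_sum[OF assms(1)] is_subfieldD(4)[OF assms(1)])

lemma gen_field_subset: "is_subfield S \<Longrightarrow> R \<subseteq> S \<Longrightarrow> gen_field R \<subseteq> S"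
  unfolding gen_field_def by blast

lemma mat_mul_left_cancel:
  assumes "mat_mul n W U = mat_one n" "A \<in> Mn n" "B \<in> Mn n" "mat_mul n U A = mat_mul n U B"
  shows "A = B"
  using arg_cong[OF assms(4), of "mat_mul n W"]
  unfolding mat_mul_assoc[symmetric] assms(1) by (simp add: mat_mul_one_left assms(2,3))

lemma mat_mul_right_cancel:
  assumes "mat_mul n U W = mat_one n" "A \<in> Mn n" "B \<in> Mn n" "mat_mul n A U = mat_mul n B U"
  shows "A = B"
  using arg_cong[OF assms(4), of "\<lambda>Y. mat_mul n Y W"]
  unfolding mat_mul_assoc assms(1) by (simp add: mat_mul_one_right assms(2,3))

lemma mmap_Delta: "field_hom g \<Longrightarrow> mmap g (Delta n a) = Delta n (\<lambda>i. g (a i))"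
  by (auto simp: Delta_def fun_eq_iff field_homD)

lemma mmap_inj: "field_hom h \<Longrightarrow> mmap h A = mmap h B \<Longrightarrow> A = B"
  by (intro ext) (metis field_hom_eq_iff)

text \<open>Entrywise q-th power acts on coordinates as q-th power, since the basis is rational. As
  coordinates are unique, a fixed matrix has rational coordinates.\<close>

lemma (in matrix_algebra) fixed_in_algebra:
  fixes h :: "'f \<Rightarrow> 'e::field"
  assumes h: "field_hom h" and fxd: "mpow (card (UNIV :: 'f set)) (emb h x) = emb h x"
  shows "\<exists>C\<in>\<A>. emb h x = mmap h C"
proof -
  let ?x = "\<lambda>i. if i < m then x i else 0"
  have q: "0 < card (UNIV :: 'f set)" using card_finite_field_gt_1[where 'f = 'f] by linarith
  have x: "emb h x = emb h ?x" by (rule emb_cong) simp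
  have "(\<lambda>i. ?x i ^ card (UNIV :: 'f set)) = ?x"
  proof (rule emb_inj[OF h])
    show "emb h (\<lambda>i. ?x i ^ card (UNIV :: 'f set)) = emb h ?x"
      using fxd unfolding x mmap_frob_emb[OF h] .
  qed (use q in \<open>auto simp: coords_def\<close>)
  then have "\<forall>i. ?x i \<in> range h" using frob_fixed_iff[OF h] by (metis (mono_tags, lifting))
  then have "\<forall>i. \<exists>c. ?x i = h c" by blast
  then obtain c where c: "\<And>i. ?x i = h (c i)" by metis
  have "emb h ?x = mmap h (\<lambda>r s. \<Sum>i<m. c i * v i r s)" unfolding c by (rule emb_combination[OF h])
  then show ?thesis
    unfolding x by (rule bexI[of "\<lambda>C. emb h ?x = mmap h C"]) (rule combination_in, simp)
qed

lemma (in matrix_algebra) emb_inj': "field_hom h \<Longrightarrow> emb h x = emb h y \<Longrightarrow> i < m \<Longrightarrow> x i = y i"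
proof -
  assume h: "field_hom h" and eq: "emb h x = emb h y" and i: "i < m"
  let ?r = "\<lambda>x i. if i < m then x i else 0"
  have "emb h (?r x) = emb h x" "emb h (?r y) = emb h y" by (auto intro!: emb_cong)
  then have "?r x = ?r y" using eq by (intro emb_inj[OF h]) (auto simp: coords_def)
  from fun_cong[OF this, of i] show "x i = y i" using i by simp
qed

locale generic_equation = generic_matrix \<A> n m v eF eK t q
  for \<A> :: "(nat \<Rightarrow> nat \<Rightarrow> 'f::{finite,field}) set" and n m :: nat and v
    and eF :: "'f \<Rightarrow> 'k::field" and eK :: "'k \<Rightarrow> 'K::field" and t :: "nat \<Rightarrow> 'K" and q :: nat +
  fixes N Ninv :: "nat \<Rightarrow> nat \<Rightarrow> 'K" and a :: "nat \<Rightarrow> 'K"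
  assumes N: "N \<in> Mn n" "Ninv \<in> Mn n" "mat_mul n N Ninv = mat_one n"
    and Delta: "mat_mul n (mat_mul n Ninv (emb (eK \<circ> eF) t)) (mpow q N) = Delta n a"
begin

lemma NinvN: "mat_mul n Ninv N = mat_one n" by (rule mat_left_inverse_imp_right[OF N(3)])

text \<open>The companion matrix is a product of invertible matrices, but its top row is zero if
  \<open>a 0\<close> is.\<close>

lemma a_0_nonzero: "a 0 \<noteq> 0"
proof
  assume 0: "a 0 = 0"
  note F = frob_hom[OF eK]
  obtain y where y: "mat_mul n (emb (eK \<circ> eF) t) (emb (eK \<circ> eF) y) = mat_one n"
    using \<delta>_inverse[OF eK \<delta>_t] by blast
  define Y where "Y = mat_mul n (mpow q Ninv) (mat_mul n (emb (eK \<circ> eF) y) N)"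
  have FN: "mat_mul n (mpow q N) (mpow q Ninv) = mat_one n"
    unfolding mmap_mat_mul[OF F, symmetric] N(3) mmap_mat_one[OF F] ..
  have "mat_mul n (Delta n a) Y = mat_mul n Ninv (mat_mul n (emb (eK \<circ> eF) t)
      (mat_mul n (mat_mul n (mpow q N) (mpow q Ninv)) (mat_mul n (emb (eK \<circ> eF) y) N)))"
    unfolding Delta[symmetric] Y_def mat_mul_assoc ..
  also have "\<dots> = mat_mul n Ninv (mat_mul n (mat_mul n (emb (eK \<circ> eF) t) (emb (eK \<circ> eF) y)) N)"
    unfolding FN mat_mul_one_left[OF mat_mul_Mn] mat_mul_assoc ..
  also have "\<dots> = mat_one n" unfolding y mat_mul_one_left[OF N(1)] NinvN ..
  finally have "mat_mul n (Delta n a) Y 0 0 = 1" using n_pos by (simp add: mat_one_def)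
  moreover have "mat_mul n (Delta n a) Y 0 0 = 0"
    using n_pos 0 by (auto simp: mat_mul_def Delta_def intro!: sum.neutral)
  ultimately show False by simp
qed

section \<open>Unit solutions over an extension of the rational function field\<close>

abbreviation hh :: "('K \<Rightarrow> 'e) \<Rightarrow> 'f \<Rightarrow> 'e::field" where "hh g \<equiv> g \<circ> eK \<circ> eF"

lemma hh: "field_hom g \<Longrightarrow> field_hom (hh g)"
  using field_hom_comp[OF field_hom_comp[OF _ eK] eF] .

definition solution :: "('K \<Rightarrow> 'e::field) \<Rightarrow> (nat \<Rightarrow> 'e) \<Rightarrow> (nat \<Rightarrow> 'e) \<Rightarrow> bool" where
  "solution g u w \<longleftrightarrow> u \<in> coords m \<and> mat_mul n (emb (hh g) u) (emb (hh g) w) = mat_one n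
    \<and> mat_mul n (emb (hh g) w) (emb (hh g) u) = mat_one n
    \<and> mat_mul n (emb (hh g) u) (emb (hh g) (\<lambda>i. g (t i))) = mpow q (emb (hh g) u)"

lemma transported:
  assumes g: "field_hom g"
  shows "mat_mul n (mmap g N) (mmap g Ninv) = mat_one n" "mat_mul n (mmap g Ninv) (mmap g N) = mat_one n"
    "mat_mul n (mat_mul n (mmap g Ninv) (emb (hh g) (\<lambda>i. g (t i)))) (mpow q (mmap g N)) = Delta n (\<lambda>i. g (a i))"
proof -
  show "mat_mul n (mmap g N) (mmap g Ninv) = mat_one n" "mat_mul n (mmap g Ninv) (mmap g N) = mat_one n"
    unfolding mmap_mat_mul[OF g, symmetric] N(3) NinvN mmap_mat_one[OF g] by (rule refl)+
  have "emb (hh g) (\<lambda>i. g (t i)) = mmap g (emb (eK \<circ> eF) t)"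
    using mmap_emb[OF g, of "eK \<circ> eF" t] by (simp add: comp_assoc)
  moreover have "mpow q (mmap g N) = mmap g (mpow q N)"
    by (simp add: field_hom_power[OF g])
  ultimately show "mat_mul n (mat_mul n (mmap g Ninv) (emb (hh g) (\<lambda>i. g (t i)))) (mpow q (mmap g N)) = Delta n (\<lambda>i. g (a i))"
    using arg_cong[OF Delta, of "mmap g"] by (simp only: mmap_mat_mul[OF g] mmap_Delta[OF g])
qed

lemma exists_solution:
  fixes g :: "'K \<Rightarrow> 'e::field"
  assumes g: "field_hom g" and card: "card {y. poly (f_poly q n (\<lambda>i. g (a i))) y = 0} = q ^ n"
  shows "\<exists>u w. solution g u w"
proof -
  note h = hh[OF g]
  interpret E: frobenius_field "hh g" q using h q by unfold_locales
  note F = E.frob_hom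
  obtain y Zi where y: "\<And>i. i < n \<Longrightarrow> poly (f_poly q n (\<lambda>i. g (a i))) (y i) = 0"
    and Zi: "Zi \<in> Mn n" "mat_mul n (E.moore n y) Zi = mat_one n"
    using E.exists_moore_inverse[OF n_pos card] by blast
  let ?Z = "E.moore n y" and ?N = "mmap g N" and ?Ni = "mmap g Ninv" and ?T = "emb (hh g) (\<lambda>i. g (t i))"
  \<comment> \<open>Undoing the change of variables by \<open>N\<close> on a Moore matrix gives a
    solution with entries outside the extended algebra in general;
    \<open>exists_invertible_solution\<close> moves it inside.\<close>
  define U0 where "U0 = mat_mul n ?Z ?Ni"
  define U0i where "U0i = mat_mul n ?N Zi"
  note tr = transported[OF g]
  have Nin: "?N \<in> Mn n" "?Ni \<in> Mn n" using N mmap_Mn[OF g] by auto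
  have "mat_mul n U0 U0i = mat_mul n ?Z (mat_mul n (mat_mul n ?Ni ?N) Zi)"
    unfolding U0_def U0i_def mat_mul_assoc ..
  also have "\<dots> = mat_one n" unfolding tr mat_mul_one_left[OF Zi(1)] Zi(2) ..
  finally have inv: "mat_mul n U0 U0i = mat_one n" .
  have FN: "mat_mul n (mpow q ?N) (mpow q ?Ni) = mat_one n"
    using arg_cong[OF tr(1), of "mpow q"] by (simp only: mmap_mat_mul[OF F] mmap_mat_one[OF F])
  have FZ: "mpow q ?Z = mat_mul n ?Z (Delta n (\<lambda>i. g (a i)))"
    by (rule E.frob_moore[OF n_pos y])
  have "mpow q U0 = mat_mul n (mpow q ?Z) (mpow q ?Ni)"
    unfolding U0_def by (rule mmap_mat_mul[OF F])
  also have "\<dots> = mat_mul n (mat_mul n ?Z (Delta n (\<lambda>i. g (a i)))) (mpow q ?Ni)"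
    by (rule arg_cong[OF FZ])
  also have "\<dots> = mat_mul n ?Z (mat_mul n ?Ni (mat_mul n ?T (mat_mul n (mpow q ?N) (mpow q ?Ni))))"
    unfolding tr(3)[symmetric] mat_mul_assoc ..
  also have "\<dots> = mat_mul n U0 ?T"
    unfolding FN mat_mul_one_right[OF emb_Mn[OF h]] U0_def mat_mul_assoc ..
  finally have eq: "mpow (card (UNIV :: 'f set)) U0 = mat_mul n U0 ?T" unfolding q .
  have "U0 \<in> Mn n" "U0i \<in> Mn n" unfolding U0_def U0i_def by simp_all
  from exists_invertible_solution[OF h this inv eq] show ?thesis
    unfolding solution_def q[symmetric] by (metis (no_types, lifting))
qed

lemma solution_indep: "field_hom g \<Longrightarrow> solution g u w \<Longrightarrow> alg_indep m (g \<circ> eK) u"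
  using solution_alg_indep[of g "emb (hh g) w" u] frob_emb[OF field_hom_comp[OF _ eK], of g u]
  unfolding solution_def by simp

lemma solution_\<xi>:
  assumes g: "field_hom g" and u: "solution g u w" and j: "j < m"
  shows "specialization.rrel m eK (g \<circ> eK) t u (\<xi> j) (g (t j))"
proof (rule rrel_\<xi>[OF field_hom_comp[OF g eK] _ _ j])
  show "\<delta> (g \<circ> eK) u \<noteq> 0"
    using u \<delta>_nonzero[OF field_hom_comp[OF g eK]] unfolding solution_def by blast
  show "mat_mul n (emb (g \<circ> eK \<circ> eF) u) (emb (g \<circ> eK \<circ> eF) (\<lambda>i. g (t i))) = emb (g \<circ> eK \<circ> eF) (\<lambda>i. u i ^ q)"
    using u frob_emb[OF field_hom_comp[OF g eK], of u] unfolding solution_def by simp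
qed

text \<open>The field generated by \<open>u\<close> contains each \<open>t j\<close>, which is the
  value of \<open>\<xi> j\<close> at \<open>u\<close>. It therefore contains K, the entries of
  \<open>Z = U N\<close>, and all the roots.\<close>

lemma solution_generates:
  assumes g: "field_hom g" and u: "solution g u w"
    and gen: "gen_field (range g \<union> {y. poly (f_poly q n (\<lambda>i. g (a i))) y = 0}) = UNIV"
  shows "is_rat_fun_field m (g \<circ> eK) u"
proof -
  note geK = field_hom_comp[OF g eK] and h = hh[OF g]
  interpret E: frobenius_field "hh g" q using h q by unfold_locales
  interpret A: specialization m eK "g \<circ> eK" t u using eK geK by unfold_locales
  let ?S = "rat_funs m (g \<circ> eK) u"
  note S = rat_funs_subfield[OF geK, where m = m and t = u]
  have tS: "g (t j) \<in> ?S" if "j < m" for j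
    using A.rrel_specializes[OF solution_\<xi>[OF g u that]] unfolding specializes_def rat_funs_def by blast
  have gS: "g x \<in> ?S" for x
  proof -
    have "x \<in> rat_funs m eK t" using t unfolding rat_fun_field_iff by blast
    then obtain I P Q where x: "x = mpeval m eK I P t / mpeval m eK I Q t" unfolding rat_funs_def by blast
    have "g x = mpeval m (g \<circ> eK) I P (\<lambda>j. g (t j)) / mpeval m (g \<circ> eK) I Q (\<lambda>j. g (t j))"
      unfolding x field_hom_divide[OF g] mpeval_hom[OF g] ..
    then show ?thesis using S tS
      by (auto intro!: is_subfield_divide[OF S(1)] is_subfield_mpeval[OF S(1)])
  qed
  define Z where "Z = mat_mul n (emb (hh g) u) (mmap g N)"
  define Zi where "Zi = mat_mul n (mmap g Ninv) (emb (hh g) w)"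
  note tr = transported[OF g]
  have ZZi: "mat_mul n Z Zi = mat_one n"
    and ZD: "mpow q Z = mat_mul n Z (Delta n (\<lambda>i. g (a i)))"
    using E.solution_times[OF _ emb_Mn[OF h] tr(1) _ tr(3), of "emb (hh g) u" w] u
    unfolding Z_def Zi_def solution_def by auto
  have hS: "hh g c \<in> ?S" for c using gS by simp
  have "emb (hh g) u i j \<in> ?S" for i j
    unfolding emb_def using S hS by (auto intro!: is_subfield_sum[OF S(1)] is_subfieldD(4)[OF S(1)])
  then have ZS: "Z i j \<in> ?S" for i j
    unfolding Z_def using gS by (intro is_subfield_mat_mul[OF S(1)]) auto
  have "{y. poly (f_poly q n (\<lambda>i. g (a i))) y = 0} \<subseteq> ?S"
  proof
    fix y assume "y \<in> {y. poly (f_poly q n (\<lambda>i. g (a i))) y = 0}"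
    then obtain c where "y = (\<Sum>k<n. hh g (c k) * Z k 0)"
      using E.root_as_combination[OF n_pos _ _ ZZi ZD] unfolding Z_def Zi_def by auto
    then show "y \<in> ?S" using hS ZS
      by (auto intro!: is_subfield_sum[OF S(1)] is_subfieldD(4)[OF S(1)])
  qed
  then have "UNIV \<subseteq> ?S" unfolding gen[symmetric] using gS by (intro gen_field_subset[OF S(1)]) auto
  then show ?thesis unfolding rat_fun_field_iff using geK solution_indep[OF g u] by auto
qed

text \<open>The quotient of two solutions is both Frobenius-fixed and in the extended algebra, so it
  lies in the algebra. Exchanging the two solutions gives its inverse there.\<close>

lemma solution_quotient:
  assumes g: "field_hom g" and u: "solution g u w" and u': "solution g u' w'"
  shows "\<exists>C\<in>carrier (units_group n \<A>). mat_mul n (mmap (hh g) C) (emb (hh g) u') = emb (hh g) u"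
proof -
  note h = hh[OF g]
  interpret E: frobenius_field "hh g" q using h q by unfold_locales
  have quot: "\<exists>C\<in>\<A>. mat_mul n (emb (hh g) u) (emb (hh g) w') = mmap (hh g) C"
    if u: "solution g u w" and u': "solution g u' w'" for u w u' w'
  proof -
    have "mat_mul n (emb (hh g) u) (emb (hh g) w') i j \<in> range (hh g)" for i j
      by (rule E.solution_quotient_fixed(1)[where Z = "emb (hh g) u'" and D = "emb (hh g) (\<lambda>i. g (t i))"])
        (use u u' emb_Mn[OF h] in \<open>auto simp: solution_def\<close>)
    then have "mat_mul n (emb (hh g) u) (emb (hh g) w') i j ^ q = mat_mul n (emb (hh g) u) (emb (hh g) w') i j" for i j
      using E.frob_fixed by blast
    then show ?thesis
      using fixed_in_algebra[OF h, of "mulc (hh g) u w'"] unfolding emb_mulc[OF h] q[symmetric] by simp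
  qed
  obtain C where C: "C \<in> \<A>" "mat_mul n (emb (hh g) u) (emb (hh g) w') = mmap (hh g) C"
    using quot[OF u u'] by blast
  obtain D where D: "D \<in> \<A>" "mat_mul n (emb (hh g) u') (emb (hh g) w) = mmap (hh g) D"
    using quot[OF u' u] by blast
  have "mmap (hh g) (mat_mul n C D) = mat_mul n (emb (hh g) u) (mat_mul n (mat_mul n (emb (hh g) w') (emb (hh g) u')) (emb (hh g) w))"
    unfolding mmap_mat_mul[OF h] C(2)[symmetric] D(2)[symmetric] mat_mul_assoc ..
  also have "\<dots> = mmap (hh g) (mat_one n)"
    using u u' unfolding solution_def by (simp add: mat_mul_one_left[OF emb_Mn[OF h]] mmap_mat_one[OF h, unfolded comp_def])
  finally have CD: "mat_mul n C D = mat_one n" by (rule mmap_inj[OF h])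
  then have "C \<in> carrier (units_group n \<A>)"
    using C(1) D(1) mat_left_inverse_imp_right[OF CD] unfolding units_group_def by auto
  moreover have "mat_mul n (mmap (hh g) C) (emb (hh g) u') = emb (hh g) u"
    using u' unfolding C(2)[symmetric] mat_mul_assoc solution_def by (simp add: mat_mul_one_right[OF emb_Mn[OF h]])
  ultimately show ?thesis by blast
qed

lemma solution_translate:
  assumes g: "field_hom g" and u: "solution g u w" and C: "C \<in> carrier (units_group n \<A>)"
  shows "\<exists>u' w'. solution g u' w' \<and> mat_mul n (mmap (hh g) C) (emb (hh g) u') = emb (hh g) u"
proof -
  note h = hh[OF g]
  note F = frob_hom[OF field_hom_comp[OF g eK]]
  obtain D where D: "D \<in> \<A>" "mat_mul n C D = mat_one n" "mat_mul n D C = mat_one n" and C\<A>: "C \<in> \<A>"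
    using C unfolding units_group_def by auto
  obtain c where c: "C = (\<lambda>r s. \<Sum>i<m. c i * v i r s)" by (rule \<A>_coordsE[OF C\<A>])
  obtain d where d: "D = (\<lambda>r s. \<Sum>i<m. d i * v i r s)" by (rule \<A>_coordsE[OF D(1)])
  have Cemb: "mmap (hh g) C = emb (hh g) (\<lambda>i. hh g (c i))" unfolding c by (rule emb_combination[OF h, symmetric])
  have Demb: "mmap (hh g) D = emb (hh g) (\<lambda>i. hh g (d i))" unfolding d by (rule emb_combination[OF h, symmetric])
  define u' where "u' = mulc (hh g) (\<lambda>i. hh g (d i)) u"
  define w' where "w' = mulc (hh g) w (\<lambda>i. hh g (c i))"
  have u'_emb: "emb (hh g) u' = mat_mul n (mmap (hh g) D) (emb (hh g) u)"
    unfolding u'_def emb_mulc[OF h] Demb ..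
  have w'_emb: "emb (hh g) w' = mat_mul n (emb (hh g) w) (mmap (hh g) C)"
    unfolding w'_def emb_mulc[OF h] Cemb ..
  have CD: "mat_mul n (mmap (hh g) C) (mmap (hh g) D) = mat_one n"
    unfolding mmap_mat_mul[OF h, symmetric] D(2) mmap_mat_one[OF h] ..
  have DC: "mat_mul n (mmap (hh g) D) (mmap (hh g) C) = mat_one n"
    unfolding mmap_mat_mul[OF h, symmetric] D(3) mmap_mat_one[OF h] ..
  have uw: "mat_mul n (emb (hh g) u) (emb (hh g) w) = mat_one n" "mat_mul n (emb (hh g) w) (emb (hh g) u) = mat_one n"
    and ueq: "mat_mul n (emb (hh g) u) (emb (hh g) (\<lambda>i. g (t i))) = mpow q (emb (hh g) u)"
    using u unfolding solution_def by auto
  have "mat_mul n (emb (hh g) u') (emb (hh g) w')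
    = mat_mul n (mmap (hh g) D) (mat_mul n (mat_mul n (emb (hh g) u) (emb (hh g) w)) (mmap (hh g) C))"
    unfolding u'_emb w'_emb mat_mul_assoc ..
  also have "\<dots> = mat_one n"
    unfolding uw(1) mat_mul_one_left[OF mmap_Mn[OF h \<A>_Mn[OF C\<A>]]] DC ..
  finally have u'w': "mat_mul n (emb (hh g) u') (emb (hh g) w') = mat_one n" .
  have FD: "mpow q (mmap (hh g) D) = mmap (hh g) D"
    using frob_fixed_iff[OF h] unfolding q by (intro ext) simp
  have "mat_mul n (emb (hh g) u') (emb (hh g) (\<lambda>i. g (t i))) = mat_mul n (mmap (hh g) D) (mpow q (emb (hh g) u))"
    unfolding u'_emb mat_mul_assoc ueq ..
  also have "\<dots> = mpow q (emb (hh g) u')"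
    unfolding u'_emb mmap_mat_mul[OF F] FD ..
  finally have "solution g u' w'"
    using u'w' mat_left_inverse_imp_right[OF u'w'] unfolding solution_def u'_def by simp
  moreover have "mat_mul n (mmap (hh g) C) (emb (hh g) u') = emb (hh g) u"
    unfolding u'_emb mat_mul_assoc[symmetric] CD by (rule mat_mul_one_left[OF emb_Mn[OF h]])
  ultimately show ?thesis by blast
qed

theorem aut_group_iso:
  fixes g :: "'K \<Rightarrow> 'e::field"
  assumes split: "is_splitting_field g (f_poly q n a)"
  shows "aut_group g \<cong> units_group n \<A>"
proof -
  have g: "field_hom g" using split unfolding is_splitting_field_def by blast
  note h = hh[OF g] and geK = field_hom_comp[OF g eK]
  interpret E: frobenius_field "hh g" q using h q by unfold_locales
  let ?b = "\<lambda>i. g (a i)"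
  have map: "map_poly g (f_poly q n a) = f_poly q n ?b" by (rule map_f_poly[OF g])
  have "lead_coeff (f_poly q n ?b) = 1" by (rule E.lead_coeff_f[OF n_pos])
  then obtain rs where "f_poly q n ?b = (\<Prod>r\<leftarrow>rs. [:- r, 1:])"
    using split unfolding is_splitting_field_def splits_in_def map by auto
  then have card: "card {y. poly (f_poly q n ?b) y = 0} = q ^ n"
    using a_0_nonzero field_hom_eq_0_iff[OF g] by (intro E.card_roots_of_product[OF n_pos]) auto
  obtain u w where u: "solution g u w" using exists_solution[OF g card] by blast
  have gen: "gen_field (range g \<union> {y. poly (f_poly q n ?b) y = 0}) = UNIV"
    using split unfolding is_splitting_field_def map by blast
  note rat = solution_generates[OF g _ gen]
  let ?U = "emb (hh g) u"
  have aut: "field_hom \<sigma>" "bij \<sigma>" "\<sigma> (g x) = g x" "\<sigma> \<circ> hh g = hh g" if "\<sigma> \<in> Aut g" for \<sigma> x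
    using that unfolding Aut_def by (auto simp: fun_eq_iff)
  have mmap_fix: "mmap \<sigma> (mmap (hh g) C) = mmap (hh g) C" if "\<sigma> \<in> Aut g" for \<sigma> and C :: "nat \<Rightarrow> nat \<Rightarrow> 'f"
    using aut(3)[OF that] by simp
  have sol: "solution g (\<lambda>i. \<sigma> (u i)) (\<lambda>i. \<sigma> (w i))" and emb\<sigma>: "emb (hh g) (\<lambda>i. \<sigma> (u i)) = mmap \<sigma> ?U" if \<sigma>: "\<sigma> \<in> Aut g" for \<sigma>
  proof -
    have e: "mmap \<sigma> (emb (hh g) x) = emb (hh g) (\<lambda>i. \<sigma> (x i))" for x
      unfolding mmap_emb[OF aut(1)[OF \<sigma>]] aut(4)[OF \<sigma>] ..
    then show "emb (hh g) (\<lambda>i. \<sigma> (u i)) = mmap \<sigma> ?U" by simp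
    have "mat_mul n (emb (hh g) (\<lambda>i. \<sigma> (u i))) (emb (hh g) (\<lambda>i. \<sigma> (w i))) = mat_one n"
      "mat_mul n (emb (hh g) (\<lambda>i. \<sigma> (w i))) (emb (hh g) (\<lambda>i. \<sigma> (u i))) = mat_one n"
      using u unfolding e[symmetric] mmap_mat_mul[OF aut(1)[OF \<sigma>], symmetric] solution_def
      by (simp_all add: mmap_mat_one[OF aut(1)[OF \<sigma>]])
    moreover have "mat_mul n (emb (hh g) (\<lambda>i. \<sigma> (u i))) (emb (hh g) (\<lambda>i. g (t i))) = mpow q (emb (hh g) (\<lambda>i. \<sigma> (u i)))"
    proof -
      have "emb (hh g) (\<lambda>i. g (t i)) = mmap \<sigma> (emb (hh g) (\<lambda>i. g (t i)))" unfolding e aut(3)[OF \<sigma>] ..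
      then have "mat_mul n (emb (hh g) (\<lambda>i. \<sigma> (u i))) (emb (hh g) (\<lambda>i. g (t i)))
        = mmap \<sigma> (mat_mul n ?U (emb (hh g) (\<lambda>i. g (t i))))"
        unfolding mmap_mat_mul[OF aut(1)[OF \<sigma>]] e by simp
      also have "\<dots> = mmap \<sigma> (mpow q ?U)" using u unfolding solution_def by simp
      also have "\<dots> = mpow q (emb (hh g) (\<lambda>i. \<sigma> (u i)))"
        by (simp add: field_hom_power[OF aut(1)[OF \<sigma>]] fun_cong[OF fun_cong[OF e]])
      finally show ?thesis .
    qed
    ultimately show "solution g (\<lambda>i. \<sigma> (u i)) (\<lambda>i. \<sigma> (w i))"
      using u field_homD(1)[OF aut(1)[OF \<sigma>]] unfolding solution_def coords_def by auto
  qed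
  let ?G = "carrier (units_group n \<A>)"
  have G_Mn: "C \<in> Mn n" if "C \<in> ?G" for C using that \<A>_Mn unfolding units_group_def by auto
  \<comment> \<open>The inverse cocycle: \<open>\<Psi> \<sigma>\<close> is U divided by its
    conjugate, so that \<sigma> multiplies U by the inverse of \<open>\<Psi> \<sigma>\<close>. The
    inversion undoes the reversal of order and makes \<open>\<Psi>\<close> a homomorphism.\<close>
  define \<Psi> where "\<Psi> \<sigma> = (SOME C. C \<in> ?G \<and> mat_mul n (mmap (hh g) C) (mmap \<sigma> ?U) = ?U)" for \<sigma>
  have \<Psi>: "\<Psi> \<sigma> \<in> ?G \<and> mat_mul n (mmap (hh g) (\<Psi> \<sigma>)) (mmap \<sigma> ?U) = ?U" if "\<sigma> \<in> Aut g" for \<sigma>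
  proof -
    have "\<exists>C. C \<in> ?G \<and> mat_mul n (mmap (hh g) C) (mmap \<sigma> ?U) = ?U"
      using solution_quotient[OF g u sol[OF that]] unfolding emb\<sigma>[OF that] Bex_def .
    from someI_ex[OF this] show ?thesis unfolding \<Psi>_def .
  qed
  have uniq: "C = D" if "\<sigma> \<in> Aut g" "C \<in> ?G" "D \<in> ?G" "mat_mul n (mmap (hh g) C) (mmap \<sigma> ?U) = ?U"
    "mat_mul n (mmap (hh g) D) (mmap \<sigma> ?U) = ?U" for \<sigma> C D
  proof (rule mmap_inj[OF h], rule mat_mul_right_cancel)
    show "mat_mul n (mmap \<sigma> ?U) (emb (hh g) (\<lambda>i. \<sigma> (w i))) = mat_one n"
      using sol[OF that(1)] unfolding solution_def emb\<sigma>[OF that(1)] by blast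
  qed (use that mmap_Mn[OF h G_Mn] in auto)
  have Aut_comp: "\<sigma> \<circ> \<tau> \<in> Aut g" if "\<sigma> \<in> Aut g" "\<tau> \<in> Aut g" for \<sigma> \<tau>
    using that field_hom_comp unfolding Aut_def by (auto intro: bij_comp)
  have G_mult: "mat_mul n C D \<in> ?G" if CD: "C \<in> ?G" "D \<in> ?G" for C D
  proof -
    obtain C' D' where i: "C' \<in> \<A>" "D' \<in> \<A>" "mat_mul n C C' = mat_one n" "mat_mul n D D' = mat_one n"
      using CD unfolding units_group_def by auto
    have "mat_mul n (mat_mul n C D) (mat_mul n D' C') = mat_mul n C (mat_mul n (mat_mul n D D') C')"
      unfolding mat_mul_assoc ..
    then have "mat_mul n (mat_mul n C D) (mat_mul n D' C') = mat_one n"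
      unfolding i(4) mat_mul_one_left[OF \<A>_Mn[OF i(1)]] i(3) .
    moreover from this have "mat_mul n (mat_mul n D' C') (mat_mul n C D) = mat_one n"
      by (rule mat_left_inverse_imp_right)
    ultimately show ?thesis
      using CD i mat_mul_in unfolding units_group_def by auto
  qed
  have "\<Psi> \<in> hom (aut_group g) (units_group n \<A>)"
  proof (rule homI)
    fix \<sigma> assume "\<sigma> \<in> carrier (aut_group g)"
    then show "\<Psi> \<sigma> \<in> ?G" using \<Psi> unfolding aut_group_def by auto
  next
    fix \<sigma> \<tau> assume "\<sigma> \<in> carrier (aut_group g)" "\<tau> \<in> carrier (aut_group g)"
    then have \<sigma>: "\<sigma> \<in> Aut g" and \<tau>: "\<tau> \<in> Aut g" unfolding aut_group_def by auto
    have "mat_mul n (mmap (hh g) (mat_mul n (\<Psi> \<sigma>) (\<Psi> \<tau>))) (mmap (\<sigma> \<circ> \<tau>) ?U)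
      = mat_mul n (mmap (hh g) (\<Psi> \<sigma>)) (mat_mul n (mmap \<sigma> (mmap (hh g) (\<Psi> \<tau>))) (mmap \<sigma> (mmap \<tau> ?U)))"
      unfolding mmap_mat_mul[OF h] mat_mul_assoc mmap_fix[OF \<sigma>] by simp
    also have "\<dots> = ?U"
      unfolding mmap_mat_mul[OF aut(1)[OF \<sigma>], symmetric] using \<Psi>[OF \<sigma>] \<Psi>[OF \<tau>] by simp
    finally have "mat_mul n (\<Psi> \<sigma>) (\<Psi> \<tau>) = \<Psi> (\<sigma> \<circ> \<tau>)"
      using \<Psi>[OF \<sigma>] \<Psi>[OF \<tau>] \<Psi>[OF Aut_comp[OF \<sigma> \<tau>]] G_mult Aut_comp[OF \<sigma> \<tau>]
      by (intro uniq[of "\<sigma> \<circ> \<tau>"]) auto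
    then show "\<Psi> (\<sigma> \<otimes>\<^bsub>aut_group g\<^esub> \<tau>) = \<Psi> \<sigma> \<otimes>\<^bsub>units_group n \<A>\<^esub> \<Psi> \<tau>"
      unfolding aut_group_def units_group_def by simp
  qed
  moreover have "bij_betw \<Psi> (carrier (aut_group g)) ?G"
    unfolding bij_betw_def
  proof
    show "inj_on \<Psi> (carrier (aut_group g))"
    proof (rule inj_onI)
      fix \<sigma> \<tau> assume "\<sigma> \<in> carrier (aut_group g)" "\<tau> \<in> carrier (aut_group g)" and eq: "\<Psi> \<sigma> = \<Psi> \<tau>"
      then have \<sigma>: "\<sigma> \<in> Aut g" and \<tau>: "\<tau> \<in> Aut g" unfolding aut_group_def by auto
      obtain D where D: "mat_mul n D (\<Psi> \<sigma>) = mat_one n" using \<Psi>[OF \<sigma>] unfolding units_group_def by auto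
      have "mmap \<sigma> ?U = mmap \<tau> ?U"
      proof (rule mat_mul_left_cancel)
        show "mat_mul n (mmap (hh g) D) (mmap (hh g) (\<Psi> \<sigma>)) = mat_one n"
          unfolding mmap_mat_mul[OF h, symmetric] D mmap_mat_one[OF h] ..
        show "mat_mul n (mmap (hh g) (\<Psi> \<sigma>)) (mmap \<sigma> ?U) = mat_mul n (mmap (hh g) (\<Psi> \<sigma>)) (mmap \<tau> ?U)"
          using \<Psi>[OF \<sigma>] \<Psi>[OF \<tau>] eq by simp
      qed (use mmap_Mn[OF aut(1)[OF \<sigma>] emb_Mn[OF h]] mmap_Mn[OF aut(1)[OF \<tau>] emb_Mn[OF h]] in auto)
      then have "emb (hh g) (\<lambda>i. \<sigma> (u i)) = emb (hh g) (\<lambda>i. \<tau> (u i))" using emb\<sigma>[OF \<sigma>] emb\<sigma>[OF \<tau>] by simp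
      then show "\<sigma> = \<tau>"
        using aut(3)[OF \<sigma>] aut(3)[OF \<tau>] emb_inj'[OF h]
        by (intro rat_fun_hom_unique[OF rat[OF u] aut(1)[OF \<sigma>] aut(1)[OF \<tau>]]) auto
    qed
    show "\<Psi> ` carrier (aut_group g) = ?G"
    proof (intro equalityI subsetI)
      fix C assume "C \<in> \<Psi> ` carrier (aut_group g)"
      then show "C \<in> ?G" using \<Psi> unfolding aut_group_def by auto
    next
      fix C assume C: "C \<in> ?G"
      obtain u' w' where u': "solution g u' w'" "mat_mul n (mmap (hh g) C) (emb (hh g) u') = ?U"
        using solution_translate[OF g u C] by blast
      \<comment> \<open>Both coordinate vectors are independent generators over the coefficient
        field, so u can be substituted by u'. The substitution fixes each \<open>t i\<close>,
        because the generic matrix is \<open>U^(-1) U^(q)\<close> for either solution; hence it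
        fixes all of K. Exchanging u and u' gives its inverse.\<close>
      have ex: "\<exists>\<sigma>. field_hom \<sigma> \<and> (\<forall>x. \<sigma> (g x) = g x) \<and> (\<forall>i<m. \<sigma> (u i) = u' i)"
        if u: "solution g u w" and u': "solution g u' w'" for u w u' w'
      proof -
        obtain \<sigma> where \<sigma>: "field_hom \<sigma>" "\<And>c. \<sigma> ((g \<circ> eK) c) = (g \<circ> eK) c" "\<And>i. i < m \<Longrightarrow> \<sigma> (u i) = u' i"
          using rat_fun_hom_exists[OF rat[OF u] geK solution_indep[OF g u']] by blast
        have e: "mmap \<sigma> (emb (hh g) x) = emb (hh g) (\<lambda>i. \<sigma> (x i))" for x
        proof -
          have "\<sigma> \<circ> hh g = hh g" using \<sigma>(2) by auto
          then show ?thesis unfolding mmap_emb[OF \<sigma>(1)] by simp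
        qed
        have \<sigma>u: "mmap \<sigma> (emb (hh g) u) = emb (hh g) u'" unfolding e by (rule emb_cong) (rule \<sigma>(3))
        have "emb (hh g) (\<lambda>i. \<sigma> (g (t i))) = emb (hh g) (\<lambda>i. g (t i))"
        proof (rule mat_mul_left_cancel)
          show "mat_mul n (emb (hh g) w') (emb (hh g) u') = mat_one n" using u' unfolding solution_def by blast
          have "mat_mul n (emb (hh g) u') (emb (hh g) (\<lambda>i. \<sigma> (g (t i)))) = mmap \<sigma> (mat_mul n (emb (hh g) u) (emb (hh g) (\<lambda>i. g (t i))))"
            unfolding mmap_mat_mul[OF \<sigma>(1)] \<sigma>u e ..
          also have "\<dots> = mmap \<sigma> (mpow q (emb (hh g) u))" using u unfolding solution_def by simp
          also have "\<dots> = mpow q (emb (hh g) u')"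
            by (simp only: field_hom_power[OF \<sigma>(1)] fun_cong[OF fun_cong[OF \<sigma>u]])
          also have "\<dots> = mat_mul n (emb (hh g) u') (emb (hh g) (\<lambda>i. g (t i)))"
            using u' unfolding solution_def by simp
          finally show "mat_mul n (emb (hh g) u') (emb (hh g) (\<lambda>i. \<sigma> (g (t i)))) = mat_mul n (emb (hh g) u') (emb (hh g) (\<lambda>i. g (t i)))" .
        qed (auto simp: emb_Mn[OF h])
        then have "\<sigma> (g (t i)) = g (t i)" if "i < m" for i using emb_inj'[OF h] that by blast
        then have "\<sigma> \<circ> g = g"
          using \<sigma>(2) by (intro rat_fun_hom_unique[OF t field_hom_comp[OF \<sigma>(1) g] g]) auto
        then have "\<forall>x. \<sigma> (g x) = g x" by (metis comp_apply)
        then show ?thesis using \<sigma> by blast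
      qed
      obtain \<sigma> where \<sigma>: "field_hom \<sigma>" "\<And>x. \<sigma> (g x) = g x" "\<And>i. i < m \<Longrightarrow> \<sigma> (u i) = u' i"
        using ex[OF u u'(1)] by blast
      obtain \<tau> where \<tau>: "field_hom \<tau>" "\<And>x. \<tau> (g x) = g x" "\<And>i. i < m \<Longrightarrow> \<tau> (u' i) = u i"
        using ex[OF u'(1) u] by blast
      have id: "field_hom (id :: 'e \<Rightarrow> 'e)" by (simp add: field_hom_def)
      have "\<tau> \<circ> \<sigma> = id"
        using \<sigma> \<tau> by (intro rat_fun_hom_unique[OF rat[OF u] field_hom_comp[OF \<tau>(1) \<sigma>(1)] id]) auto
      moreover have "\<sigma> \<circ> \<tau> = id"
        using \<sigma> \<tau> by (intro rat_fun_hom_unique[OF rat[OF u'(1)] field_hom_comp[OF \<sigma>(1) \<tau>(1)] id]) auto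
      ultimately have "bij \<sigma>" by (rule o_bij)
      then have A: "\<sigma> \<in> Aut g" unfolding Aut_def using \<sigma> by blast
      have "mmap \<sigma> ?U = emb (hh g) u'" unfolding emb\<sigma>[OF A, symmetric] by (rule emb_cong) (rule \<sigma>(3))
      then have "C = \<Psi> \<sigma>" using \<Psi>[OF A] C u'(2) by (intro uniq[OF A]) auto
      then show "C \<in> \<Psi> ` carrier (aut_group g)" using A unfolding aut_group_def by auto
    qed
  qed
  ultimately have "\<Psi> \<in> iso (aut_group g) (units_group n \<A>)" unfolding iso_def by blast
  then show ?thesis unfolding is_iso_def by blast
qed

end

section \<open>Galois descent\<close>

text \<open>The product of the functions \<open>\<sigma> \<mapsto> (\<sigma> s - \<tau> s) / (s - \<tau> s)\<close> is \<open>1\<close> at the identity and vanishes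
  at all other \<open>\<tau>\<close>. It is a combination of evaluations, so a property of coefficient functions that
  is stable under them passes from the constant function \<open>1\<close> to this delta function.\<close>

lemma delta_function:
  fixes Q :: "(('a::field \<Rightarrow> 'a) \<Rightarrow> 'a) \<Rightarrow> bool"
  assumes "finite T" and one: "Q (\<lambda>_. 1)"
    and add: "\<And>\<phi> \<psi>. Q \<phi> \<Longrightarrow> Q \<psi> \<Longrightarrow> Q (\<lambda>\<sigma>. \<phi> \<sigma> + \<psi> \<sigma>)"
    and eval: "\<And>\<phi> s. Q \<phi> \<Longrightarrow> s \<in> S \<Longrightarrow> Q (\<lambda>\<sigma>. \<sigma> s * \<phi> \<sigma>)"
    and scale: "\<And>\<phi> d. Q \<phi> \<Longrightarrow> d \<in> S \<Longrightarrow> Q (\<lambda>\<sigma>. d * \<phi> \<sigma>)"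
    and S: "is_subfield S"
    and sep: "\<And>\<tau>. \<tau> \<in> T \<Longrightarrow> \<exists>s\<in>S. \<tau> s \<in> S \<and> \<tau> s \<noteq> s"
  shows "\<exists>\<phi>. Q \<phi> \<and> \<phi> id = 1 \<and> (\<forall>\<tau>\<in>T. \<phi> \<tau> = 0)"
  using \<open>finite T\<close> sep
proof (induction T rule: finite_induct)
  case empty
  then show ?case using one by auto
next
  case (insert \<tau> T)
  then have "\<exists>\<phi>. Q \<phi> \<and> \<phi> id = 1 \<and> (\<forall>\<tau>\<in>T. \<phi> \<tau> = 0)" by blast
  then obtain \<phi> where \<phi>: "Q \<phi>" "\<phi> id = 1" "\<forall>\<tau>\<in>T. \<phi> \<tau> = 0" by blast
  obtain s where s: "s \<in> S" "\<tau> s \<in> S" "\<tau> s \<noteq> s" using insert.prems by blast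
  define d where "d = inverse (s - \<tau> s)"
  have d: "d \<in> S" unfolding d_def using s is_subfield_diff[OF S] is_subfieldD(6)[OF S] by blast
  then have "- \<tau> s * d \<in> S" using is_subfieldD(4,5)[OF S] s by blast
  from add[OF scale[OF eval[OF \<phi>(1) s(1)] d] scale[OF \<phi>(1) this]]
  have "Q (\<lambda>\<sigma>. d * (\<sigma> s * \<phi> \<sigma>) + - \<tau> s * d * \<phi> \<sigma>)" .
  moreover have "d * (id s * \<phi> id) + - \<tau> s * d * \<phi> id = 1"
  proof -
    have "d * (s - \<tau> s) = 1" unfolding d_def using s(3) by simp
    then show ?thesis using \<phi>(2) by (simp add: algebra_simps)
  qed
  moreover have "\<forall>\<tau>'\<in>insert \<tau> T. d * (\<tau>' s * \<phi> \<tau>') + - \<tau> s * d * \<phi> \<tau>' = 0"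
    using \<phi>(3) by (auto simp: algebra_simps)
  ultimately show ?case by blast
qed

section \<open>The twisted action of the Galois group on the extended algebra\<close>

locale twisted_galois = matrix_algebra \<A> n m v
  for \<A> :: "(nat \<Rightarrow> nat \<Rightarrow> 'f::{finite,field}) set" and n m :: nat and v +
  fixes eM :: "'l::field \<Rightarrow> 'm::field" and hL :: "'f \<Rightarrow> 'l" and \<phi> :: "('m \<Rightarrow> 'm) \<Rightarrow> nat \<Rightarrow> nat \<Rightarrow> 'f"
  assumes galois: "galois_ext eM" and hL: "field_hom hL"
    and \<phi>: "\<phi> \<in> iso (aut_group eM) (units_group n \<A>)"
begin

abbreviation h :: "'f \<Rightarrow> 'm" where "h \<equiv> eM \<circ> hL"

lemma eM: "field_hom eM" using galois unfolding galois_ext_def by blast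

lemma h: "field_hom h" by (rule field_hom_comp[OF eM hL])

lemma fixed_in_range: "(\<And>\<sigma>. \<sigma> \<in> Aut eM \<Longrightarrow> \<sigma> x = x) \<Longrightarrow> x \<in> range eM"
  using galois unfolding galois_ext_def by blast

lemma autD: "\<sigma> \<in> Aut eM \<Longrightarrow> field_hom \<sigma>" "\<sigma> \<in> Aut eM \<Longrightarrow> bij \<sigma>" "\<sigma> \<in> Aut eM \<Longrightarrow> \<sigma> (eM x) = eM x"
  unfolding Aut_def by auto

lemma Aut_comp: "\<sigma> \<in> Aut eM \<Longrightarrow> \<tau> \<in> Aut eM \<Longrightarrow> \<sigma> \<circ> \<tau> \<in> Aut eM"
  using field_hom_comp unfolding Aut_def by (auto intro: bij_comp)

lemma id_Aut: "id \<in> Aut eM"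
  unfolding Aut_def by (auto simp: field_hom_def)

lemma \<phi>_bij: "bij_betw \<phi> (Aut eM) (carrier (units_group n \<A>))"
  using \<phi> unfolding iso_def aut_group_def by auto

lemma \<phi>_mult: "\<sigma> \<in> Aut eM \<Longrightarrow> \<tau> \<in> Aut eM \<Longrightarrow> \<phi> (\<sigma> \<circ> \<tau>) = mat_mul n (\<phi> \<sigma>) (\<phi> \<tau>)"
  using \<phi> hom_mult[of \<phi> "aut_group eM" "units_group n \<A>" \<sigma> \<tau>]
  unfolding iso_def aut_group_def units_group_def by auto

lemma \<phi>_unit: "\<sigma> \<in> Aut eM \<Longrightarrow> \<phi> \<sigma> \<in> carrier (units_group n \<A>)"
  using \<phi>_bij unfolding bij_betw_def by blast

lemma \<phi>_in: "\<sigma> \<in> Aut eM \<Longrightarrow> \<phi> \<sigma> \<in> \<A>"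
  using \<phi>_unit unfolding units_group_def by auto

lemma \<phi>_inverse: "\<sigma> \<in> Aut eM \<Longrightarrow> \<exists>D\<in>\<A>. mat_mul n D (\<phi> \<sigma>) = mat_one n \<and> mat_mul n (\<phi> \<sigma>) D = mat_one n"
  using \<phi>_unit unfolding units_group_def by auto

lemma \<phi>_id: "\<phi> id = mat_one n"
proof -
  obtain D where D: "mat_mul n D (\<phi> id) = mat_one n" using \<phi>_inverse[OF id_Aut] by blast
  have "mat_mul n (\<phi> id) (\<phi> id) = mat_mul n (\<phi> id) (mat_one n)"
    using \<phi>_mult[OF id_Aut id_Aut] by (simp add: mat_mul_one_right[OF \<A>_Mn[OF \<phi>_in[OF id_Aut]]])
  then show ?thesis
    by (rule mat_mul_left_cancel[OF D \<A>_Mn[OF \<phi>_in[OF id_Aut]] mat_one_Mn])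
qed

lemma \<phi>_eq_one: "\<sigma> \<in> Aut eM \<Longrightarrow> \<phi> \<sigma> = mat_one n \<Longrightarrow> \<sigma> = id"
  using \<phi>_bij \<phi>_id id_Aut unfolding bij_betw_def inj_on_def by metis

lemma finite_Aut: "finite (Aut eM)"
proof -
  have "finite (carrier (units_group n \<A>))"
    using finite_\<A> unfolding units_group_def by simp
  then show ?thesis using bij_betw_finite[OF \<phi>_bij] by blast
qed

lemma sum_Aut_translate: "\<tau> \<in> Aut eM \<Longrightarrow> (\<Sum>\<sigma>\<in>Aut eM. f (\<tau> \<circ> \<sigma>)) = (\<Sum>\<sigma>\<in>Aut eM. f \<sigma>)"
proof -
  assume \<tau>: "\<tau> \<in> Aut eM"
  have inj: "inj_on (\<lambda>\<sigma>. \<tau> \<circ> \<sigma>) (Aut eM)"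
    using autD(2)[OF \<tau>] by (intro inj_onI) (metis bij_is_inj fun.inj_map injD)
  have "(\<lambda>\<sigma>. \<tau> \<circ> \<sigma>) ` Aut eM = Aut eM"
    using Aut_comp[OF \<tau>] by (intro endo_inj_surj[OF finite_Aut _ inj]) auto
  then show ?thesis using sum.reindex[OF inj, of f] by (simp add: o_def)
qed

definition cc :: "('m \<Rightarrow> 'm) \<Rightarrow> nat \<Rightarrow> 'f" where
  "cc \<sigma> = (SOME c. \<phi> \<sigma> = (\<lambda>r s. \<Sum>i<m. c i * v i r s))"

lemma cc: "\<sigma> \<in> Aut eM \<Longrightarrow> \<phi> \<sigma> = (\<lambda>r s. \<Sum>i<m. cc \<sigma> i * v i r s)"
proof -
  assume "\<sigma> \<in> Aut eM"
  then have "\<exists>c. \<phi> \<sigma> = (\<lambda>r s. \<Sum>i<m. c i * v i r s)" by (rule \<A>_coordsE[OF \<phi>_in]) (rule exI)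
  from someI_ex[OF this] show ?thesis unfolding cc_def .
qed

text \<open>In matrix form this is U to \<open>\<phi> \<sigma>\<close> times the conjugate of U, a
  semilinear action. Its fixed points carry the cocycle that solutions of the generic equation
  have.\<close>

definition act :: "('m \<Rightarrow> 'm) \<Rightarrow> (nat \<Rightarrow> 'm) \<Rightarrow> nat \<Rightarrow> 'm" where
  "act \<sigma> x = mulc h (\<lambda>i. h (cc \<sigma> i)) (\<lambda>i. \<sigma> (x i))"

lemma mmap_aut: "\<sigma> \<in> Aut eM \<Longrightarrow> mmap \<sigma> (emb h x) = emb h (\<lambda>i. \<sigma> (x i))"
proof -
  assume \<sigma>: "\<sigma> \<in> Aut eM"
  have "\<sigma> \<circ> h = h" using autD(3)[OF \<sigma>] by (auto simp: fun_eq_iff)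
  then show ?thesis unfolding mmap_emb[OF autD(1)[OF \<sigma>]] by simp
qed

lemma emb_act: "\<sigma> \<in> Aut eM \<Longrightarrow> emb h (act \<sigma> x) = mat_mul n (mmap h (\<phi> \<sigma>)) (mmap \<sigma> (emb h x))"
  unfolding act_def emb_mulc[OF h] emb_combination[OF h] mmap_aut
  using arg_cong[OF cc, of \<sigma> "mmap h"] by (simp only:)

lemma act_coords [simp]: "act \<sigma> x \<in> coords m" unfolding act_def by simp

lemma act_add: "\<sigma> \<in> Aut eM \<Longrightarrow> act \<sigma> (x + y) = act \<sigma> x + act \<sigma> y"
  unfolding act_def mulc_def by (auto simp: fun_eq_iff field_homD(3)[OF autD(1)] distrib_left sum.distrib)

lemma act_scale: "\<sigma> \<in> Aut eM \<Longrightarrow> act \<sigma> (\<lambda>i. c * x i) = (\<lambda>i. \<sigma> c * act \<sigma> x i)"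
  unfolding act_def mulc_def by (auto simp: fun_eq_iff field_homD(4)[OF autD(1)] sum_distrib_left mult_ac)

lemma act_sum: "\<sigma> \<in> Aut eM \<Longrightarrow> act \<sigma> (sum f I) = (\<Sum>i\<in>I. act \<sigma> (f i))"
proof (induction I rule: infinite_finite_induct)
  case (insert i I)
  then show ?case unfolding sum.insert[OF insert.hyps] act_add[OF insert.prems] by simp
qed (auto simp: act_def mulc_def fun_eq_iff field_homD(1)[OF autD(1)])

text \<open>The constants \<open>\<phi> \<sigma>\<close> come from the finite field and are fixed by
  every automorphism, so the cocycle condition is just multiplicativity of
  \<open>\<phi>\<close>.\<close>

lemma act_comp:
  assumes \<sigma>: "\<sigma> \<in> Aut eM" and \<tau>: "\<tau> \<in> Aut eM"
  shows "act \<tau> (act \<sigma> x) = act (\<tau> \<circ> \<sigma>) x"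
proof (rule emb_inj[OF h act_coords act_coords])
  have fxd: "mmap \<tau> (mmap h C) = mmap h C" for C :: "nat \<Rightarrow> nat \<Rightarrow> 'f" using autD(3)[OF \<tau>] by simp
  have "emb h (act \<tau> (act \<sigma> x)) = mat_mul n (mmap h (\<phi> \<tau>)) (mmap \<tau> (mat_mul n (mmap h (\<phi> \<sigma>)) (mmap \<sigma> (emb h x))))"
    unfolding emb_act[OF \<tau>] emb_act[OF \<sigma>] ..
  also have "\<dots> = mat_mul n (mmap h (\<phi> \<tau>)) (mat_mul n (mmap h (\<phi> \<sigma>)) (mmap \<tau> (mmap \<sigma> (emb h x))))"
    unfolding mmap_mat_mul[OF autD(1)[OF \<tau>]] fxd ..
  also have "\<dots> = emb h (act (\<tau> \<circ> \<sigma>) x)"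
    unfolding emb_act[OF Aut_comp[OF \<tau> \<sigma>]] \<phi>_mult[OF \<tau> \<sigma>] mmap_mat_mul[OF h] mat_mul_assoc by simp
  finally show "emb h (act \<tau> (act \<sigma> x)) = emb h (act (\<tau> \<circ> \<sigma>) x)" .
qed

lemma act_id: "x \<in> coords m \<Longrightarrow> act id x = x"
  by (rule emb_inj[OF h act_coords])
    (simp_all add: emb_act[OF id_Aut] \<phi>_id mmap_mat_one[OF h, unfolded comp_def] mat_mul_one_left[OF emb_Mn[OF h]])

definition fixed_points where
  "fixed_points = {x\<in>coords m. \<forall>\<sigma>\<in>Aut eM. act \<sigma> x = x}"

text \<open>The twisted trace of any vector is fixed. Replacing x by \<open>s\<close> times x
  weights the summands by \<sigma>(s), so \<open>delta_function\<close> applies; with the delta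
  function as weight the sum is x itself.\<close>

lemma coords_subset_span_fixed: "coords m \<subseteq> fs.span fixed_points"
proof
  fix x :: "nat \<Rightarrow> 'm" assume x: "x \<in> coords m"
  define Q where "Q \<psi> \<longleftrightarrow> (\<forall>x\<in>coords m. (\<Sum>\<sigma>\<in>Aut eM. (\<lambda>i. \<psi> \<sigma> * act \<sigma> x i)) \<in> fs.span fixed_points)" for \<psi>
  have "\<exists>\<psi>. Q \<psi> \<and> \<psi> id = 1 \<and> (\<forall>\<tau>\<in>Aut eM - {id}. \<psi> \<tau> = 0)"
  proof (rule delta_function[where S = UNIV])
    show "finite (Aut eM - {id})" using finite_Aut by simp
    show "is_subfield (UNIV :: 'm set)" unfolding is_subfield_def by simp
    show "\<exists>s\<in>UNIV. \<tau> s \<in> UNIV \<and> \<tau> s \<noteq> s" if "\<tau> \<in> Aut eM - {id}" for \<tau>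
      using that by (auto simp: fun_eq_iff)
    show "Q (\<lambda>_. 1)"
      unfolding Q_def
    proof (intro ballI fs.span_base)
      fix x :: "nat \<Rightarrow> 'm" assume x: "x \<in> coords m"
      have eq: "(\<Sum>\<sigma>\<in>Aut eM. (\<lambda>i. 1 * act \<sigma> x i)) = (\<Sum>\<sigma>\<in>Aut eM. act \<sigma> x)" by simp
      have "act \<tau> (\<Sum>\<sigma>\<in>Aut eM. act \<sigma> x) = (\<Sum>\<sigma>\<in>Aut eM. act \<sigma> x)" if \<tau>: "\<tau> \<in> Aut eM" for \<tau>
      proof -
        have "act \<tau> (\<Sum>\<sigma>\<in>Aut eM. act \<sigma> x) = (\<Sum>\<sigma>\<in>Aut eM. act (\<tau> \<circ> \<sigma>) x)"
          unfolding act_sum[OF \<tau>] using act_comp[OF _ \<tau>] by (intro sum.cong refl) blast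
        then show ?thesis unfolding sum_Aut_translate[OF \<tau>, of "\<lambda>\<sigma>. act \<sigma> x"] .
      qed
      moreover have "(\<Sum>\<sigma>\<in>Aut eM. act \<sigma> x) \<in> coords m"
        by (intro fs.subspace_sum[OF subspace_coords]) simp
      ultimately show "(\<Sum>\<sigma>\<in>Aut eM. (\<lambda>i. 1 * act \<sigma> x i)) \<in> fixed_points"
        unfolding eq fixed_points_def by blast
    qed
    show "Q (\<lambda>\<sigma>. \<psi> \<sigma> + \<psi>' \<sigma>)" if "Q \<psi>" "Q \<psi>'" for \<psi> \<psi>'
      unfolding Q_def
    proof
      fix x :: "nat \<Rightarrow> 'm" assume x: "x \<in> coords m"
      have "(\<Sum>\<sigma>\<in>Aut eM. (\<lambda>i. \<psi> \<sigma> * act \<sigma> x i)) + (\<Sum>\<sigma>\<in>Aut eM. (\<lambda>i. \<psi>' \<sigma> * act \<sigma> x i)) \<in> fs.span fixed_points"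
        using that x unfolding Q_def by (intro fs.span_add) auto
      moreover have "(\<Sum>\<sigma>\<in>Aut eM. (\<lambda>i. \<psi> \<sigma> * act \<sigma> x i)) + (\<Sum>\<sigma>\<in>Aut eM. (\<lambda>i. \<psi>' \<sigma> * act \<sigma> x i))
        = (\<Sum>\<sigma>\<in>Aut eM. (\<lambda>i. (\<psi> \<sigma> + \<psi>' \<sigma>) * act \<sigma> x i))"
        unfolding sum.distrib[symmetric] by (intro sum.cong refl) (auto simp: fun_eq_iff distrib_right)
      ultimately show "(\<Sum>\<sigma>\<in>Aut eM. (\<lambda>i. (\<psi> \<sigma> + \<psi>' \<sigma>) * act \<sigma> x i)) \<in> fs.span fixed_points" by simp
    qed
    show "Q (\<lambda>\<sigma>. d * \<psi> \<sigma>)" if "Q \<psi>" for \<psi> d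
      unfolding Q_def
    proof
      fix x :: "nat \<Rightarrow> 'm" assume x: "x \<in> coords m"
      have "(\<lambda>i. d * (\<Sum>\<sigma>\<in>Aut eM. (\<lambda>i. \<psi> \<sigma> * act \<sigma> x i)) i) \<in> fs.span fixed_points"
        using that x unfolding Q_def by (intro fs.span_scale) auto
      moreover have "(\<lambda>i. d * (\<Sum>\<sigma>\<in>Aut eM. (\<lambda>i. \<psi> \<sigma> * act \<sigma> x i)) i) = (\<Sum>\<sigma>\<in>Aut eM. (\<lambda>i. d * \<psi> \<sigma> * act \<sigma> x i))"
        by (rule ext) (simp only: sum_fun_apply sum_distrib_left mult.assoc)
      ultimately show "(\<Sum>\<sigma>\<in>Aut eM. (\<lambda>i. d * \<psi> \<sigma> * act \<sigma> x i)) \<in> fs.span fixed_points" by simp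
    qed
    show "Q (\<lambda>\<sigma>. \<sigma> s * \<psi> \<sigma>)" if "Q \<psi>" for \<psi> s
      unfolding Q_def
    proof
      fix x :: "nat \<Rightarrow> 'm" assume x: "x \<in> coords m"
      then have sx: "(\<lambda>i. s * x i) \<in> coords m" unfolding coords_def by simp
      have eq: "(\<Sum>\<sigma>\<in>Aut eM. (\<lambda>i. \<psi> \<sigma> * act \<sigma> (\<lambda>i. s * x i) i)) = (\<Sum>\<sigma>\<in>Aut eM. (\<lambda>i. \<sigma> s * \<psi> \<sigma> * act \<sigma> x i))"
      proof (rule sum.cong[OF refl], rule ext)
        fix \<sigma> i assume \<sigma>: "\<sigma> \<in> Aut eM"
        show "\<psi> \<sigma> * act \<sigma> (\<lambda>i. s * x i) i = \<sigma> s * \<psi> \<sigma> * act \<sigma> x i"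
          unfolding act_scale[OF \<sigma>] by (simp only: mult_ac)
      qed
      show "(\<Sum>\<sigma>\<in>Aut eM. (\<lambda>i. \<sigma> s * \<psi> \<sigma> * act \<sigma> x i)) \<in> fs.span fixed_points"
        using bspec[OF that[unfolded Q_def] sx] unfolding eq .
    qed
  qed
  then obtain \<psi> where \<psi>: "Q \<psi>" "\<psi> id = 1" "\<And>\<tau>. \<tau> \<in> Aut eM - {id} \<Longrightarrow> \<psi> \<tau> = 0" by blast
  have "(\<Sum>\<sigma>\<in>Aut eM. (\<lambda>i. \<psi> \<sigma> * act \<sigma> x i)) i = x i" for i
  proof -
    have "(\<Sum>\<sigma>\<in>Aut eM. (\<lambda>i. \<psi> \<sigma> * act \<sigma> x i)) i = (\<Sum>\<sigma>\<in>{id}. \<psi> \<sigma> * act \<sigma> x i)"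
      unfolding sum_fun_apply using finite_Aut id_Aut \<psi>(3) by (intro sum.mono_neutral_right) auto
    then show ?thesis using \<psi>(2) act_id[OF x] by simp
  qed
  then have eq: "(\<Sum>\<sigma>\<in>Aut eM. (\<lambda>i. \<psi> \<sigma> * act \<sigma> x i)) = x" by (rule ext)
  show "x \<in> fs.span fixed_points" using bspec[OF \<psi>(1)[unfolded Q_def] x] unfolding eq .
qed

text \<open>A conjugate of U is a constant multiple of U, so its entries stay in \<open>S\<close>,
  and only the identity fixes all entries of U. These entries separate automorphisms within
  \<open>S\<close>, so \<open>delta_function\<close> turns the trace into an expression of every
  element with values in \<open>S\<close>.\<close>

lemma generated_by_fixed_point:
  assumes S: "is_subfield S" "range eM \<subseteq> S" and x: "x \<in> fixed_points"
    and inv: "mat_mul n (emb h x) W = mat_one n" and entries: "\<And>i j. emb h x i j \<in> S"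
  shows "S = UNIV"
proof -
  let ?U = "emb h x"
  have tw: "mat_mul n (mmap h (\<phi> \<sigma>)) (mmap \<sigma> ?U) = ?U" if "\<sigma> \<in> Aut eM" for \<sigma>
    using x emb_act[OF that, of x] that unfolding fixed_points_def by simp
  define Q where "Q \<psi> \<longleftrightarrow> (\<forall>z. (\<Sum>\<sigma>\<in>Aut eM. \<psi> \<sigma> * \<sigma> z) \<in> S)" for \<psi>
  have "\<exists>\<psi>. Q \<psi> \<and> \<psi> id = 1 \<and> (\<forall>\<tau>\<in>Aut eM - {id}. \<psi> \<tau> = 0)"
  proof (rule delta_function[where S = S, OF _ _ _ _ _ S(1)])
    show "finite (Aut eM - {id})" using finite_Aut by simp
    show "Q (\<lambda>_. 1)"
      unfolding Q_def
    proof
      fix z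
      have "(\<Sum>\<sigma>\<in>Aut eM. \<sigma> z) \<in> range eM"
      proof (rule fixed_in_range)
        fix \<tau> assume \<tau>: "\<tau> \<in> Aut eM"
        show "\<tau> (\<Sum>\<sigma>\<in>Aut eM. \<sigma> z) = (\<Sum>\<sigma>\<in>Aut eM. \<sigma> z)"
          using sum_Aut_translate[OF \<tau>, of "\<lambda>\<sigma>. \<sigma> z"] by (simp add: field_hom_sum[OF autD(1)[OF \<tau>]])
      qed
      then show "(\<Sum>\<sigma>\<in>Aut eM. 1 * \<sigma> z) \<in> S" using S(2) by auto
    qed
    show "Q (\<lambda>\<sigma>. \<psi> \<sigma> + \<psi>' \<sigma>)" if "Q \<psi>" "Q \<psi>'" for \<psi> \<psi>'
      using that is_subfieldD(3)[OF S(1)] unfolding Q_def by (simp add: distrib_right sum.distrib)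
    show "Q (\<lambda>\<sigma>. d * \<psi> \<sigma>)" if "Q \<psi>" "d \<in> S" for \<psi> d
      using that is_subfieldD(4)[OF S(1)] unfolding Q_def by (simp add: mult.assoc sum_distrib_left[symmetric])
    show "Q (\<lambda>\<sigma>. \<sigma> s * \<psi> \<sigma>)" if "Q \<psi>" for \<psi> s
      unfolding Q_def
    proof
      fix z
      have "(\<Sum>\<sigma>\<in>Aut eM. \<sigma> s * \<psi> \<sigma> * \<sigma> z) = (\<Sum>\<sigma>\<in>Aut eM. \<psi> \<sigma> * \<sigma> (s * z))"
        by (intro sum.cong refl) (simp add: field_homD(4)[OF autD(1)] mult_ac)
      then show "(\<Sum>\<sigma>\<in>Aut eM. \<sigma> s * \<psi> \<sigma> * \<sigma> z) \<in> S" using that unfolding Q_def by simp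
    qed
    show "\<exists>s\<in>S. \<tau> s \<in> S \<and> \<tau> s \<noteq> s" if "\<tau> \<in> Aut eM - {id}" for \<tau>
    proof -
      have \<tau>: "\<tau> \<in> Aut eM" and "\<tau> \<noteq> id" using that by auto
      obtain D where D: "D \<in> \<A>" "mat_mul n D (\<phi> \<tau>) = mat_one n" using \<phi>_inverse[OF \<tau>] by blast
      have DU: "mat_mul n (mmap h D) ?U = mmap \<tau> ?U"
      proof -
        have "mat_mul n (mmap h D) ?U = mat_mul n (mat_mul n (mmap h D) (mmap h (\<phi> \<tau>))) (mmap \<tau> ?U)"
          unfolding mat_mul_assoc tw[OF \<tau>] ..
        also have "\<dots> = mmap \<tau> ?U"
          unfolding mmap_mat_mul[OF h, symmetric] D(2) mmap_mat_one[OF h]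
          by (rule mat_mul_one_left[OF mmap_Mn[OF autD(1)[OF \<tau>] emb_Mn[OF h]]])
        finally show ?thesis .
      qed
      have in_S: "\<tau> (?U i j) \<in> S" for i j
      proof -
        have "mat_mul n (mmap h D) ?U i j \<in> S"
          using S(2) entries by (intro is_subfield_mat_mul[OF S(1)]) auto
        then show ?thesis unfolding DU .
      qed
      have "mmap \<tau> ?U \<noteq> ?U"
      proof
        assume fxd: "mmap \<tau> ?U = ?U"
        have "mmap h (\<phi> \<tau>) = mmap h (mat_one n)"
        proof (rule mat_mul_right_cancel[OF inv])
          show "mat_mul n (mmap h (\<phi> \<tau>)) ?U = mat_mul n (mmap h (mat_one n)) ?U"
            using tw[OF \<tau>] unfolding fxd mmap_mat_one[OF h] mat_mul_one_left[OF emb_Mn[OF h]] .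
        qed (intro mmap_Mn[OF h] \<A>_Mn \<phi>_in[OF \<tau>] mat_one_Mn)+
        then have "\<phi> \<tau> = mat_one n" by (rule mmap_inj[OF h])
        then show False using \<phi>_eq_one[OF \<tau>] \<open>\<tau> \<noteq> id\<close> by blast
      qed
      then obtain i j where "\<tau> (?U i j) \<noteq> ?U i j" by (auto simp: fun_eq_iff)
      then show ?thesis using in_S entries by blast
    qed
  qed
  then obtain \<psi> where \<psi>: "Q \<psi>" "\<psi> id = 1" "\<And>\<tau>. \<tau> \<in> Aut eM - {id} \<Longrightarrow> \<psi> \<tau> = 0" by blast
  have "(\<Sum>\<sigma>\<in>Aut eM. \<psi> \<sigma> * \<sigma> z) = z" for z
  proof -
    have "(\<Sum>\<sigma>\<in>Aut eM. \<psi> \<sigma> * \<sigma> z) = (\<Sum>\<sigma>\<in>{id}. \<psi> \<sigma> * \<sigma> z)"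
      using finite_Aut id_Aut \<psi>(3) by (intro sum.mono_neutral_right) auto
    then show ?thesis using \<psi>(2) by simp
  qed
  then show ?thesis using \<psi>(1) unfolding Q_def by (metis UNIV_eq_I)
qed

end

section \<open>Specializing the generic equation\<close>

lemma is_subfield_gen_field: "is_subfield (gen_field R)"
  unfolding gen_field_def is_subfield_def by auto

lemma gen_field_superset: "R \<subseteq> gen_field R"
  unfolding gen_field_def by auto

lemma infinite_range_field_hom: "field_hom h \<Longrightarrow> infinite (UNIV :: 'a set) \<Longrightarrow> infinite (range h)"
  for h :: "'a::field \<Rightarrow> 'b::field"
  using field_hom_inj[of h] finite_imageD by blast

lemma to_ac_field_hom: "field_hom to_ac"
  unfolding field_hom_def by simp

context generic_equation
begin

text \<open>Over the algebraic closure a unit solution u exists, and specializing t to u sends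
  \<open>\<xi>\<close> to \<open>t\<close>. A relation for \<open>\<xi>\<close> thus becomes one for
  \<open>t\<close>.\<close>

lemma \<xi>_alg_indep: "alg_indep m eK \<xi>"
proof -
  let ?g = "to_ac :: 'K \<Rightarrow> 'K alg_closure"
  note g = to_ac_field_hom[where 'a = 'K]
  note geK = field_hom_comp[OF g eK]
  interpret E: frobenius_field "hh ?g" q using hh[OF g] q by unfold_locales
  let ?f = "f_poly q n (\<lambda>i. ?g (a i))"
  have lead: "lead_coeff ?f = 1" by (rule E.lead_coeff_f[OF n_pos])
  then have "?f \<noteq> 0" by auto
  then obtain R where "?f = Polynomial.smult (lead_coeff ?f) (\<Prod>r\<in>#R. [:- r, 1:])"
    using alg_closed_imp_factorization by blast
  then have fR: "?f = (\<Prod>r\<in>#R. [:- r, 1:])" unfolding lead by simp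
  obtain rs where rs: "mset rs = R" using ex_mset by blast
  have "?f = (\<Prod>r\<leftarrow>rs. [:- r, 1:])"
    unfolding fR rs[symmetric] mset_map[symmetric] by (rule prod_mset_prod_list)
  then have "card {y. poly ?f y = 0} = q ^ n"
    using a_0_nonzero by (intro E.card_roots_of_product[OF n_pos]) auto
  then obtain u w where u: "solution ?g u w" using exists_solution[OF g] by blast
  interpret A: specialization m eK "?g \<circ> eK" t u using eK geK by unfold_locales
  show ?thesis
    unfolding alg_indep_def
  proof (intro allI impI)
    fix S c assume S: "finite S \<and> S \<subseteq> exps m \<and> mpeval m eK S c \<xi> = 0"
    have "A.rrel (mpeval m eK S c \<xi>) (mpeval m (?g \<circ> eK) S c (\<lambda>j. ?g (t j)))"
      by (rule A.rrel_mpeval) (rule solution_\<xi>[OF g u])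
    then have "mpeval m (?g \<circ> eK) S c (\<lambda>j. ?g (t j)) = 0" using A.rrel_eq_0[OF t_indep] S by blast
    then have "mpeval m eK S c t = 0" unfolding mpeval_hom[OF g] by simp
    then show "\<forall>\<alpha>\<in>S. c \<alpha> = 0" using t_indep S unfolding alg_indep_def by blast
  qed
qed

lemma nonzero_at_fixed_point:
  fixes eL :: "'k \<Rightarrow> 'l::field" and eM :: "'l \<Rightarrow> 'm::field"
  assumes inf: "infinite (UNIV :: 'k set)" and eL: "field_hom eL"
    and tw: "twisted_galois \<A> n m v eM (eL \<circ> eF) \<phi>"
    and S: "mpeval m eK S c t \<noteq> 0"
  shows "\<exists>x\<in>twisted_galois.fixed_points n m v eM (eL \<circ> eF) \<phi>. mpeval m (eM \<circ> eL) S c x \<noteq> 0"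
proof -
  interpret T: twisted_galois \<A> n m v eM "eL \<circ> eF" \<phi> by (rule tw)
  let ?g = "eM \<circ> eL"
  have g: "field_hom ?g" by (rule field_hom_comp[OF T.eM eL])
  \<comment> \<open>The given point \<open>t\<close> has no counterpart in the Galois extension, so
    it is first replaced by a point over the infinite field k, which can be mapped there.\<close>
  have "\<exists>y. (\<forall>i<m. y i \<in> range eK) \<and> (\<forall>i\<ge>m. y i = t i) \<and> mpeval m eK S c y \<noteq> 0"
  proof (rule nonvanishing_point[where g = "mpeval m eK S c", OF _ infinite_range_field_hom[OF eK inf] S])
    fix i :: nat and y :: "nat \<Rightarrow> 'K"
    show "\<exists>p. \<forall>z. mpeval m eK S c (y(i := z)) = poly p z"
      by (rule mpeval_poly[where p = "\<lambda>j. if j = i then [:0, 1:] else [:y j:]"]) auto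
  qed
  then obtain y where y: "\<forall>i<m. y i \<in> range eK" "mpeval m eK S c y \<noteq> 0" by blast
  then have "\<forall>i\<in>{..<m}. \<exists>c. y i = eK c" by blast
  from bchoice[OF this] obtain y0 where y0: "\<And>i. i < m \<Longrightarrow> y i = eK (y0 i)" by auto
  have id: "field_hom (id :: 'k \<Rightarrow> 'k)" by (simp add: field_hom_def)
  have "mpeval m eK S c y = mpeval m (eK \<circ> id) S c (\<lambda>i. eK (y0 i))"
    by (simp add: mpeval_cong[of m y "\<lambda>i. eK (y0 i)", OF y0])
  also have "\<dots> = eK (mpeval m id S c y0)" by (rule mpeval_hom[OF eK])
  finally have "mpeval m id S c y0 \<noteq> 0" using y(2) by (auto simp: field_homD[OF eK])
  then have "mpeval m (?g \<circ> id) S c (\<lambda>i. ?g (y0 i)) \<noteq> 0"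
    unfolding mpeval_hom[OF g] by (simp add: field_hom_eq_0_iff[OF g, unfolded comp_def])
  define x1 where "x1 = (\<lambda>i. if i < m then ?g (y0 i) else 0)"
  have "mpeval m (?g \<circ> id) S c (\<lambda>i. ?g (y0 i)) = mpeval m ?g S c x1"
    unfolding comp_id by (rule mpeval_cong) (simp add: x1_def)
  then have x1: "mpeval m ?g S c x1 \<noteq> 0"
    using \<open>mpeval m (?g \<circ> id) S c (\<lambda>i. ?g (y0 i)) \<noteq> 0\<close> by simp
  have x1c: "x1 \<in> coords m" unfolding coords_def x1_def by simp
  obtain B where B: "B \<subseteq> T.fixed_points" "fs.independent B" "T.fixed_points \<subseteq> fs.span B"
    using fs.maximal_independent_subset[of T.fixed_points] by blast
  let ?E = "(\<lambda>i j. if j = i then 1 else 0 :: 'm) ` {..<m}"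
  have "coords m \<subseteq> fs.span ?E"
  proof
    fix x :: "nat \<Rightarrow> 'm" assume x: "x \<in> coords m"
    have "(\<Sum>i<m. (\<lambda>j. x i * (if j = i then 1 else 0))) = x"
    proof
      fix j
      show "(\<Sum>i<m. (\<lambda>j. x i * (if j = i then 1 else 0))) j = x j"
        using x unfolding sum_fun_apply coords_def
        by (cases "j < m") (auto simp: if_distrib[where f = "\<lambda>x. _ * x"] cong: if_cong)
    qed
    moreover have "(\<Sum>i<m. (\<lambda>j. x i * (if j = i then 1 else 0))) \<in> fs.span ?E"
      by (intro fs.span_sum fs.span_scale fs.span_base) auto
    ultimately show "x \<in> fs.span ?E" by simp
  qed
  moreover have "B \<subseteq> coords m" using B(1) unfolding T.fixed_points_def by blast
  ultimately have finB: "finite B"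
    using fs.independent_span_bound[OF _ B(2), of ?E] by blast
  have "coords m \<subseteq> fs.span B"
    using T.coords_subset_span_fixed fs.span_minimal[OF B(3) fs.subspace_span] by blast
  then obtain k where k: "x1 = (\<Sum>b\<in>B. (\<lambda>i. k b * b i))"
    using x1c fs.span_finite[OF finB] by blast
  obtain b where b: "bij_betw b {..<card B} B"
    using ex_bij_betw_nat_finite[OF finB] unfolding lessThan_atLeast0 by blast
  \<comment> \<open>The point is now a combination of fixed points with coefficients in the top
    field. The coefficients are moved one at a time into the infinite base field L, and combinations
    with coefficients there are again fixed.\<close>
  define P where "P z = (\<Sum>i<card B. (\<lambda>j. z i * b i j))" for z
  have "x1 = P (\<lambda>i. k (b i))"
    unfolding k P_def using sum.reindex_bij_betw[OF b, of "\<lambda>b i. k b * b i"] by simp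
  then have nz: "mpeval m ?g S c (P (\<lambda>i. k (b i))) \<noteq> 0" using x1 by simp
  have infL: "infinite (range eM)"
    using infinite_range_field_hom[OF T.eM] infinite_range_field_hom[OF eL inf] finite_subset[OF subset_UNIV] by blast
  have "\<exists>z. (\<forall>i<card B. z i \<in> range eM) \<and> (\<forall>i\<ge>card B. z i = k (b i)) \<and> mpeval m ?g S c (P z) \<noteq> 0"
  proof (rule nonvanishing_point[where g = "\<lambda>z. mpeval m ?g S c (P z)", OF _ infL nz])
    fix i :: nat and z :: "nat \<Rightarrow> 'm" assume i: "i < card B"
    show "\<exists>p. \<forall>s. mpeval m ?g S c (P (z(i := s))) = poly p s"
    proof (rule mpeval_poly[where f = "\<lambda>s. P (z(i := s))" and p = "\<lambda>j. \<Sum>l<card B. (if l = i then [:0, 1:] else [:z l:]) * [:b l j:]"])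
      fix j s
      show "P (z(i := s)) j = poly (\<Sum>l<card B. (if l = i then [:0, 1:] else [:z l:]) * [:b l j:]) s"
        unfolding P_def sum_fun_apply poly_sum by (intro sum.cong refl) simp
    qed
  qed
  then obtain z where z: "\<And>i. i < card B \<Longrightarrow> z i \<in> range eM" "mpeval m ?g S c (P z) \<noteq> 0" by blast
  have "P z \<in> T.fixed_points"
    unfolding T.fixed_points_def
  proof (intro CollectI conjI ballI)
    have bB: "b i \<in> T.fixed_points" if "i < card B" for i
      using b B(1) that unfolding bij_betw_def by blast
    then have bc: "b i \<in> coords m" if "i < card B" for i using that unfolding T.fixed_points_def by blast
    show "P z \<in> coords m" unfolding P_def
      by (intro fs.subspace_sum[OF subspace_coords] fs.subspace_scale[OF subspace_coords] bc) simp
    fix \<sigma> assume \<sigma>: "\<sigma> \<in> Aut eM"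
    show "T.act \<sigma> (P z) = P z"
      unfolding P_def T.act_sum[OF \<sigma>] T.act_scale[OF \<sigma>]
    proof (rule sum.cong[OF refl])
      fix i assume "i \<in> {..<card B}"
      then have i: "i < card B" by simp
      have "\<sigma> (z i) = z i" using z(1)[OF i] T.autD(3)[OF \<sigma>] by auto
      moreover have "T.act \<sigma> (b i) = b i" using bB[OF i] \<sigma> unfolding T.fixed_points_def by blast
      ultimately show "(\<lambda>j. \<sigma> (z i) * T.act \<sigma> (b i) j) = (\<lambda>j. z i * b i j)" by simp
    qed
  qed
  then show ?thesis using z(2) by blast
qed

theorem exists_specialization:
  fixes eL :: "'k \<Rightarrow> 'l::field" and eM :: "'l \<Rightarrow> 'm::field"
  assumes inf: "infinite (UNIV :: 'k set)" and eL: "field_hom eL"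
    and galois: "galois_ext eM" and iso: "aut_group eM \<cong> units_group n \<A>"
  shows "\<exists>\<zeta> b. (\<forall>i<n. specializes m eK t eL \<zeta> (a i) (b i)) \<and> is_splitting_field eM (f_poly q n b)"
proof -
  obtain \<phi> where \<phi>: "\<phi> \<in> iso (aut_group eM) (units_group n \<A>)" using iso unfolding is_iso_def by blast
  have hL: "field_hom (eL \<circ> eF)" by (rule hom_comp[OF eL])
  interpret T: twisted_galois \<A> n m v eM "eL \<circ> eF" \<phi>
    using galois hL \<phi> by unfold_locales
  note eM = T.eM
  let ?g = "eM \<circ> eL"
  have g: "field_hom ?g" by (rule field_hom_comp[OF eM eL])
  have hg: "T.h = ?g \<circ> eF" by (simp add: comp_assoc)
  have h: "field_hom (?g \<circ> eF)" by (rule hom_comp[OF g])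
  let ?A = "range (\<lambda>(i, j). N i j) \<union> range (\<lambda>(i, j). Ninv i j) \<union> a ` {..<n}"
  have fin: "finite ?A"
  proof -
    have "range (\<lambda>(i, j). M i j) \<subseteq> (\<lambda>(i, j). M i j) ` ({..<n} \<times> {..<n}) \<union> {0}" if "M \<in> Mn n" for M :: "nat \<Rightarrow> nat \<Rightarrow> 'K"
    proof
      fix y assume "y \<in> range (\<lambda>(i, j). M i j)"
      then obtain i j where y: "y = M i j" by auto
      show "y \<in> (\<lambda>(i, j). M i j) ` ({..<n} \<times> {..<n}) \<union> {0}"
      proof (cases "i < n \<and> j < n")
        case True
        then show ?thesis unfolding y by (intro UnI1 image_eqI[of _ _ "(i, j)"]) auto
      next
        case False
        then have "M i j = 0" using that unfolding Mn_def by auto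
        then show ?thesis unfolding y by simp
      qed
    qed
    note sub = this
    have "finite (range (\<lambda>(i, j). M i j))" if "M \<in> Mn n" for M :: "nat \<Rightarrow> nat \<Rightarrow> 'K"
      by (rule finite_subset[OF sub[OF that]]) simp
    note this[OF N(1)] this[OF N(2)]
    then show ?thesis by simp
  qed
  obtain S c where S: "finite S" "S \<subseteq> exps m" "mpeval m eK S c t \<noteq> 0"
    and "\<forall>(g :: 'k \<Rightarrow> 'l) \<zeta>. field_hom g \<longrightarrow> mpeval m g S c \<zeta> \<noteq> 0
      \<longrightarrow> (\<forall>y\<in>?A. \<exists>b. specialization.rrel m eK g t \<zeta> y b)"
    using common_denominator[OF t fin, where ?'b = 'l] by (elim exE conjE)
  note den = this(4)[rule_format, OF eL]
  \<comment> \<open>The denominator is evaluated at \<open>\<xi>\<close> because the parameters of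
    the specialization will be values of \<open>\<xi>\<close> at a fixed point.\<close>
  have "mpeval m eK S c \<xi> \<noteq> 0"
  proof
    assume "mpeval m eK S c \<xi> = 0"
    then have "\<forall>\<alpha>\<in>S. c \<alpha> = 0" using \<xi>_alg_indep S unfolding alg_indep_def by blast
    then have "mpeval m eK S c t = 0" by (intro mpeval_zero[OF eK]) blast
    then show False using S(3) by blast
  qed
  moreover have "mpeval m eK S c \<xi> \<in> rat_funs m eK t" using t unfolding rat_fun_field_iff by blast
  ultimately obtain R P Q where R: "finite R" "R \<subseteq> exps m" "mpeval m eK R Q t \<noteq> 0"
    and DQ: "mpeval m eK S c \<xi> = mpeval m eK R P t / mpeval m eK R Q t" and Pnz: "mpeval m eK R P t \<noteq> 0"
    unfolding rat_funs_def by auto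
  interpret K: specialization m eK eK t t using eK by unfold_locales
  \<comment> \<open>Nonvanishing of this product at \<open>x\<close> has three uses: the last factor
    makes U a unit, the middle one lets the denominator at \<open>\<xi>\<close> be evaluated at
    \<open>x\<close>, and the first one makes that value nonzero.\<close>
  let ?W = "mpeval m eK R P t * (mpeval m eK R Q t * \<delta> eK t)"
  have "K.prel ?W ?W" using R by (intro K.prel_mult K.prelI prel_\<delta>[OF eK])
  then obtain S' c' where S': "finite S'" "S' \<subseteq> exps m" "?W = mpeval m eK S' c' t"
    unfolding K.prel_def by blast
  have "mpeval m eK S' c' t \<noteq> 0" using R(3) Pnz \<delta>_t unfolding S'(3)[symmetric] by simp
  then obtain x where x: "x \<in> T.fixed_points" "mpeval m ?g S' c' x \<noteq> 0"
    using nonzero_at_fixed_point[OF inf eL T.twisted_galois_axioms] by blast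
  have xc: "x \<in> coords m" using x(1) unfolding T.fixed_points_def by blast
  interpret A: specialization m eK ?g t x using eK g by unfold_locales
  have "A.prel ?W (mpeval m ?g R P x * (mpeval m ?g R Q x * \<delta> ?g x))"
    using R by (intro A.prel_mult A.prelI prel_\<delta>[OF g])
  moreover have "A.prel ?W (mpeval m ?g S' c' x)" unfolding S'(3) using S' by (intro A.prelI)
  ultimately have "mpeval m ?g R P x * (mpeval m ?g R Q x * \<delta> ?g x) \<noteq> 0"
    using x(2) A.rrel_functional[OF t_indep A.prel_imp_rrel A.prel_imp_rrel] by metis
  then have nz: "mpeval m ?g R P x \<noteq> 0" "mpeval m ?g R Q x \<noteq> 0" "\<delta> ?g x \<noteq> 0" by auto
  let ?U = "emb (?g \<circ> eF) x"
  obtain w where w: "w \<in> coords m" "mat_mul n ?U (emb (?g \<circ> eF) w) = mat_one n"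
    using \<delta>_inverse[OF g nz(3)] by blast
  have w': "mat_mul n (emb (?g \<circ> eF) w) ?U = mat_one n" by (rule mat_left_inverse_imp_right[OF w(2)])
  note F = frob_hom[OF g]
  \<comment> \<open>Coordinates of \<open>U^(-1) U^(q)\<close>. Conjugation multiplies U on the left
    by a constant fixed by Frobenius, which cancels, so \<open>z\<close> descends to L.\<close>
  define z where "z = mulc (?g \<circ> eF) w (\<lambda>i. x i ^ q)"
  have Uz: "mat_mul n ?U (emb (?g \<circ> eF) z) = emb (?g \<circ> eF) (\<lambda>i. x i ^ q)"
    unfolding z_def emb_mulc[OF h] mat_mul_assoc[symmetric] w(2) by (rule mat_mul_one_left[OF emb_Mn[OF h]])
  then have UzF: "mat_mul n ?U (emb (?g \<circ> eF) z) = mpow q ?U"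
    unfolding frob_emb[OF g, of x] .
  have "z i \<in> range eM" if i: "i < m" for i
  proof (rule T.fixed_in_range)
    fix \<sigma> assume \<sigma>: "\<sigma> \<in> Aut eM"
    note \<sigma>h = T.autD(1)[OF \<sigma>]
    have e: "mmap \<sigma> (emb (?g \<circ> eF) y) = emb (?g \<circ> eF) (\<lambda>i. \<sigma> (y i))" for y
      using T.mmap_aut[OF \<sigma>, of y] unfolding hg .
    have tw: "mat_mul n (mmap (?g \<circ> eF) (\<phi> \<sigma>)) (mmap \<sigma> ?U) = ?U"
      using x(1) T.emb_act[OF \<sigma>, of x] \<sigma> unfolding hg T.fixed_points_def by simp
    have F\<phi>: "mpow q (mmap (?g \<circ> eF) (\<phi> \<sigma>)) = mmap (?g \<circ> eF) (\<phi> \<sigma>)"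
      using frob_fixed_iff[OF h] unfolding q by (intro ext) simp
    have "mat_mul n ?U (emb (?g \<circ> eF) (\<lambda>i. \<sigma> (z i)))
      = mat_mul n (mat_mul n (mmap (?g \<circ> eF) (\<phi> \<sigma>)) (mmap \<sigma> ?U)) (mmap \<sigma> (emb (?g \<circ> eF) z))"
      unfolding tw unfolding e ..
    also have "\<dots> = mat_mul n (mmap (?g \<circ> eF) (\<phi> \<sigma>)) (mmap \<sigma> (mat_mul n ?U (emb (?g \<circ> eF) z)))"
      unfolding mat_mul_assoc mmap_mat_mul[OF \<sigma>h] ..
    also have "\<dots> = mat_mul n (mmap (?g \<circ> eF) (\<phi> \<sigma>)) (mmap \<sigma> (mpow q ?U))"
      unfolding UzF ..
    also have "\<dots> = mat_mul n (mpow q (mmap (?g \<circ> eF) (\<phi> \<sigma>))) (mpow q (mmap \<sigma> ?U))"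
      unfolding F\<phi> by (simp add: field_hom_power[OF \<sigma>h])
    also have "\<dots> = mpow q (mat_mul n (mmap (?g \<circ> eF) (\<phi> \<sigma>)) (mmap \<sigma> ?U))"
      by (rule mmap_mat_mul[OF F, symmetric])
    also have "\<dots> = mat_mul n ?U (emb (?g \<circ> eF) z)" unfolding tw UzF ..
    finally have "emb (?g \<circ> eF) (\<lambda>i. \<sigma> (z i)) = emb (?g \<circ> eF) z"
      by (rule mat_mul_left_cancel[OF w' emb_Mn[OF h] emb_Mn[OF h]])
    then show "\<sigma> (z i) = z i" using emb_inj'[OF h] i by blast
  qed
  then have "\<forall>i\<in>{..<m}. \<exists>y. z i = eM y" by blast
  from bchoice[OF this] obtain \<zeta> where \<zeta>: "\<And>i. i < m \<Longrightarrow> z i = eM (\<zeta> i)" by auto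
  have "A.rrel (mpeval m eK S c \<xi>) (mpeval m ?g S c z)"
    by (rule A.rrel_mpeval) (rule rrel_\<xi>[OF g nz(3) Uz])
  moreover have "A.rrel (mpeval m eK S c \<xi>) (mpeval m ?g R P x / mpeval m ?g R Q x)"
    unfolding DQ using R nz by (intro A.rrelI A.prelI)
  ultimately have "mpeval m ?g S c z = mpeval m ?g R P x / mpeval m ?g R Q x"
    by (rule A.rrel_functional[OF t_indep])
  then have "mpeval m ?g S c z \<noteq> 0" using nz by simp
  moreover have "mpeval m ?g S c z = eM (mpeval m eL S c \<zeta>)"
    unfolding mpeval_hom[OF eM, symmetric] by (rule mpeval_cong) (rule \<zeta>)
  ultimately have den_nz: "mpeval m eL S c \<zeta> \<noteq> 0" by (auto simp: field_homD[OF eM])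
  interpret L: specialization m eK eL t \<zeta> using eK eL by unfold_locales
  define N' where "N' i j = (SOME y. L.rrel (N i j) y)" for i j
  define Ni' where "Ni' i j = (SOME y. L.rrel (Ninv i j) y)" for i j
  \<comment> \<open>Only the values with \<open>i < n\<close> matter: \<open>Delta\<close> and
    \<open>f_poly\<close> read no others.\<close>
  define b where "b i = (SOME y. L.rrel (a i) y)" for i
  have N': "L.rrel (N i j) (N' i j)" for i j
  proof -
    have "N i j \<in> ?A" using rangeI[of "\<lambda>(i, j). N i j" "(i, j)"] by simp
    from someI_ex[OF den[OF den_nz this]] show ?thesis unfolding N'_def .
  qed
  have Ni': "L.rrel (Ninv i j) (Ni' i j)" for i j
  proof -
    have "Ninv i j \<in> ?A" using rangeI[of "\<lambda>(i, j). Ninv i j" "(i, j)"] by simp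
    from someI_ex[OF den[OF den_nz this]] show ?thesis unfolding Ni'_def .
  qed
  have b: "L.rrel (a i) (b i)" if "i < n" for i
  proof -
    have "a i \<in> ?A" using that by simp
    from someI_ex[OF den[OF den_nz this]] show ?thesis unfolding b_def .
  qed
  note func = L.rrel_functional[OF t_indep]
  \<comment> \<open>Single-valuedness transfers identities: two matrices that specialize the same
    matrix over K are equal. The inverse relation and the companion equation pass to L this
    way.\<close>
  have eqI: "M' = M''" if "\<And>i j. L.rrel (M i j) (M' i j)" "\<And>i j. L.rrel (M i j) (M'' i j)" for M M' M''
    using func that by blast
  have one: "L.rrel (mat_one n i j) (mat_one n i j)" for i j
    unfolding mat_one_def using L.rrel_0 L.rrel_1 by auto
  have N'_one: "mat_mul n N' Ni' = mat_one n"
  proof (rule eqI)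
    show "L.rrel (mat_one n i j) (mat_mul n N' Ni' i j)" for i j
      unfolding N(3)[symmetric] by (intro L.rrel_mat_mul N' Ni')
  qed (rule one)
  have T': "L.rrel (emb (eK \<circ> eF) t i j) (emb (eL \<circ> eF) \<zeta> i j)" for i j
    unfolding emb_def comp_apply
    by (intro L.rrel_sum L.rrel_mult L.prel_imp_rrel[OF L.prel_var] L.prel_imp_rrel[OF L.prel_const]) auto
  have D': "L.rrel (Delta n a i j) (Delta n b i j)" for i j
    unfolding Delta_def using L.rrel_0 L.rrel_1 b by auto
  have Delta': "mat_mul n (mat_mul n Ni' (emb (eL \<circ> eF) \<zeta>)) (mpow q N') = Delta n b"
  proof (rule eqI)
    show "L.rrel (Delta n a i j) (mat_mul n (mat_mul n Ni' (emb (eL \<circ> eF) \<zeta>)) (mpow q N') i j)" for i j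
      unfolding Delta[symmetric] by (intro L.rrel_mat_mul L.rrel_power Ni' T' N')
  qed (rule D')
  have N'_Mn: "N' \<in> Mn n"
    using N(1) N' L.rrel_eq_0[OF t_indep] unfolding Mn_def by blast
  interpret M: frobenius_field "?g \<circ> eF" q using h q by unfold_locales
  interpret FL: frobenius_field "eL \<circ> eF" q using hL q by unfold_locales
  define Z where "Z = mat_mul n ?U (mmap eM N')"
  define Zi where "Zi = mat_mul n (mmap eM Ni') (emb (?g \<circ> eF) w)"
  have eN: "mat_mul n (mmap eM N') (mmap eM Ni') = mat_one n"
    unfolding mmap_mat_mul[OF eM, symmetric] N'_one mmap_mat_one[OF eM] ..
  have emb\<zeta>: "mmap eM (emb (eL \<circ> eF) \<zeta>) = emb (?g \<circ> eF) z"
    unfolding mmap_emb[OF eM] comp_assoc[symmetric] by (rule emb_cong) (simp add: \<zeta>)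
  have De: "Delta n (\<lambda>i. eM (b i)) = mat_mul n (mat_mul n (mmap eM Ni') (emb (?g \<circ> eF) z)) (mpow q (mmap eM N'))"
  proof -
    have "Delta n (\<lambda>i. eM (b i)) = mmap eM (mat_mul n (mat_mul n Ni' (emb (eL \<circ> eF) \<zeta>)) (mpow q N'))"
      unfolding Delta' by (rule mmap_Delta[OF eM, symmetric])
    also have "\<dots> = mat_mul n (mat_mul n (mmap eM Ni') (mmap eM (emb (eL \<circ> eF) \<zeta>))) (mmap eM (mpow q N'))"
      unfolding mmap_mat_mul[OF eM] ..
    finally show ?thesis unfolding emb\<zeta> by (simp add: field_hom_power[OF eM])
  qed
  have ZZi: "mat_mul n Z Zi = mat_one n" and ZD: "mpow q Z = mat_mul n Z (Delta n (\<lambda>i. eM (b i)))"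
    using M.solution_times[OF w(2) emb_Mn[OF h] eN UzF De[symmetric]] unfolding Z_def Zi_def by auto
  have Z_Mn: "Z \<in> Mn n" unfolding Z_def by simp
  have card: "card {y. poly (f_poly q n (\<lambda>i. eM (b i))) y = 0} = q ^ n"
    by (rule M.card_roots_of_solution[OF n_pos Z_Mn ZZi ZD])
  have map: "map_poly eM (f_poly q n b) = f_poly q n (\<lambda>i. eM (b i))" by (rule map_f_poly[OF eM])
  let ?R = "{y. poly (f_poly q n (\<lambda>i. eM (b i))) y = 0}"
  let ?S = "gen_field (range eM \<union> ?R)"
  have S_sub: "is_subfield ?S" by (rule is_subfield_gen_field)
  have eMS: "range eM \<subseteq> ?S" and RS: "?R \<subseteq> ?S" using gen_field_superset[of "range eM \<union> ?R"] by auto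
  have ZS: "Z i j \<in> ?S" for i j
  proof (cases "i < n \<and> j < n")
    case True
    then have "Z i 0 \<in> ?S" using M.solution_entries(2)[OF Z_Mn ZD, of i j] RS by blast
    then show ?thesis
      using M.solution_entries(1)[OF Z_Mn ZD, of i j] True is_subfield_power[OF S_sub] by simp
  next
    case False
    then have "Z i j = 0" using Z_Mn unfolding Mn_def by auto
    then show ?thesis using is_subfieldD(1)[OF S_sub] by simp
  qed
  \<comment> \<open>Powers of roots give the entries of \<open>Z\<close>, and the specialized
    inverse of N recovers U from \<open>Z\<close>. So the field of the roots contains the entries of
    U, which generate the whole extension.\<close>
  have U_eq: "?U = mat_mul n Z (mmap eM Ni')"
    unfolding Z_def mat_mul_assoc eN by (rule mat_mul_one_right[OF emb_Mn[OF h], symmetric])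
  have US: "emb T.h x i j \<in> ?S" for i j
    unfolding hg by (subst U_eq) (rule is_subfield_mat_mul[OF S_sub], use ZS eMS in auto)
  have "?S = UNIV"
    by (rule T.generated_by_fixed_point[OF S_sub eMS x(1) _ US]) (use w(2) in \<open>simp add: hg\<close>)
  moreover have "splits_in eM (f_poly q n b)"
    using M.product_of_card_roots[OF n_pos card] M.lead_coeff_f[OF n_pos, of "\<lambda>i. eM (b i)"]
    unfolding splits_in_def map by auto
  moreover have "f_poly q n b \<noteq> 0" using FL.lead_coeff_f[OF n_pos, of b] by auto
  ultimately have "is_splitting_field eM (f_poly q n b)"
    unfolding is_splitting_field_def map using eM by blast
  moreover have "\<forall>i<n. specializes m eK t eL \<zeta> (a i) (b i)" using b L.rrel_specializes by blast
  ultimately show ?thesis by blast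
qed

end

text \<open>Fields are types and extensions are embeddings, so the quantification over splitting
  fields and over Galois extensions is carried by the free types of \<open>eE\<close>,
  \<open>eL\<close> and \<open>eM\<close>.\<close>

theorem theorem4p9:
  fixes \<A> :: "(nat \<Rightarrow> nat \<Rightarrow> 'f::{finite,field}) set"
    and n m q :: nat
    and v :: "nat \<Rightarrow> nat \<Rightarrow> nat \<Rightarrow> 'f"
    and eF :: "'f \<Rightarrow> 'k::field"
    and eK :: "'k \<Rightarrow> 'K::field"
    and t :: "nat \<Rightarrow> 'K"
    and N Ninv :: "nat \<Rightarrow> nat \<Rightarrow> 'K"
    and a :: "nat \<Rightarrow> 'K"
    and eE :: "'K \<Rightarrow> 'E::field"
    and eL :: "'k \<Rightarrow> 'L::field"
    and eM :: "'L \<Rightarrow> 'M::field"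
  assumes "q = card (UNIV :: 'f set)"
    and "0 < n"
    and "is_subalgebra n \<A>"
    and "is_basis n \<A> m v"
    and "infinite (UNIV :: 'k set)"
    and "field_hom eF"
    and "is_rat_fun_field m eK t"
    and "N \<in> Mn n" and "Ninv \<in> Mn n"
    and "\<forall>i j. N i j \<in> rat_funs m (eK \<circ> eF) t"
    and "mat_mul n N Ninv = mat_one n" and "mat_mul n Ninv N = mat_one n"
    and "mat_mul n (mat_mul n Ninv (\<lambda>r s. \<Sum>i<m. t i * eK (eF (v i r s))))
           (\<lambda>r s. N r s ^ q) = Delta n a"
  shows "coprime (f_poly q n a) (pderiv (f_poly q n a))
     \<and> (is_splitting_field eE (f_poly q n a) \<longrightarrow> aut_group eE \<cong> units_group n \<A>)
     \<and> (field_hom eL \<and> galois_ext eM \<and> aut_group eM \<cong> units_group n \<A> \<longrightarrow>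
          (\<exists>\<xi> b. (\<forall>i<n. specializes m eK t eL \<xi> (a i) (b i))
                 \<and> is_splitting_field eM (f_poly q n b)))"
proof -
  have "matrix_algebra \<A> n m v" using assms by unfold_locales
  note emb_def = matrix_algebra.emb_def[OF this]
  interpret generic_equation \<A> n m v eF eK t q N Ninv a
    using assms by unfold_locales (simp_all add: emb_def)
  interpret E: frobenius_field "eK \<circ> eF" q using hom_comp[OF eK] q by unfold_locales
  \<comment> \<open>The derivative is the constant \<open>- a 0\<close>, which is nonzero and hence
    a unit.\<close>
  have "coprime (f_poly q n a) (pderiv (f_poly q n a))"
    unfolding E.pderiv_f[OF n_pos] using a_0_nonzero
    by (intro is_unit_right_imp_coprime) (simp add: is_unit_pCons_iff)
  then show ?thesis using aut_group_iso exists_specialization[OF assms(5)] by blast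
qed

end
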